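(* Let $K$ be a compact convex subset with non-empty interior in $E:=\mathbb{R}^n$ and $r\in\mathbb{N}\cup\{\infty\}$. Then $\operatorname{Diff}^{C^r}_{\partial K}(K)$ is a smooth submanifold of $C^r(K,E)$ modelled on the closed vector subspace $C^r_{\partial K}(K,E)$ of $C^r(K,E)$. Moreover, $\operatorname{Diff}^{C^r}_{\partial K}(K)$ admits a global chart.
   Context: $\mathbb{N}=\{1,2,\dots\}$. A map $f\colon K\to E$ is $C^r$ if it is continuous, $f|_{K^0}$ is $C^r$ on the interior $K^0$, and for all $k\in\mathbb{N}$ with $k\le r$ the iterated directional derivative $d^{(k)}(f|_{K^0})\colon K^0\times E^k\to E$, $(x,y_1,\dots,y_k)\mapsto(D_{y_k}\cdots D_{y_1}f)(x)$ has a continuous extension $d^{(k)}f\colon K\times E^k\to E$. $C^r(K,E)$, the space of all such maps, carries the compact-open $C^r$-topology, i.e. the initial topology with respect to the maps $f\mapsto d^{(k)}f\in C(K\times E^k,E)$ ($k\in\mathbb{N}_0$, $k\le r$, $d^{(0)}f=f$), with compact-open topologies on the targets. $C^r_{\partial K}(K,E)=\{\gamma\in C^r(K,E):\gamma|_{\partial K}=0\}$. $\operatorname{Diff}^{C^r}_{\partial K}(K)$ is the group of all bijections $\phi\colon K\to K$ such that $\phi$ and $\phi^{-1}$ are $C^r$ and $\phi|_{\partial K}=\operatorname{id}_{\partial K}$. Smooth means $C^\infty$ in the sense of Bastiani (continuous, with all iterated directional derivatives existing and jointly continuous). A subset $N$ of a smooth manifold $M$ modelled on a locally convex space $X$ is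 a smooth submanifold modelled on a closed vector subspace $Y\subseteq X$ if around each point of $N$ there is a chart $\kappa\colon W\to W'\subseteq X$ of $M$ with $\kappa(W\cap N)=W'\cap Y$; $N$ is then a smooth manifold modelled on $Y$ with the charts $\kappa|_{W\cap N}$. *)

theory Defs
  imports
    "HOL-Analysis.Analysis"
    "HOL-Library.Function_Algebras"
    "HOL-Library.Extended_Nat"
begin

section \<open>Pointwise vector space structure on functions\<close>

instantiation "fun" :: (type, real_vector) real_vector
begin

definition scaleR_fun :: "real \<Rightarrow> ('a \<Rightarrow> 'b) \<Rightarrow> 'a \<Rightarrow> 'b"
  where "scaleR_fun c f = (\<lambda>x. c *\<^sub>R f x)"

instance
  by standard
    (simp_all add: scaleR_fun_def plus_fun_def fun_eq_iff scaleR_add_right scaleR_add_left)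

end

section \<open>Locally convex spaces and Bastiani calculus\<close>

text \<open>A locally convex space is given by a topology whose underlying set is a linear subspace
  of an ambient real vector space; linear subspaces of it are obtained with \<^const>\<open>subtopology\<close>.
  Locally convex spaces are Hausdorff.\<close>

definition locally_convex_space :: "'a::real_vector topology \<Rightarrow> bool" where
  "locally_convex_space X \<longleftrightarrow>
     subspace (topspace X) \<and> Hausdorff_space X \<and>
     continuous_map (prod_topology X X) X (\<lambda>(x, y). x + y) \<and>
     continuous_map (prod_topology euclideanreal X) X (\<lambda>(t, x). t *\<^sub>R x) \<and>
     (\<forall>U. openin X U \<and> 0 \<in> U \<longrightarrow> (\<exists>V. openin X V \<and> convex V \<and> 0 \<in> V \<and> V \<subseteq> U))"

definition has_dir_deriv ::
  "'b::real_vector topology \<Rightarrow> ('a::real_vector \<Rightarrow> 'b) \<Rightarrow> 'a \<Rightarrow> 'a \<Rightarrow> 'b \<Rightarrow> bool" where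
  "has_dir_deriv F f x v l \<longleftrightarrow>
     limitin F (\<lambda>t::real. (f (x + t *\<^sub>R v) - f x) /\<^sub>R t) l (at 0)"

definition dir_deriv ::
  "'b::real_vector topology \<Rightarrow> ('a::real_vector \<Rightarrow> 'b) \<Rightarrow> 'a \<Rightarrow> 'a \<Rightarrow> 'b" where
  "dir_deriv F f x v = (THE l. has_dir_deriv F f x v l)"

text \<open>\<open>iter_dir_deriv F f k x y\<close> is \<open>(D\<^bsub>y (k-1)\<^esub> \<dots> D\<^bsub>y 0\<^esub> f)(x)\<close>: the directions are indexed from
  \<open>0\<close>, and the derivative in direction \<open>y 0\<close> is taken first.\<close>

primrec iter_dir_deriv ::
  "'b::real_vector topology \<Rightarrow> ('a::real_vector \<Rightarrow> 'b) \<Rightarrow> nat \<Rightarrow> 'a \<Rightarrow> (nat \<Rightarrow> 'a) \<Rightarrow> 'b" where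
  "iter_dir_deriv F f 0 x y = f x"
| "iter_dir_deriv F f (Suc k) x y = dir_deriv F (\<lambda>z. iter_dir_deriv F f k z y) x (y k)"

abbreviation power_topology :: "'a topology \<Rightarrow> nat \<Rightarrow> (nat \<Rightarrow> 'a) topology" where
  "power_topology X k \<equiv> product_topology (\<lambda>_. X) {..<k}"

text \<open>\<open>f\<close> is \<open>C\<^sup>r\<close> in Bastiani's sense as a map from the open subset \<open>U\<close> of \<open>X\<close> to \<open>F\<close>. The values of
  \<open>f\<close> outside \<open>U\<close> are irrelevant. The case \<open>k = 0\<close> says that \<open>f\<close> is continuous.\<close>

definition bastiani_C ::
  "enat \<Rightarrow> 'a::real_vector topology \<Rightarrow> 'b::real_vector topology \<Rightarrow> 'a set \<Rightarrow> ('a \<Rightarrow> 'b) \<Rightarrow> bool" where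
  "bastiani_C r X F U f \<longleftrightarrow> openin X U \<and>
     (\<forall>k. enat (Suc k) \<le> r \<longrightarrow>
        (\<forall>x\<in>U. \<forall>y \<in> topspace (power_topology X (Suc k)).
           \<exists>l. has_dir_deriv F (\<lambda>z. iter_dir_deriv F f k z y) x (y k) l)) \<and>
     (\<forall>k. enat k \<le> r \<longrightarrow>
        continuous_map (prod_topology (subtopology X U) (power_topology X k)) F
          (\<lambda>(x, y). iter_dir_deriv F f k x y))"

abbreviation bastiani_smooth ::
  "'a::real_vector topology \<Rightarrow> 'b::real_vector topology \<Rightarrow> 'a set \<Rightarrow> ('a \<Rightarrow> 'b) \<Rightarrow> bool" where
  "bastiani_smooth \<equiv> bastiani_C \<infinity>"

section \<open>Manifolds modelled on locally convex spaces\<close>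

text \<open>Charts are pairs \<open>(W, \<kappa>)\<close> of a chart domain and a map, of which only the restriction to
  \<open>W\<close> matters.\<close>

definition is_chart :: "'x topology \<Rightarrow> 'm topology \<Rightarrow> 'm set \<times> ('m \<Rightarrow> 'x) \<Rightarrow> bool" where
  "is_chart X M = (\<lambda>(W, \<kappa>). openin M W \<and> openin X (\<kappa> ` W) \<and>
     homeomorphic_map (subtopology M W) (subtopology X (\<kappa> ` W)) \<kappa>)"

definition smooth_transition ::
  "'x::real_vector topology \<Rightarrow> 'm set \<times> ('m \<Rightarrow> 'x) \<Rightarrow> 'm set \<times> ('m \<Rightarrow> 'x) \<Rightarrow> bool" where
  "smooth_transition X = (\<lambda>(W1, \<kappa>1) (W2, \<kappa>2).
     bastiani_smooth X X (\<kappa>1 ` (W1 \<inter> W2)) (\<kappa>2 \<circ> inv_into W1 \<kappa>1))"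

definition smooth_compatible ::
  "'x::real_vector topology \<Rightarrow> 'm set \<times> ('m \<Rightarrow> 'x) \<Rightarrow> 'm set \<times> ('m \<Rightarrow> 'x) \<Rightarrow> bool" where
  "smooth_compatible X c d \<longleftrightarrow> smooth_transition X c d \<and> smooth_transition X d c"

definition smooth_manifold ::
  "'x::real_vector topology \<Rightarrow> 'm topology \<Rightarrow> ('m set \<times> ('m \<Rightarrow> 'x)) set \<Rightarrow> bool" where
  "smooth_manifold X M A \<longleftrightarrow> locally_convex_space X \<and> Hausdorff_space M \<and>
     (\<forall>c\<in>A. is_chart X M c) \<and> topspace M = (\<Union>c\<in>A. fst c) \<and>
     (\<forall>c\<in>A. \<forall>d\<in>A. smooth_compatible X c d)"

text \<open>The charts of the manifold with atlas \<open>A\<close>.\<close>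

definition maximal_atlas ::
  "'x::real_vector topology \<Rightarrow> 'm topology \<Rightarrow> ('m set \<times> ('m \<Rightarrow> 'x)) set
     \<Rightarrow> ('m set \<times> ('m \<Rightarrow> 'x)) set" where
  "maximal_atlas X M A = {c. is_chart X M c \<and> (\<forall>a\<in>A. smooth_compatible X c a)}"

definition adapted_chart :: "'x set \<Rightarrow> 'm set \<Rightarrow> 'm set \<times> ('m \<Rightarrow> 'x) \<Rightarrow> bool" where
  "adapted_chart Y N = (\<lambda>(W, \<kappa>). \<kappa> ` (W \<inter> N) = \<kappa> ` W \<inter> Y)"

definition smooth_submanifold ::
  "'x::real_vector topology \<Rightarrow> 'm topology \<Rightarrow> ('m set \<times> ('m \<Rightarrow> 'x)) set
     \<Rightarrow> 'x set \<Rightarrow> 'm set \<Rightarrow> bool" where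
  "smooth_submanifold X M A Y N \<longleftrightarrow>
     smooth_manifold X M A \<and> subspace Y \<and> closedin X Y \<and> N \<subseteq> topspace M \<and>
     (\<forall>p\<in>N. \<exists>c \<in> maximal_atlas X M A. p \<in> fst c \<and> adapted_chart Y N c)"

definition submanifold_atlas ::
  "'x::real_vector topology \<Rightarrow> 'm topology \<Rightarrow> ('m set \<times> ('m \<Rightarrow> 'x)) set
     \<Rightarrow> 'x set \<Rightarrow> 'm set \<Rightarrow> ('m set \<times> ('m \<Rightarrow> 'x)) set" where
  "submanifold_atlas X M A Y N =
     {(W \<inter> N, \<kappa>) |W \<kappa>. (W, \<kappa>) \<in> maximal_atlas X M A \<and> adapted_chart Y N (W, \<kappa>)}"

definition submanifold_has_global_chart ::
  "'x::real_vector topology \<Rightarrow> 'm topology \<Rightarrow> ('m set \<times> ('m \<Rightarrow> 'x)) set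
     \<Rightarrow> 'x set \<Rightarrow> 'm set \<Rightarrow> bool" where
  "submanifold_has_global_chart X M A Y N \<longleftrightarrow>
     (\<exists>\<kappa>. (N, \<kappa>) \<in> maximal_atlas (subtopology X Y) (subtopology M N)
                     (submanifold_atlas X M A Y N))"

text \<open>A locally convex space, considered as a manifold modelled on itself.\<close>

definition lcs_atlas :: "'x topology \<Rightarrow> ('x set \<times> ('x \<Rightarrow> 'x)) set" where
  "lcs_atlas X = {(topspace X, id)}"

section \<open>Spaces of differentiable functions\<close>

definition compact_open_topology :: "'a topology \<Rightarrow> 'b topology \<Rightarrow> ('a \<Rightarrow> 'b) topology" where
  "compact_open_topology X Y = topology_generated_by
     {{g \<in> extensional (topspace X). continuous_map X Y g \<and> g ` C \<subseteq> V} |C V.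
        compactin X C \<and> openin Y V}"

text \<open>The initial topology on \<open>S\<close> with respect to the maps \<open>f i\<close> into \<open>T i\<close>, \<open>i \<in> I\<close>.\<close>

definition initial_topology :: "'a set \<Rightarrow> 'i set \<Rightarrow> ('i \<Rightarrow> 'a \<Rightarrow> 'b) \<Rightarrow> ('i \<Rightarrow> 'b topology) \<Rightarrow> 'a topology" where
  "initial_topology S I f T = topology_generated_by
     (insert S {S \<inter> f i -` V |i V. i \<in> I \<and> openin (T i) V})"

context
  fixes K :: "'a::euclidean_space set"
begin

abbreviation dom_top :: "nat \<Rightarrow> ('a \<times> (nat \<Rightarrow> 'a)) topology" where
  "dom_top k \<equiv> prod_topology (top_of_set K) (power_topology euclidean k)"

definition is_ext_deriv :: "nat \<Rightarrow> ('a \<Rightarrow> 'b::euclidean_space) \<Rightarrow> ('a \<times> (nat \<Rightarrow> 'a) \<Rightarrow> 'b) \<Rightarrow> bool" where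
  "is_ext_deriv k f g \<longleftrightarrow> g \<in> extensional (topspace (dom_top k)) \<and>
     continuous_map (dom_top k) euclidean g \<and>
     (\<forall>x \<in> interior K. \<forall>y \<in> topspace (power_topology euclidean k).
        g (x, y) = iter_dir_deriv euclidean f k x y)"

text \<open>The map \<open>d\<^sup>(\<^sup>k\<^sup>)f\<close> on \<open>K \<times> E\<^sup>k\<close>; it is unique if \<open>K\<close> is the closure of its interior. For \<open>k = 0\<close> it
  is \<open>f\<close> itself, up to the identification of \<open>K \<times> E\<^sup>0\<close> with \<open>K\<close>.\<close>

definition ext_deriv :: "nat \<Rightarrow> ('a \<Rightarrow> 'b::euclidean_space) \<Rightarrow> ('a \<times> (nat \<Rightarrow> 'a) \<Rightarrow> 'b)" where
  "ext_deriv k f = (THE g. is_ext_deriv k f g)"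

definition Cr_on :: "enat \<Rightarrow> ('a \<Rightarrow> 'b::euclidean_space) \<Rightarrow> bool" where
  "Cr_on r f \<longleftrightarrow> continuous_on K f \<and> bastiani_C r euclidean euclidean (interior K) f \<and>
     (\<forall>k\<ge>1. enat k \<le> r \<longrightarrow> (\<exists>g. is_ext_deriv k f g))"

text \<open>A function on \<open>K\<close> is represented by its extension by \<open>0\<close> to the whole type, so that
  the pointwise operations make \<open>Cr_space\<close> a linear subspace.\<close>

definition Cr_space :: "enat \<Rightarrow> ('a \<Rightarrow> 'b::euclidean_space) set" where
  "Cr_space r = {f. Cr_on r f \<and> (\<forall>x. x \<notin> K \<longrightarrow> f x = 0)}"

definition Cr_topology :: "enat \<Rightarrow> ('a \<Rightarrow> 'b::euclidean_space) topology" where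
  "Cr_topology r = initial_topology (Cr_space r) {k. enat k \<le> r} ext_deriv
     (\<lambda>k. compact_open_topology (dom_top k) euclidean)"

definition Cr_frontier :: "enat \<Rightarrow> ('a \<Rightarrow> 'b::euclidean_space) set" where
  "Cr_frontier r = {f \<in> Cr_space r. \<forall>x \<in> frontier K. f x = 0}"

definition Diff_frontier :: "enat \<Rightarrow> ('a \<Rightarrow> 'a) set" where
  "Diff_frontier r = {\<phi> \<in> Cr_space r. bij_betw \<phi> K K \<and> Cr_on r (inv_into K \<phi>) \<and>
     (\<forall>x \<in> frontier K. \<phi> x = x)}"

end

end

theory Submission
  imports Defs
begin

text \<open>A map in \<open>C\<^sup>r(K,E)\<close> that is the identity on \<open>\<partial>K\<close> is a diffeomorphism of the required kind iff
  its (extended) derivative is injective at every point of \<open>K\<close>. This is an open condition, as it can be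
  tested on the compact set of pairs of a point of \<open>K\<close> and a unit vector. Hence the diffeomorphism
  group is the intersection of an open set with the affine space \<open>id + C\<^sup>r\<^bsub>\<partial>K\<^esub>(K,E)\<close>, and \<open>\<phi> \<mapsto> \<phi> - id\<close> is a
  global submanifold chart.

  If the derivative of \<open>\<phi>\<close> is everywhere injective, then \<open>\<phi>\<close> is injective near each point of \<open>K\<close>, boundary
  points included, because \<open>K\<close> is convex and \<open>\<phi>\<close> is \<open>C\<^sup>1\<close> up to the boundary. Separating hyperplanes,
  connectedness and a compactness argument then give bijectivity. The inverse is \<open>C\<^sup>r\<close> up to the boundary
  by the usual induction, with derivatives taken within \<open>K\<close> throughout.\<close>

section \<open>Bastiani calculus\<close>

text \<open>The obstacle is the boundary of \<open>K\<close>. \<open>Cr_on\<close> speaks of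
  directional derivatives on the interior and of continuous extensions, and neither can be composed
  or inverted directly at a boundary point. Both are traded for Frechet derivatives within
  \<open>K\<close>: convexity and non-empty interior make these unique, mean value estimates on
  convex pieces of \<open>K\<close> replace arguments on open neighbourhoods, and no map is ever
  extended beyond \<open>K\<close>. \<open>Cr_on_iff\<close> is the bridge. The topology is accessed
  through the sup-norm balls \<open>Cr_ball\<close>, formed with these derivatives.

  On the manifold side, a global chart must be compatible with every adapted chart of the ambient
  space, not only with the one that it comes from. Bastiani smooth maps therefore have to be
  restricted to a closed subspace, whose closedness keeps the limits of difference quotients inside.

  The step from injective derivatives to bijectivity rests on invariance of domain: it makes the map
  open on the interior, while the fixed boundary supplies the global information.\<close>

lemma lcs_subspace: "locally_convex_space X \<Longrightarrow> subspace (topspace X)"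
  and lcs_Hausdorff: "locally_convex_space X \<Longrightarrow> Hausdorff_space X"
  by (simp_all add: locally_convex_space_def)

lemma lcs_continuous_add:
  assumes "locally_convex_space X" "continuous_map T X f" "continuous_map T X g"
  shows "continuous_map T X (\<lambda>t. f t + g t)"
proof -
  have "continuous_map (prod_topology X X) X (\<lambda>(x, y). x + y)"
    using assms(1) by (simp add: locally_convex_space_def)
  from continuous_map_compose[OF continuous_map_pairedI[OF assms(2,3)] this]
  show ?thesis by (simp add: o_def)
qed

lemma lcs_continuous_scaleR:
  assumes "locally_convex_space X" "continuous_map T euclideanreal a" "continuous_map T X f"
  shows "continuous_map T X (\<lambda>t. a t *\<^sub>R f t)"
proof -
  have "continuous_map (prod_topology euclideanreal X) X (\<lambda>(t, x). t *\<^sub>R x)"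
    using assms(1) by (simp add: locally_convex_space_def)
  from continuous_map_compose[OF continuous_map_pairedI[OF assms(2,3)] this]
  show ?thesis by (simp add: o_def)
qed

lemma locally_convex_space_subtopology:
  assumes X: "locally_convex_space X" and Y: "subspace Y" "Y \<subseteq> topspace X"
  shows "locally_convex_space (subtopology X Y)"
proof -
  let ?Y = "subtopology X Y"
  have top: "topspace ?Y = Y" using Y by auto
  have inX: "continuous_map T X f" if "continuous_map T ?Y f" for T and f :: "'b \<Rightarrow> 'a"
    using that by (simp add: continuous_map_in_subtopology)
  have fstc: "continuous_map (prod_topology ?Y ?Y) X fst" "continuous_map (prod_topology ?Y ?Y) X snd"
    and sndc: "continuous_map (prod_topology euclideanreal ?Y) X snd"
    using continuous_map_fst[of ?Y ?Y] continuous_map_snd[of ?Y ?Y]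
      continuous_map_snd[of euclideanreal ?Y] by (simp_all add: continuous_map_in_subtopology)
  have "continuous_map (prod_topology ?Y ?Y) ?Y (\<lambda>(x, y). x + y)"
    using lcs_continuous_add[OF X fstc] Y
    by (auto simp: continuous_map_in_subtopology case_prod_unfold top subspace_add)
  moreover have "continuous_map (prod_topology euclideanreal ?Y) ?Y (\<lambda>(t, x). t *\<^sub>R x)"
    using lcs_continuous_scaleR[OF X continuous_map_fst sndc] Y
    by (auto simp: continuous_map_in_subtopology case_prod_unfold top subspace_scale)
  moreover have "\<exists>V. openin ?Y V \<and> convex V \<and> 0 \<in> V \<and> V \<subseteq> U" if U: "openin ?Y U" "0 \<in> U" for U
  proof -
    obtain U' where U': "openin X U'" "U = U' \<inter> Y"
      using U by (auto simp: openin_subtopology)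
    then obtain V where "openin X V" "convex V" "0 \<in> V" "V \<subseteq> U'"
      using X U by (auto simp: locally_convex_space_def)
    with U' Y show ?thesis
      by (intro exI[of _ "V \<inter> Y"])
        (auto simp: openin_subtopology convex_Int subspace_imp_convex subspace_0)
  qed
  ultimately show ?thesis
    using lcs_Hausdorff[OF X] Y
    unfolding locally_convex_space_def top by (auto simp: Hausdorff_space_subtopology)
qed

lemma locally_convex_space_euclidean:
  "locally_convex_space (euclidean :: 'a::real_normed_vector topology)"
proof -
  have "\<exists>V. open V \<and> convex V \<and> 0 \<in> V \<and> V \<subseteq> U" if "open U" "0 \<in> U" for U :: "'a set"
    using that open_contains_ball[of U] centre_in_ball convex_ball open_ball by metis
  moreover have "continuous_map (prod_topology euclidean euclidean) euclidean (\<lambda>(x::'a, y). x + y)"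
    "continuous_map (prod_topology euclideanreal euclidean) euclidean (\<lambda>(t, x::'a). t *\<^sub>R x)"
    by (simp_all add: euclidean_product_topology case_prod_unfold) (intro continuous_intros)+
  ultimately show ?thesis by (simp add: locally_convex_space_def)
qed

text \<open>This makes directional derivatives local: by continuity of the vector space operations,
  the difference quotients at a point of \<open>U\<close> only see values on \<open>U\<close> once
  \<open>t\<close> is small.\<close>

lemma lcs_eventually_line:
  assumes X: "locally_convex_space X" and U: "openin X U" "x \<in> U" and v: "v \<in> topspace X"
  shows "\<forall>\<^sub>F t::real in at 0. x + t *\<^sub>R v \<in> U"
proof -
  have "x \<in> topspace X" using U openin_subset by blast
  then have "continuous_map euclideanreal X (\<lambda>t. x + t *\<^sub>R v)"
    using v by (intro lcs_continuous_add[OF X] lcs_continuous_scaleR[OF X]) auto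
  then have "openin euclideanreal {t \<in> topspace euclideanreal. x + t *\<^sub>R v \<in> U}"
    using U by (intro openin_continuous_map_preimage)
  then have "open {t. x + t *\<^sub>R v \<in> U}" by simp
  then show ?thesis
    using U unfolding eventually_at_topological by (intro exI[of _ "{t. x + t *\<^sub>R v \<in> U}"]) auto
qed

section \<open>Locality and formal rules for directional derivatives\<close>

lemma has_dir_deriv_cong:
  assumes X: "locally_convex_space X" and U: "openin X U" "x \<in> U" and v: "v \<in> topspace X"
    and eq: "\<And>z. z \<in> U \<Longrightarrow> f z = g z"
  shows "has_dir_deriv F f x v l \<longleftrightarrow> has_dir_deriv F g x v l"
proof -
  have ev: "\<forall>\<^sub>F t in at 0. (f (x + t *\<^sub>R v) - f x) /\<^sub>R t = (g (x + t *\<^sub>R v) - g x) /\<^sub>R t"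
    using lcs_eventually_line[OF X U v] by eventually_elim (simp add: eq U)
  show ?thesis
    unfolding has_dir_deriv_def
    by (rule iffI; erule limitin_transform_eventually[rotated]; use ev in \<open>auto elim: eventually_mono\<close>)
qed

lemma dir_deriv_eqI:
  assumes "Hausdorff_space F" "has_dir_deriv F f x v l"
  shows "dir_deriv F f x v = l"
  unfolding dir_deriv_def
  using assms limitin_Hausdorff_unique[of F _ _ "at (0::real)"]
  by (intro the_equality) (auto simp: has_dir_deriv_def)

lemma iter_dir_deriv_cong:
  assumes X: "locally_convex_space X" and U: "openin X U" 
    and eq: "\<And>z. z \<in> U \<Longrightarrow> f z = g z"
  shows "x \<in> U \<Longrightarrow> (\<And>i. i < k \<Longrightarrow> y i \<in> topspace X) \<Longrightarrow>
    iter_dir_deriv F f k x y = iter_dir_deriv F g k x y"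
proof (induction k arbitrary: x)
  case (Suc k)
  have "has_dir_deriv F (\<lambda>z. iter_dir_deriv F f k z y) x (y k) l
      = has_dir_deriv F (\<lambda>z. iter_dir_deriv F g k z y) x (y k) l" for l
    by (rule has_dir_deriv_cong[OF X U Suc.prems(1)]) (use Suc in auto)
  then show ?case by (simp add: dir_deriv_def)
qed (simp add: eq)

text \<open>The recursion splits off the last direction. Inductions that replace \<open>f\<close> by
  one of its first derivatives have to split off direction \<open>0\<close> instead.\<close>

lemma iter_dir_deriv_Suc_shift:
  "iter_dir_deriv F f (Suc k) x y =
    iter_dir_deriv F (\<lambda>z. dir_deriv F f z (y 0)) k x (\<lambda>i. y (Suc i))"
  by (induction k arbitrary: x) simp_all

lemma iter_dir_deriv_directions_cong:
  "(\<And>i. i < k \<Longrightarrow> y i = y' i) \<Longrightarrow> iter_dir_deriv F f k x y = iter_dir_deriv F f k x y'"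
  by (induction k arbitrary: x) (simp_all)

lemma iter_dir_deriv_translate:
  "iter_dir_deriv F (\<lambda>z. f (z + c)) k x y = iter_dir_deriv F f k (x + c) y"
  by (induction k arbitrary: x) (simp_all add: dir_deriv_def has_dir_deriv_def algebra_simps)

lemma iter_dir_deriv_add_const:
  "iter_dir_deriv F (\<lambda>z. f z + c) k x y =
    (if k = 0 then iter_dir_deriv F f k x y + c else iter_dir_deriv F f k x y)"
proof (induction k arbitrary: x)
  case (Suc k)
  then show ?case by (cases "k = 0") (simp_all add: dir_deriv_def has_dir_deriv_def)
qed simp

text \<open>The tuples of directions in \<open>bastiani_C\<close> are extensional functions. Only
  the entries \<open>0\<close> to \<open>k\<close> enter the derivative, so an arbitrary
  \<open>y\<close> may be cut down to them.\<close>

lemma bastiani_C_dir_deriv_exists: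
  assumes f: "bastiani_C r X F U f" and k: "enat (Suc k) \<le> r" and x: "x \<in> U"
    and y: "\<And>i. i \<le> k \<Longrightarrow> y i \<in> topspace X"
  shows "\<exists>l. has_dir_deriv F (\<lambda>z. iter_dir_deriv F f k z y) x (y k) l"
proof -
  let ?y = "restrict y {..<Suc k}"
  have "?y \<in> topspace (power_topology X (Suc k))"
    using y by (auto simp: less_Suc_eq_le)
  then have "\<exists>l. has_dir_deriv F (\<lambda>z. iter_dir_deriv F f k z ?y) x (?y k) l"
    using f k x unfolding bastiani_C_def by blast
  moreover have "iter_dir_deriv F f k z ?y = iter_dir_deriv F f k z y" for z
    by (rule iter_dir_deriv_directions_cong) simp
  ultimately show ?thesis by simp
qed

section \<open>Operations on Bastiani maps: restriction, translation, closed subspaces\<close>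

lemma bastiani_C_cong:
  assumes X: "locally_convex_space X" and eq: "\<And>z. z \<in> U \<Longrightarrow> f z = g z"
    and f: "bastiani_C r X F U f"
  shows "bastiani_C r X F U g"
proof -
  have U: "openin X U" using f by (simp add: bastiani_C_def)
  note iter = iter_dir_deriv_cong[OF X U eq]
  have iter': "iter_dir_deriv F f k z y = iter_dir_deriv F g k z y"
    if "z \<in> U" "y \<in> topspace (power_topology X (Suc k))" for k z y
    using that by (intro iter) (auto simp: PiE_iff)
  have "continuous_map (prod_topology (subtopology X U) (power_topology X k)) F
          (\<lambda>(x, y). iter_dir_deriv F g k x y)" if "enat k \<le> r" for k
  proof (rule continuous_map_eq)
    show "continuous_map (prod_topology (subtopology X U) (power_topology X k)) F
          (\<lambda>(x, y). iter_dir_deriv F f k x y)"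
      using f that by (simp add: bastiani_C_def)
  qed (auto intro!: iter simp: PiE_iff)
  moreover have "\<exists>l. has_dir_deriv F (\<lambda>z. iter_dir_deriv F g k z y) x (y k) l"
    if k: "enat (Suc k) \<le> r" and x: "x \<in> U" and y: "y \<in> topspace (power_topology X (Suc k))" for k x y
  proof -
    obtain l where "has_dir_deriv F (\<lambda>z. iter_dir_deriv F f k z y) x (y k) l"
      using f k x y unfolding bastiani_C_def by blast
    then have "has_dir_deriv F (\<lambda>z. iter_dir_deriv F g k z y) x (y k) l"
      using y by (subst (asm) has_dir_deriv_cong[OF X U x _ iter']) (auto simp: PiE_iff)
    then show ?thesis ..
  qed
  ultimately show ?thesis
    using U unfolding bastiani_C_def by blast
qed

lemma bastiani_C_subset:
  assumes "bastiani_C r X F U f" "openin X V" "V \<subseteq> U"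
  shows "bastiani_C r X F V f"
proof -
  have "continuous_map (prod_topology (subtopology X V) (power_topology X k)) F
          (\<lambda>(x, y). iter_dir_deriv F f k x y)" if "enat k \<le> r" for k
  proof -
    let ?T = "prod_topology (subtopology X V) (power_topology X k)"
    have "continuous_map ?T (subtopology X U) fst"
      using continuous_map_fst[of "subtopology X V" "power_topology X k"] assms(3)
      by (auto simp: continuous_map_in_subtopology)
    then have "continuous_map ?T (prod_topology (subtopology X U) (power_topology X k)) (\<lambda>p. (fst p, snd p))"
      by (intro continuous_map_pairedI continuous_map_snd)
    moreover have "continuous_map (prod_topology (subtopology X U) (power_topology X k)) F
          (\<lambda>(x, y). iter_dir_deriv F f k x y)"
      using assms(1) that by (simp add: bastiani_C_def)
    ultimately have "continuous_map ?T F
        ((\<lambda>(x, y). iter_dir_deriv F f k x y) \<circ> (\<lambda>p. (fst p, snd p)))"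
      by (rule continuous_map_compose)
    then show ?thesis
      by (simp add: o_def)
  qed
  then show ?thesis using assms unfolding bastiani_C_def by blast
qed

lemma lcs_translate_homeomorphic_map:
  assumes X: "locally_convex_space X" and c: "c \<in> topspace X"
  shows "homeomorphic_map X X (\<lambda>x. x + c)"
proof -
  have c': "- c \<in> topspace X" using lcs_subspace[OF X] c subspace_neg by blast
  have "continuous_map X X (\<lambda>x. x + c)" "continuous_map X X (\<lambda>x. x + - c)"
    by (intro lcs_continuous_add[OF X]; simp add: c c')+
  then show ?thesis
    by (auto simp: homeomorphic_map_maps homeomorphic_maps_def intro!: exI[of _ "\<lambda>x. x + - c"])
qed

lemma bastiani_C_translate:
  assumes X: "locally_convex_space X" and c: "c \<in> topspace X" and f: "bastiani_C r X F U f"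
  shows "bastiani_C r X F ((\<lambda>x. x - c) ` U) (\<lambda>x. f (x + c))"
proof -
  let ?V = "(\<lambda>x. x - c) ` U"
  have c': "- c \<in> topspace X" using lcs_subspace[OF X] c subspace_neg by blast
  have U: "openin X U" using f by (simp add: bastiani_C_def)
  have V: "openin X ?V"
    using homeomorphic_map_openness_eq[OF lcs_translate_homeomorphic_map[OF X c'], of U] U by simp
  have "continuous_map (prod_topology (subtopology X ?V) (power_topology X k)) F
          (\<lambda>(x, y). iter_dir_deriv F f k (x + c) y)" if k: "enat k \<le> r" for k
  proof -
    have "continuous_map (subtopology X ?V) (subtopology X U) (\<lambda>x. x + c)"
      using c by (auto simp: continuous_map_in_subtopology
          intro!: lcs_continuous_add[OF X] continuous_map_from_subtopology)
    then have "continuous_map (prod_topology (subtopology X ?V) (power_topology X k))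
       (prod_topology (subtopology X U) (power_topology X k)) (\<lambda>(x, y). (x + c, y))"
      by (simp add: continuous_map_prod_top)
    moreover have "continuous_map (prod_topology (subtopology X U) (power_topology X k)) F
          (\<lambda>(x, y). iter_dir_deriv F f k x y)"
      using f k by (simp add: bastiani_C_def)
    ultimately have "continuous_map (prod_topology (subtopology X ?V) (power_topology X k)) F
        ((\<lambda>(x, y). iter_dir_deriv F f k x y) \<circ> (\<lambda>(x, y). (x + c, y)))"
      by (rule continuous_map_compose)
    then show ?thesis by (simp add: o_def case_prod_unfold)
  qed
  moreover have "\<exists>l. has_dir_deriv F (\<lambda>z. iter_dir_deriv F f k (z + c) y) x (y k) l"
    if k: "enat (Suc k) \<le> r" and x: "x \<in> ?V" and y: "y \<in> topspace (power_topology X (Suc k))" for k x y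
  proof -
    have "x + c \<in> U" using x by auto
    then obtain l where "has_dir_deriv F (\<lambda>z. iter_dir_deriv F f k z y) (x + c) (y k) l"
      using f k y unfolding bastiani_C_def by blast
    then show ?thesis
      by (auto simp: has_dir_deriv_def algebra_simps)
  qed
  ultimately show ?thesis
    using V by (simp add: bastiani_C_def iter_dir_deriv_translate)
qed

lemma bastiani_C_add_const:
  assumes F: "locally_convex_space F" and c: "c \<in> topspace F" and f: "bastiani_C r X F U f"
  shows "bastiani_C r X F U (\<lambda>x. f x + c)"
proof -
  have "continuous_map (prod_topology (subtopology X U) (power_topology X k)) F
          (\<lambda>(x, y). iter_dir_deriv F (\<lambda>x. f x + c) k x y)" if k: "enat k \<le> r" for k
  proof -
    have *: "continuous_map (prod_topology (subtopology X U) (power_topology X k)) F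
          (\<lambda>(x, y). iter_dir_deriv F f k x y)"
      using f k by (simp add: bastiani_C_def)
    show ?thesis
    proof (cases "k = 0")
      case True
      then show ?thesis
        using lcs_continuous_add[OF F *, of "\<lambda>_. c"] c
        by (simp add: iter_dir_deriv_add_const case_prod_unfold)
    next
      case False
      then show ?thesis using * by (simp add: iter_dir_deriv_add_const)
    qed
  qed
  moreover have "\<exists>l. has_dir_deriv F (\<lambda>z. iter_dir_deriv F (\<lambda>x. f x + c) k z y) x (y k) l"
    if k: "enat (Suc k) \<le> r" and x: "x \<in> U" and y: "y \<in> topspace (power_topology X (Suc k))" for k x y
  proof -
    obtain l where "has_dir_deriv F (\<lambda>z. iter_dir_deriv F f k z y) x (y k) l"
      using f k x y unfolding bastiani_C_def by blast
    then show ?thesis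
      by (cases "k = 0") (auto simp: has_dir_deriv_def iter_dir_deriv_add_const)
  qed
  ultimately show ?thesis
    using f unfolding bastiani_C_def by blast
qed

lemma bastiani_smooth_id:
  assumes X: "locally_convex_space X" and U: "openin X U"
  shows "bastiani_smooth X X U id"
proof -
  note H = lcs_Hausdorff[OF X]
  have 0: "0 \<in> topspace X" using lcs_subspace[OF X] by (rule subspace_0)
  have id_deriv: "has_dir_deriv X id x v v" if "v \<in> topspace X" for x v
    unfolding has_dir_deriv_def
  proof (rule limitin_eventually)
    show "\<forall>\<^sub>F t in at 0. (id (x + t *\<^sub>R v) - id x) /\<^sub>R t = v"
      by (auto simp: eventually_at intro!: exI[of _ 1])
  qed (rule that)
  have const_deriv: "has_dir_deriv X (\<lambda>z. a) x v 0" for x v and a :: 'a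
    using 0 by (simp add: has_dir_deriv_def)
  \<comment> \<open>The first derivative of the identity does not depend on the point, so every
    further derivative vanishes.\<close>
  have iter_Suc: "iter_dir_deriv X id (Suc k) x y = (if k = 0 then y 0 else 0)"
    if "y 0 \<in> topspace X" for k x y
  proof (induction k arbitrary: x)
    case 0
    have "(\<lambda>z::'a. z) = id" by auto
    then show ?case using dir_deriv_eqI[OF H id_deriv[OF that]] by simp
  next
    case (Suc k)
    have "iter_dir_deriv X id (Suc (Suc k)) x y =
        dir_deriv X (\<lambda>z. if k = 0 then y 0 else 0) x (y (Suc k))"
      unfolding iter_dir_deriv.simps(2)[of _ _ "Suc k"] Suc ..
    also have "\<dots> = 0" by (rule dir_deriv_eqI[OF H const_deriv])
    finally show ?case by (simp only: nat.distinct if_False)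
  qed
  have "\<exists>l. has_dir_deriv X (\<lambda>z. iter_dir_deriv X id k z y) x (y k) l"
    if "y \<in> topspace (power_topology X (Suc k))" for k x y
  proof -
    have y: "y i \<in> topspace X" if "i \<le> k" for i
      using that \<open>y \<in> topspace (power_topology X (Suc k))\<close> by (simp add: PiE_iff)
    show ?thesis
    proof (cases k)
      case 0
      have "(\<lambda>z::'a. z) = id" by auto
      then show ?thesis using 0 id_deriv[OF y[of 0]] by auto
    next
      case (Suc m)
      then show ?thesis
        using y[of 0] by (simp only: iter_Suc) (blast intro: const_deriv)
    qed
  qed
  moreover have "continuous_map (prod_topology (subtopology X U) (power_topology X k)) X
          (\<lambda>(x, y). iter_dir_deriv X id k x y)" for k
  proof (cases k)
    case 0
    then show ?thesis
      using continuous_map_fst[of "subtopology X U" "power_topology X k"]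
      by (simp add: continuous_map_in_subtopology case_prod_unfold flip: id_def)
  next
    case (Suc m)
    let ?T = "prod_topology (subtopology X U) (power_topology X k)"
    have "0 \<in> {..<k}" using Suc by simp
    from continuous_map_compose[OF continuous_map_snd continuous_map_product_projection[OF this]]
    have "continuous_map ?T X (\<lambda>p. snd p 0)" by (simp add: o_def)
    then have "continuous_map ?T X (\<lambda>p. if m = 0 then snd p 0 else 0)"
      using 0 by (cases "m = 0") simp_all
    moreover have "(if m = 0 then snd p 0 else 0) = (case p of (x, y) \<Rightarrow> iter_dir_deriv X id k x y)"
      if "p \<in> topspace ?T" for p
    proof -
      obtain x y where p: "p = (x, y)" by (cases p)
      then have "y 0 \<in> topspace X" using that Suc by (auto simp: PiE_iff)
      then have "iter_dir_deriv X id (Suc m) x y = (if m = 0 then y 0 else 0)"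
        by (rule iter_Suc)
      then show ?thesis unfolding p Suc prod.case snd_conv by (rule sym)
    qed
    ultimately show ?thesis by (rule continuous_map_eq)
  qed
  ultimately show ?thesis
    using U by (simp add: bastiani_C_def)
qed

text \<open>Difference quotients of values in the subspace \<open>Z\<close> lie in \<open>Z\<close>,
  and so do their limits because \<open>Z\<close> is closed. Hence derivatives along
  \<open>Y\<close> are the same whether computed in \<open>F\<close> or in the subspace topology.
  This turns chart changes of the ambient space into chart changes of a submanifold.\<close>

lemma bastiani_C_restrict:
  assumes X: "locally_convex_space X" and F: "locally_convex_space F"
    and Y: "subspace Y" "Y \<subseteq> topspace X" and Z: "subspace Z" "closedin F Z"
    and f: "bastiani_C r X F U f" and im: "f ` (U \<inter> Y) \<subseteq> Z"
  shows "bastiani_C r (subtopology X Y) (subtopology F Z) (U \<inter> Y) f"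
proof -
  let ?Y = "subtopology X Y" and ?Z = "subtopology F Z"
  have topY: "topspace ?Y = Y" and topZ: "topspace ?Z = Z"
    using Y closedin_subset[OF Z(2)] by auto
  have U: "openin X U" using f by (simp add: bastiani_C_def)
  have openY: "openin ?Y (U \<inter> Y)" using U by (auto simp: openin_subtopology)
  note lcsY = locally_convex_space_subtopology[OF X Y]
  have step: "has_dir_deriv ?Z g x v l"
    if g: "has_dir_deriv F g x v l" and gZ: "\<And>z. z \<in> U \<inter> Y \<Longrightarrow> g z \<in> Z"
      and x: "x \<in> U \<inter> Y" and v: "v \<in> Y" for g x v l
  proof -
    have ev: "\<forall>\<^sub>F t in at 0. (g (x + t *\<^sub>R v) - g x) /\<^sub>R t \<in> Z"
      using lcs_eventually_line[OF lcsY openY x, unfolded topY, OF v]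
      by eventually_elim (use gZ x Z in \<open>auto intro!: subspace_scale subspace_diff\<close>)
    moreover from this g Z have "l \<in> Z"
      unfolding has_dir_deriv_def
      by (intro limitin_closedin[of F _ l "at (0::real)" Z]) auto
    ultimately show ?thesis
      using g by (simp add: has_dir_deriv_def limitin_subtopology)
  qed
  \<comment> \<open>The three claims need each other: existence of the derivative in the subspace
    yields value and membership at the next order, and these two are what \<open>step\<close> needs
    to produce the following derivative.\<close>
  have main: "enat k \<le> r \<Longrightarrow> x \<in> U \<inter> Y \<Longrightarrow> (\<And>i. i < k \<Longrightarrow> y i \<in> Y) \<Longrightarrow>
      iter_dir_deriv ?Z f k x y = iter_dir_deriv F f k x y \<and> iter_dir_deriv F f k x y \<in> Z \<and>
      (enat (Suc k) \<le> r \<and> y k \<in> Y \<longrightarrow> has_dir_deriv ?Z (\<lambda>z. iter_dir_deriv ?Z f k z y) x (y k)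
         (iter_dir_deriv F f (Suc k) x y))" for k x y
  proof (induction k arbitrary: x)
    case 0
    have "has_dir_deriv ?Z (\<lambda>z. iter_dir_deriv ?Z f 0 z y) x (y 0) (iter_dir_deriv F f (Suc 0) x y)"
      if r: "enat (Suc 0) \<le> r" "y 0 \<in> Y"
    proof -
      obtain l where l: "has_dir_deriv F (\<lambda>z. iter_dir_deriv F f 0 z y) x (y 0) l"
        using bastiani_C_dir_deriv_exists[OF f r(1), of x y] 0(2) r(2) Y by force
      have "has_dir_deriv ?Z f x (y 0) l"
        by (rule step[OF _ _ 0(2) r(2)]) (use l im in auto)
      moreover have "l = dir_deriv F f x (y 0)"
        using dir_deriv_eqI[OF lcs_Hausdorff[OF F] l] by simp
      ultimately show ?thesis by simp
    qed
    then show ?case using 0 im by auto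
  next
    case (Suc k)
    have k: "enat k \<le> r" using Suc.prems(1) order_trans[of "enat k" "enat (Suc k)"] by simp
    have yk: "y k \<in> Y" using Suc.prems(3) by simp
    have IH: "iter_dir_deriv ?Z f k z y = iter_dir_deriv F f k z y" "iter_dir_deriv F f k z y \<in> Z"
      "has_dir_deriv ?Z (\<lambda>z. iter_dir_deriv ?Z f k z y) z (y k) (iter_dir_deriv F f (Suc k) z y)"
      if "z \<in> U \<inter> Y" for z
      using Suc.IH[OF k that] Suc.prems yk by auto
    have 1: "iter_dir_deriv ?Z f (Suc k) z y = iter_dir_deriv F f (Suc k) z y" if "z \<in> U \<inter> Y" for z
      using dir_deriv_eqI[OF _ IH(3)[OF that]] lcs_Hausdorff[OF F]
      by (simp add: Hausdorff_space_subtopology)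
    have 2: "iter_dir_deriv F f (Suc k) z y \<in> Z" if "z \<in> U \<inter> Y" for z
      using limitin_topspace[OF IH(3)[OF that, unfolded has_dir_deriv_def]] unfolding topZ .
    have "has_dir_deriv ?Z (\<lambda>z. iter_dir_deriv ?Z f (Suc k) z y) x (y (Suc k))
       (iter_dir_deriv F f (Suc (Suc k)) x y)"
      if r: "enat (Suc (Suc k)) \<le> r" "y (Suc k) \<in> Y"
    proof -
      have "y i \<in> topspace X" if i: "i \<le> Suc k" for i
        using r(2) Y Suc.prems(3) i by (cases "i = Suc k") auto
      then obtain l where
        l: "has_dir_deriv F (\<lambda>z. iter_dir_deriv F f (Suc k) z y) x (y (Suc k)) l"
        using bastiani_C_dir_deriv_exists[OF f r(1)] Suc.prems(2) by blast
      have "has_dir_deriv ?Z (\<lambda>z. iter_dir_deriv F f (Suc k) z y) x (y (Suc k)) l"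
        using step[OF l 2 Suc.prems(2) r(2)] .
      moreover have "l = iter_dir_deriv F f (Suc (Suc k)) x y"
        using dir_deriv_eqI[OF lcs_Hausdorff[OF F] l] by simp
      moreover have "has_dir_deriv ?Z (\<lambda>z. iter_dir_deriv ?Z f (Suc k) z y) x (y (Suc k)) l =
          has_dir_deriv ?Z (\<lambda>z. iter_dir_deriv F f (Suc k) z y) x (y (Suc k)) l"
        by (rule has_dir_deriv_cong[OF lcsY openY Suc.prems(2) _ 1]) (simp_all only: topY r)
      ultimately show ?thesis by (simp only:)
    qed
    then show ?case using 1 2 Suc.prems(2) by blast
  qed
  have "\<exists>l. has_dir_deriv ?Z (\<lambda>z. iter_dir_deriv ?Z f k z y) x (y k) l"
    if "enat (Suc k) \<le> r" "x \<in> U \<inter> Y" "y \<in> topspace (power_topology ?Y (Suc k))" for k x y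
  proof -
    have "y i \<in> Y" if "i < Suc k" for i
      using that \<open>y \<in> topspace (power_topology ?Y (Suc k))\<close> by (auto simp: PiE_iff)
    moreover have "enat k \<le> r" using that(1) order_trans[of "enat k" "enat (Suc k)"] by simp
    ultimately show ?thesis using main[of k x y] that by auto
  qed
  moreover have "continuous_map (prod_topology (subtopology ?Y (U \<inter> Y)) (power_topology ?Y k)) ?Z
          (\<lambda>(x, y). iter_dir_deriv ?Z f k x y)" if k: "enat k \<le> r" for k
  proof -
    let ?T = "prod_topology (subtopology ?Y (U \<inter> Y)) (power_topology ?Y k)"
    have "continuous_map ?T (subtopology X U) fst"
      using continuous_map_fst[of "subtopology ?Y (U \<inter> Y)" "power_topology ?Y k"]
      by (auto simp: continuous_map_in_subtopology)
    moreover have "continuous_map ?T (power_topology X k) snd"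
      using continuous_map_snd[of "subtopology ?Y (U \<inter> Y)" "power_topology ?Y k"]
      by (auto simp: continuous_map_componentwise continuous_map_in_subtopology PiE_iff extensional_def)
    ultimately have "continuous_map ?T (prod_topology (subtopology X U) (power_topology X k)) (\<lambda>p. (fst p, snd p))"
      by (intro continuous_map_pairedI)
    moreover have "continuous_map (prod_topology (subtopology X U) (power_topology X k)) F
          (\<lambda>(x, y). iter_dir_deriv F f k x y)"
      using f k by (simp add: bastiani_C_def)
    ultimately have "continuous_map ?T F
        ((\<lambda>(x, y). iter_dir_deriv F f k x y) \<circ> (\<lambda>p. (fst p, snd p)))"
      by (rule continuous_map_compose)
    then have "continuous_map ?T F (\<lambda>(x, y). iter_dir_deriv F f k x y)"
      by (simp add: o_def)
    then have "continuous_map ?T ?Z (\<lambda>(x, y). iter_dir_deriv F f k x y)"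
      using main[OF k] by (auto simp: continuous_map_in_subtopology PiE_iff)
    then show ?thesis
      by (rule continuous_map_eq) (use main[OF k] in \<open>auto simp: PiE_iff\<close>)
  qed
  ultimately show ?thesis
    using openY by (simp add: bastiani_C_def)
qed

section \<open>Differentiability of order k within a convex set\<close>

text \<open>The derivative is tested one direction at a time. The maps in the recursion then keep
  their type, whereas a derivative with values in linear maps would change it at every order. Since
  it is taken within \<open>K\<close>, boundary points are treated like all others.\<close>

primrec Ck :: "nat \<Rightarrow> 'a::real_normed_vector set \<Rightarrow> ('a \<Rightarrow> 'b::real_normed_vector) \<Rightarrow> bool" where
  "Ck 0 K f \<longleftrightarrow> continuous_on K f"
| "Ck (Suc k) K f \<longleftrightarrow>
    (\<exists>f'. (\<forall>x\<in>K. (f has_derivative f' x) (at x within K)) \<and> (\<forall>v. Ck k K (\<lambda>x. f' x v)))"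

declare Ck.simps(2) [simp del]

lemma Ck_SucI:
  "(\<And>x. x \<in> K \<Longrightarrow> (f has_derivative f' x) (at x within K)) \<Longrightarrow> (\<And>v. Ck k K (\<lambda>x. f' x v)) \<Longrightarrow>
    Ck (Suc k) K f"
  unfolding Ck.simps(2) by blast

lemma Ck_SucE:
  assumes "Ck (Suc k) K f"
  obtains f' where "\<And>x. x \<in> K \<Longrightarrow> (f has_derivative f' x) (at x within K)"
    "\<And>v. Ck k K (\<lambda>x. f' x v)"
  using assms unfolding Ck.simps(2) by blast

lemma Ck_continuous_on: "Ck k K f \<Longrightarrow> continuous_on K f"
  by (cases k) (auto elim!: Ck_SucE intro: has_derivative_continuous_on)

lemma Ck_SucD: "Ck (Suc k) K f \<Longrightarrow> Ck k K f"
proof (induction k arbitrary: f)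
  case 0
  then show ?case using Ck_continuous_on[OF 0] by simp
next
  case (Suc k)
  from Suc.prems show ?case by (rule Ck_SucE) (rule Ck_SucI, blast, rule Suc.IH, blast)
qed

lemma Ck_mono: "Ck k K f \<Longrightarrow> j \<le> k \<Longrightarrow> Ck j K f"
  by (induction k) (auto simp: le_Suc_eq dest: Ck_SucD)

section \<open>Closure under algebraic operations, inversion of scalars and composition\<close>

lemma Ck_cong:
  assumes "\<And>x. x \<in> K \<Longrightarrow> g x = f x" and "Ck k K f"
  shows "Ck k K g"
proof (cases k)
  case 0
  then show ?thesis using assms continuous_on_cong[of K K g f] by auto
next
  case (Suc m)
  obtain f' where f': "\<And>x. x \<in> K \<Longrightarrow> (f has_derivative f' x) (at x within K)"
    "\<And>v. Ck m K (\<lambda>x. f' x v)"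
    using assms(2) unfolding Suc by (rule Ck_SucE) blast
  have "(g has_derivative f' x) (at x within K)" if "x \<in> K" for x
    using that assms(1) f'(1) by (intro has_derivative_transform[of x K g f]) auto
  then show ?thesis unfolding Suc using f'(2) by (rule Ck_SucI)
qed

lemma Ck_const: "Ck k K (\<lambda>x. c)"
  by (induction k arbitrary: c) (auto intro!: Ck_SucI[of _ _ "\<lambda>_ _. 0"])

lemma Ck_bounded_linear: "bounded_linear f \<Longrightarrow> Ck k K f"
  using Ck_const[where K=K]
  by (cases k) (auto intro!: Ck_SucI[of _ _ "\<lambda>_. f"] linear_continuous_on bounded_linear_imp_has_derivative)

lemma Ck_bounded_linear_compose:
  assumes L: "bounded_linear L" shows "Ck k K f \<Longrightarrow> Ck k K (\<lambda>x. L (f x))"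
proof (induction k arbitrary: f)
  case 0
  then show ?case using bounded_linear.continuous_on[OF L] by auto
next
  case (Suc k)
  obtain f' where f': "\<And>x. x \<in> K \<Longrightarrow> (f has_derivative f' x) (at x within K)"
    "\<And>v. Ck k K (\<lambda>x. f' x v)"
    using Suc.prems(1) by (rule Ck_SucE) blast
  show ?case
    by (rule Ck_SucI[of _ _ "\<lambda>x v. L (f' x v)"]) (auto intro: f' Suc.IH bounded_linear.has_derivative[OF L])
qed

lemma Ck_add: "Ck k K f \<Longrightarrow> Ck k K g \<Longrightarrow> Ck k K (\<lambda>x. f x + g x)"
proof (induction k arbitrary: f g)
  case 0
  then show ?case by (auto intro: continuous_on_add)
next
  case (Suc k)
  obtain f' where "\<And>x. x \<in> K \<Longrightarrow> (f has_derivative f' x) (at x within K)"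
    "\<And>v. Ck k K (\<lambda>x. f' x v)"
    using Suc.prems(1) by (rule Ck_SucE) blast
  moreover obtain g' where "\<And>x. x \<in> K \<Longrightarrow> (g has_derivative g' x) (at x within K)"
    "\<And>v. Ck k K (\<lambda>x. g' x v)"
    using Suc.prems(2) by (rule Ck_SucE) blast
  ultimately show ?case
    by (intro Ck_SucI[of _ _ "\<lambda>x v. f' x v + g' x v"] has_derivative_add Suc.IH) blast+
qed

lemma Ck_sum: "(\<And>i. i \<in> I \<Longrightarrow> Ck k K (f i)) \<Longrightarrow> Ck k K (\<lambda>x. \<Sum>i\<in>I. f i x)"
  by (induction I rule: infinite_finite_induct) (auto intro: Ck_const Ck_add)

lemma Ck_scaleR:
  fixes a :: "'a::real_normed_vector \<Rightarrow> real"
  shows "Ck k K a \<Longrightarrow> Ck k K f \<Longrightarrow> Ck k K (\<lambda>x. a x *\<^sub>R f x)"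
proof (induction k arbitrary: a f)
  case 0
  then show ?case by (auto intro: continuous_on_scaleR)
next
  case (Suc k)
  obtain a' where a': "\<And>x. x \<in> K \<Longrightarrow> (a has_derivative a' x) (at x within K)"
    "\<And>v. Ck k K (\<lambda>x. a' x v)"
    using Suc.prems(1) by (rule Ck_SucE) blast
  obtain f' where f': "\<And>x. x \<in> K \<Longrightarrow> (f has_derivative f' x) (at x within K)"
    "\<And>v. Ck k K (\<lambda>x. f' x v)"
    using Suc.prems(2) by (rule Ck_SucE) blast
  have "Ck k K (\<lambda>x. a x *\<^sub>R f' x v + a' x v *\<^sub>R f x)" for v
    by (intro Ck_add Suc.IH a' f' Ck_SucD[OF Suc.prems(1)] Ck_SucD[OF Suc.prems(2)])
  then show ?case
    using a'(1) f'(1)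
    by (intro Ck_SucI[of _ _ "\<lambda>x v. a x *\<^sub>R f' x v + a' x v *\<^sub>R f x"] has_derivative_scaleR)
qed

lemma Ck_mult: "Ck k K a \<Longrightarrow> Ck k K b \<Longrightarrow> Ck k K (\<lambda>x. a x * b x :: real)"
  using Ck_scaleR[of k K a b] by simp

lemma Ck_prod: "(\<And>i. i \<in> I \<Longrightarrow> Ck k K (f i)) \<Longrightarrow> Ck k K (\<lambda>x. \<Prod>i\<in>I. f i x :: real)"
  by (induction I rule: infinite_finite_induct) (auto intro: Ck_const Ck_mult)

lemma Ck_inverse:
  fixes a :: "'a::real_normed_vector \<Rightarrow> real"
  assumes "\<And>x. x \<in> K \<Longrightarrow> a x \<noteq> 0"
  shows "Ck k K a \<Longrightarrow> Ck k K (\<lambda>x. inverse (a x))"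
proof (induction k)
  case 0
  then show ?case using assms by (auto intro: continuous_on_inverse)
next
  case (Suc k)
  obtain a' where a': "\<And>x. x \<in> K \<Longrightarrow> (a has_derivative a' x) (at x within K)"
    "\<And>v. Ck k K (\<lambda>x. a' x v)"
    using Suc.prems(1) by (rule Ck_SucE) blast
  note IH = Suc.IH[OF Ck_SucD[OF Suc.prems]]
  have "Ck k K (\<lambda>x. (- 1) * (inverse (a x) * a' x v * inverse (a x)))" for v
    by (intro Ck_mult Ck_const IH a')
  then show ?case
    using a'(1) assms
    by (auto intro!: Ck_SucI[of _ _ "\<lambda>x v. - (inverse (a x) * a' x v * inverse (a x))"] has_derivative_inverse)
qed

lemma Ck_compose:
  fixes f :: "'a::real_normed_vector \<Rightarrow> 'c::euclidean_space"
    and g :: "'c \<Rightarrow> 'b::real_normed_vector"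
  assumes im: "f ` K \<subseteq> S"
  shows "Ck k K f \<Longrightarrow> Ck k S g \<Longrightarrow> Ck k K (\<lambda>x. g (f x))"
proof (induction k arbitrary: g)
  case 0
  then show ?case using im continuous_on_compose2[of S g K f] by auto
next
  case (Suc k)
  obtain f' where f': "\<And>x. x \<in> K \<Longrightarrow> (f has_derivative f' x) (at x within K)"
    "\<And>v. Ck k K (\<lambda>x. f' x v)"
    using Suc.prems(1) by (rule Ck_SucE) blast
  obtain g' where g': "\<And>x. x \<in> S \<Longrightarrow> (g has_derivative g' x) (at x within S)"
    "\<And>v. Ck k S (\<lambda>x. g' x v)"
    using Suc.prems(2) by (rule Ck_SucE) blast
  have der: "((\<lambda>x. g (f x)) has_derivative (\<lambda>v. g' (f x) (f' x v))) (at x within K)" if "x \<in> K" for x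
    using has_derivative_in_compose2[OF g'(1) im that f'(1)[OF that]] .
  \<comment> \<open>The direction \<open>f' x v\<close> varies with \<open>x\<close>, but the
    induction hypothesis concerns \<open>g'\<close> in a fixed direction. Expanding in the standard
    basis separates the two dependences.\<close>
  have "g' (f x) (f' x v) = (\<Sum>b\<in>Basis. (f' x v \<bullet> b) *\<^sub>R g' (f x) b)" if "x \<in> K" for x v
  proof -
    have lin: "linear (g' (f x))"
      using that im g'(1)[of "f x"] has_derivative_linear by blast
    have "g' (f x) (f' x v) = g' (f x) (\<Sum>b\<in>Basis. (f' x v \<bullet> b) *\<^sub>R b)"
      by (simp add: euclidean_representation)
    then show ?thesis
      by (simp add: linear_sum[OF lin] linear_cmul[OF lin])
  qed
  moreover have "Ck k K (\<lambda>x. \<Sum>b\<in>Basis. (f' x v \<bullet> b) *\<^sub>R g' (f x) b)" for v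
    by (intro Ck_sum Ck_scaleR Suc.IH Ck_bounded_linear_compose[OF bounded_linear_inner_left]
        f' g' Ck_SucD[OF Suc.prems(1)])
  ultimately have "Ck k K (\<lambda>x. g' (f x) (f' x v))" for v
    by (rule Ck_cong)
  with der show ?case by (rule Ck_SucI)
qed

text \<open>The difference of two derivatives is a derivative of the zero function. Running along
  the segment from \<open>x\<close> to \<open>z\<close> shows that it kills every
  \<open>z - x\<close> with \<open>z\<close> in \<open>K\<close>, and these vectors span because
  \<open>K\<close> contains a ball.\<close>

lemma has_derivative_unique_within_convex:
  fixes f :: "'a::euclidean_space \<Rightarrow> 'b::real_normed_vector"
  assumes K: "convex K" "interior K \<noteq> {}" and x: "x \<in> K"
    and A: "(f has_derivative A) (at x within K)" and B: "(f has_derivative B) (at x within K)"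
  shows "A = B"
proof -
  define D where "D = (\<lambda>v. A v - B v)"
  have D: "((\<lambda>_. 0) has_derivative D) (at x within K)"
    using has_derivative_diff[OF A B] by (simp add: D_def)
  have lin: "linear D" using D by (rule has_derivative_linear)
  have D0: "D (z - x) = 0" if z: "z \<in> K" for z
  proof (cases "z = x")
    case False
    have "norm (D (z - x)) \<le> e * norm (z - x)" if e: "e > 0" for e
    proof -
      obtain d where d: "d > 0" "\<And>y. y \<in> K \<Longrightarrow> norm (y - x) < d \<Longrightarrow> norm (D (y - x)) \<le> e * norm (y - x)"
        using D e by (fastforce simp: has_derivative_within_alt)
      \<comment> \<open>The first bound keeps the new point on the segment, the second within
        distance \<open>d\<close> of \<open>x\<close>.\<close>
      define t where "t = min 1 (d / (2 * norm (z - x)))"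
      have t: "0 < t" "t \<le> 1" "t * norm (z - x) < d"
        using d False by (auto simp: t_def min_def field_simps)
      have "x + t *\<^sub>R (z - x) = (1 - t) *\<^sub>R x + t *\<^sub>R z" by (simp add: algebra_simps)
      then have "x + t *\<^sub>R (z - x) \<in> K"
        using convexD_alt[OF K(1) x z, of t] t by simp
      then have "norm (D (t *\<^sub>R (z - x))) \<le> e * norm (t *\<^sub>R (z - x))"
        using d(2)[of "x + t *\<^sub>R (z - x)"] t by simp
      then have "t * norm (D (z - x)) \<le> t * (e * norm (z - x))"
        using t by (simp add: linear_cmul[OF lin])
      then show ?thesis using t by simp
    qed
    \<comment> \<open>With this \<open>e\<close> the estimate bounds the norm of
      \<open>D (z - x)\<close> by half of itself.\<close>
    from this[of "norm (D (z - x)) / (2 * norm (z - x))"] show ?thesis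
      using False by (cases "D (z - x) = 0") auto
  qed (simp add: linear_0[OF lin])
  obtain c e where ce: "e > 0" "ball c e \<subseteq> K"
    using K(2) open_contains_ball[of "interior K"] interior_subset by blast
  have "D w = 0" for w
  proof (cases "w = 0")
    case False
    \<comment> \<open>A small multiple of \<open>w\<close> is the difference of two points of the
      ball around \<open>c\<close>, hence of two vectors of the form \<open>z - x\<close>.\<close>
    define s where "s = e / (2 * norm w)"
    have s: "s > 0" "s * norm w < e" using ce False by (auto simp: s_def)
    have "c \<in> K" "c + s *\<^sub>R w \<in> K"
      using ce s by (auto simp: subset_iff dist_norm)
    then have "D (c + s *\<^sub>R w - x) - D (c - x) = 0" using D0 by simp
    then have "s *\<^sub>R D w = 0"
      by (simp add: linear_diff[OF lin, symmetric] linear_cmul[OF lin])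
    then show ?thesis using s by simp
  qed (simp add: linear_0[OF lin])
  then show ?thesis by (auto simp: D_def)
qed

text \<open>This is the mean value inequality for \<open>f - A\<close>. The factor
  \<open>DIM('a)\<close> is the price for controlling the derivative on basis vectors only, which is
  all that continuity in each single direction provides.\<close>

lemma differentiable_bound_coordinates:
  fixes f :: "'a::euclidean_space \<Rightarrow> 'b::real_normed_vector" and e :: real
  assumes S: "convex S" and f': "\<And>x. x \<in> S \<Longrightarrow> (f has_derivative f' x) (at x within S)"
    and A: "bounded_linear A"
    and bd: "\<And>x b. x \<in> S \<Longrightarrow> b \<in> Basis \<Longrightarrow> norm (f' x b - A b) \<le> e"
    and u: "u \<in> S" and w: "w \<in> S"
  shows "norm (f u - f w - A (u - w)) \<le> DIM('a) * e * norm (u - w)"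
proof -
  have "norm ((f u - A u) - (f w - A w)) \<le> DIM('a) * e * norm (u - w)"
  proof (rule differentiable_bound[OF S _ _ u w])
    fix x assume x: "x \<in> S"
    show "((\<lambda>u. f u - A u) has_derivative (\<lambda>v. f' x v - A v)) (at x within S)"
      by (intro has_derivative_diff f' x bounded_linear_imp_has_derivative A)
    then have lin: "bounded_linear (\<lambda>v. f' x v - A v)" by (rule has_derivative_bounded_linear)
    show "onorm (\<lambda>v. f' x v - A v) \<le> DIM('a) * e"
    proof (rule onorm_le)
      fix v :: 'a
      have "norm (f' x v - A v) = norm (\<Sum>b\<in>Basis. (v \<bullet> b) *\<^sub>R (f' x b - A b))"
        using linear_sum[OF bounded_linear.linear[OF lin], of "\<lambda>b. (v \<bullet> b) *\<^sub>R b" Basis]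
        by (simp add: euclidean_representation linear_cmul[OF bounded_linear.linear[OF lin]])
      also have "\<dots> \<le> (\<Sum>b\<in>(Basis::'a set). norm v * e)"
        by (rule order_trans[OF norm_sum sum_mono])
          (auto intro!: mult_mono Basis_le_norm bd x)
      finally show "norm (f' x v - A v) \<le> DIM('a) * e * norm v" by (simp add: mult_ac)
    qed
  qed
  then show ?thesis
    by (simp add: linear_diff[OF bounded_linear.linear[OF A]] algebra_simps)
qed

text \<open>Both points vary, unlike in the definition of the derivative at \<open>x0\<close>; this
  is the form that gives local injectivity. The part of \<open>K\<close> in a ball is convex, so the
  mean value inequality works around boundary points too.\<close>

lemma C1_strict_derivative:
  fixes f :: "'a::euclidean_space \<Rightarrow> 'b::real_normed_vector"
  assumes K: "convex K" and f': "\<And>x. x \<in> K \<Longrightarrow> (f has_derivative f' x) (at x within K)"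
    and cont: "\<And>v. continuous_on K (\<lambda>x. f' x v)" and x0: "x0 \<in> K" and e: "e > 0"
  obtains d where "d > 0"
    "\<And>u w. u \<in> K \<inter> ball x0 d \<Longrightarrow> w \<in> K \<inter> ball x0 d \<Longrightarrow>
        norm (f u - f w - f' x0 (u - w)) \<le> e * norm (u - w)"
proof -
  \<comment> \<open>The division cancels the factor in
    \<open>differentiable_bound_coordinates\<close>.\<close>
  let ?e = "e / DIM('a)"
  have "?e > 0" using e by simp
  then have "\<forall>\<^sub>F x in at x0 within K. \<forall>b\<in>Basis. norm (f' x b - f' x0 b) < ?e"
    using cont x0 by (intro eventually_ball_finite) (auto simp: continuous_on_def tendsto_iff dist_norm)
  then obtain d where d: "d > 0"
    "\<And>x. x \<in> K \<Longrightarrow> x \<noteq> x0 \<Longrightarrow> dist x x0 < d \<Longrightarrow> \<forall>b\<in>Basis. norm (f' x b - f' x0 b) < ?e"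
    unfolding eventually_at by blast
  have d': "norm (f' x b - f' x0 b) \<le> ?e" if "x \<in> K \<inter> ball x0 d" "b \<in> Basis" for x b
    using d(2)[of x] that e by (cases "x = x0") (auto simp: dist_commute less_imp_le)
  show ?thesis
  proof (rule that[OF d(1)])
    fix u w assume uw: "u \<in> K \<inter> ball x0 d" "w \<in> K \<inter> ball x0 d"
    have "norm (f u - f w - f' x0 (u - w)) \<le> DIM('a) * ?e * norm (u - w)"
    proof (rule differentiable_bound_coordinates[OF _ _ _ d' uw])
      show "convex (K \<inter> ball x0 d)" using K by (simp add: convex_Int)
      show "(f has_derivative f' x) (at x within K \<inter> ball x0 d)" if "x \<in> K \<inter> ball x0 d" for x
        using has_derivative_subset[OF f'] that by blast
      show "bounded_linear (f' x0)" using f'[OF x0] by (rule has_derivative_bounded_linear)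
    qed
    then show "norm (f u - f w - f' x0 (u - w)) \<le> e * norm (u - w)" by simp
  qed
qed

text \<open>Near \<open>x0\<close> the mean value estimate against \<open>f' x0\<close> holds for
  pairs of interior points. It passes to pairs in \<open>K\<close> by continuity of
  \<open>f\<close>, because every point of a convex set with interior is a limit of interior points
  along a segment.\<close>

lemma has_derivative_extend_closure:
  fixes f :: "'a::euclidean_space \<Rightarrow> 'b::real_normed_vector"
  assumes K: "convex K" "interior K \<noteq> {}" and f: "continuous_on K f"
    and f': "\<And>x. x \<in> interior K \<Longrightarrow> (f has_derivative f' x) (at x)"
    and A: "bounded_linear (f' x0)"
    and cont: "\<And>v. continuous_on K (\<lambda>x. f' x v)" and x0: "x0 \<in> K"
  shows "(f has_derivative f' x0) (at x0 within K)"
  unfolding has_derivative_within_alt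
proof (intro conjI allI impI A)
  fix e :: real assume e: "e > 0"
  let ?e = "e / DIM('a)"
  have "?e > 0" using e by simp
  then have "\<forall>\<^sub>F x in at x0 within K. \<forall>b\<in>Basis. norm (f' x b - f' x0 b) < ?e"
    using cont x0 by (intro eventually_ball_finite) (auto simp: continuous_on_def tendsto_iff dist_norm)
  then obtain d where d: "d > 0"
    "\<And>x. x \<in> K \<Longrightarrow> x \<noteq> x0 \<Longrightarrow> dist x x0 < d \<Longrightarrow> \<forall>b\<in>Basis. norm (f' x b - f' x0 b) < ?e"
    unfolding eventually_at by blast
  let ?S = "interior K \<inter> ball x0 d"
  have d': "norm (f' x b - f' x0 b) \<le> ?e" if "x \<in> ?S" "b \<in> Basis" for x b
    using d(2)[of x] that e interior_subset[of K] by (cases "x = x0") (auto simp: dist_commute less_imp_le)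
  have bound: "norm (f u - f w - f' x0 (u - w)) \<le> e * norm (u - w)" if uw: "u \<in> ?S" "w \<in> ?S" for u w
  proof -
    have "norm (f u - f w - f' x0 (u - w)) \<le> DIM('a) * ?e * norm (u - w)"
    proof (rule differentiable_bound_coordinates[OF _ _ A d' uw])
      show "convex ?S" using K by (simp add: convex_Int convex_interior)
      show "(f has_derivative f' x) (at x within ?S)" if "x \<in> ?S" for x
        using has_derivative_at_withinI[OF f'] that by blast
    qed
    then show ?thesis by simp
  qed
  obtain c where c: "c \<in> interior K" using K by blast
  show "\<exists>d>0. \<forall>y\<in>K. norm (y - x0) < d \<longrightarrow> norm (f y - f x0 - f' x0 (y - x0)) \<le> e * norm (y - x0)"
  proof (intro exI[of _ d] conjI ballI impI d(1))
    fix y assume y: "y \<in> K" "norm (y - x0) < d"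
    \<comment> \<open>Moving \<open>z\<close> towards the interior point \<open>c\<close> reaches
      the interior for every small positive \<open>t\<close>, even from the boundary.\<close>
    define p where "p = (\<lambda>z t. z - t *\<^sub>R (z - c))"
    have p_lim: "(p z \<longlongrightarrow> z) (at_right 0)" for z
    proof -
      have "(p z \<longlongrightarrow> z - 0 *\<^sub>R (z - c)) (at_right 0)"
        unfolding p_def by (intro tendsto_intros)
      then show ?thesis by simp
    qed
    have ev1: "\<forall>\<^sub>F t in at_right 0. p z t \<in> interior K" if "z \<in> K" for z
      unfolding eventually_at_right_field p_def
      by (intro exI[of _ 1]) (auto intro!: mem_interior_convex_shrink[OF K(1) c that])
    have evS: "\<forall>\<^sub>F t in at_right 0. p z t \<in> ?S" if "z \<in> K" "dist x0 z < d" for z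
      using ev1[OF that(1)] topological_tendstoD[OF p_lim, of "ball x0 d" z] that(2)
      by (auto elim: eventually_elim2)
    have flim: "((\<lambda>t. f (p z t)) \<longlongrightarrow> f z) (at_right 0)" if "z \<in> K" for z
    proof (rule continuous_on_tendsto_compose[OF f p_lim that])
      show "\<forall>\<^sub>F t in at_right 0. p z t \<in> K"
        by (rule eventually_mono[OF ev1[OF that]]) (use interior_subset in blast)
    qed
    have Alim: "((\<lambda>t. f' x0 (p y t - p x0 t)) \<longlongrightarrow> f' x0 (y - x0)) (at_right 0)"
      by (intro bounded_linear.tendsto[OF A] tendsto_diff p_lim)
    show "norm (f y - f x0 - f' x0 (y - x0)) \<le> e * norm (y - x0)"
    proof (rule tendsto_le)
      show "((\<lambda>t. norm (f (p y t) - f (p x0 t) - f' x0 (p y t - p x0 t))) \<longlongrightarrow>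
          norm (f y - f x0 - f' x0 (y - x0))) (at_right 0)"
        by (intro tendsto_norm tendsto_diff flim Alim x0 y)
      show "((\<lambda>t. e * norm (p y t - p x0 t)) \<longlongrightarrow> e * norm (y - x0)) (at_right 0)"
        by (intro tendsto_intros p_lim)
      show "\<forall>\<^sub>F t in at_right 0. norm (f (p y t) - f (p x0 t) - f' x0 (p y t - p x0 t))
            \<le> e * norm (p y t - p x0 t)"
      proof -
        have "dist x0 x0 < d" "dist x0 y < d"
          using d(1) y(2) by (simp_all add: dist_norm norm_minus_commute)
        from evS[OF x0 this(1)] evS[OF y(1) this(2)] show ?thesis
          by eventually_elim (rule bound)
      qed
    qed simp
  qed
qed

section \<open>Directional and Frechet derivatives in Euclidean space\<close>

lemma has_dir_deriv_euclidean_iff: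
  "has_dir_deriv euclidean f x v l \<longleftrightarrow>
    ((\<lambda>t. f (x + t *\<^sub>R v)) has_vector_derivative l) (at 0)"
proof -
  have "has_dir_deriv euclidean f x v l \<longleftrightarrow>
     ((\<lambda>t. (f (x + t *\<^sub>R v) - f x) /\<^sub>R t - l) \<longlongrightarrow> 0) (at 0)"
    by (simp add: has_dir_deriv_def LIM_zero_iff)
  also have "\<dots> \<longleftrightarrow> ((\<lambda>t. norm ((f (x + t *\<^sub>R v) - f x) /\<^sub>R t - l)) \<longlongrightarrow> 0) (at 0)"
    by (simp add: tendsto_norm_zero_iff)
  also have "\<dots> \<longleftrightarrow> ((\<lambda>t. norm (f (x + t *\<^sub>R v) - f x - t *\<^sub>R l) / norm t) \<longlongrightarrow> 0) (at 0)"
  proof (rule tendsto_cong)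
    have "norm ((f (x + t *\<^sub>R v) - f x) /\<^sub>R t - l) = norm (f (x + t *\<^sub>R v) - f x - t *\<^sub>R l) / norm t"
      if "t \<noteq> 0" for t
    proof -
      have "(f (x + t *\<^sub>R v) - f x) /\<^sub>R t - l = (f (x + t *\<^sub>R v) - f x - t *\<^sub>R l) /\<^sub>R t"
        using that by (simp add: scaleR_diff_right)
      then show ?thesis by (simp add: divide_inverse mult.commute)
    qed
    then show "\<forall>\<^sub>F t in at 0. norm ((f (x + t *\<^sub>R v) - f x) /\<^sub>R t - l) =
        norm (f (x + t *\<^sub>R v) - f x - t *\<^sub>R l) / norm t"
      by (auto simp: eventually_at intro!: exI[of _ 1])
  qed
  also have "\<dots> \<longleftrightarrow> ((\<lambda>t. f (x + t *\<^sub>R v)) has_vector_derivative l) (at 0)"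
    by (simp add: has_vector_derivative_def has_derivative_at bounded_linear_scaleR_left)
  finally show ?thesis .
qed

lemma has_dir_deriv_of_has_derivative:
  assumes "(f has_derivative f') (at x)"
  shows "has_dir_deriv euclidean f x v (f' v)"
proof -
  have "((\<lambda>t::real. x + t *\<^sub>R v) has_derivative (\<lambda>t. t *\<^sub>R v)) (at 0)"
    by (auto intro!: derivative_eq_intros)
  moreover have "(f has_derivative f') (at (x + (0::real) *\<^sub>R v))" using assms by simp
  ultimately have "((\<lambda>t::real. f (x + t *\<^sub>R v)) has_derivative (\<lambda>t. f' (t *\<^sub>R v))) (at 0)"
    by (rule has_derivative_compose)
  then show ?thesis
    using linear_cmul[OF has_derivative_linear[OF assms]]
    by (simp add: has_dir_deriv_euclidean_iff has_vector_derivative_def)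
qed

text \<open>The increment is made one coordinate at a time, by induction on the set \<open>B\<close>
  of coordinates already moved. Moving one more coordinate is a one-dimensional mean value estimate,
  with half of \<open>e\<close> spent on it and half on the earlier ones.\<close>

lemma has_derivative_partials_continuous:
  fixes f :: "'a::euclidean_space \<Rightarrow> 'b::real_normed_vector"
  assumes U: "open U" "x0 \<in> U"
    and part: "\<And>x b. x \<in> U \<Longrightarrow> b \<in> Basis \<Longrightarrow> has_dir_deriv euclidean f x b (h b x)"
    and cont: "\<And>b. b \<in> Basis \<Longrightarrow> continuous_on U (h b)"
  shows "(f has_derivative (\<lambda>w. \<Sum>b\<in>Basis. (w \<bullet> b) *\<^sub>R h b x0)) (at x0)"
proof -
  have main: "\<exists>d>0. \<forall>w. norm w < d \<longrightarrow>
      norm (f (x0 + (\<Sum>b\<in>B. (w \<bullet> b) *\<^sub>R b)) - f x0 - (\<Sum>b\<in>B. (w \<bullet> b) *\<^sub>R h b x0)) \<le> e * norm w"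
    if "finite B" "B \<subseteq> Basis" "e > 0" for B and e :: real
    using that
  proof (induction B arbitrary: e rule: finite_induct)
    case (insert b B)
    then have b: "b \<in> Basis" and e2: "e / 2 > 0" by auto
    obtain d1 where d1: "d1 > 0" "\<And>w. norm w < d1 \<Longrightarrow>
        norm (f (x0 + (\<Sum>b\<in>B. (w \<bullet> b) *\<^sub>R b)) - f x0 - (\<Sum>b\<in>B. (w \<bullet> b) *\<^sub>R h b x0)) \<le> e / 2 * norm w"
      using insert.IH[OF _ e2] insert.prems by auto
    have "isCont (h b) x0" using cont[OF b] U by (simp add: continuous_on_eq_continuous_at)
    then obtain d2 where d2: "d2 > 0" "\<And>x. dist x x0 < d2 \<Longrightarrow> dist (h b x) (h b x0) < e / 2"
      using e2 unfolding continuous_at_eps_delta by blast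
    obtain d3 where d3: "d3 > 0" "ball x0 d3 \<subseteq> U" using U open_contains_ball by blast
    \<comment> \<open>Each of at most \<open>card B + 1\<close> coordinate moves has length at most
      \<open>norm w\<close>, so all intermediate points lie within \<open>?n * norm w\<close> of
      \<open>x0\<close>.\<close>
    let ?n = "real (card B) + 1"
    define d where "d = min d1 (min d2 d3 / ?n)"
    have "d > 0" using d1 d2 d3 by (simp add: d_def)
    moreover have "norm (f (x0 + (\<Sum>b\<in>insert b B. (w \<bullet> b) *\<^sub>R b)) - f x0
        - (\<Sum>b\<in>insert b B. (w \<bullet> b) *\<^sub>R h b x0)) \<le> e * norm w" if w: "norm w < d" for w
    proof -
      define p where "p = x0 + (\<Sum>b\<in>B. (w \<bullet> b) *\<^sub>R b)"
      define q where "q = (\<lambda>s. p + s *\<^sub>R b)"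
      let ?I = "closed_segment 0 (w \<bullet> b)"
      have near: "dist (q s) x0 < min d2 d3" if s: "s \<in> ?I" for s
      proof -
        have "\<bar>s\<bar> \<le> norm w"
          using s Basis_le_norm[OF b, of w] by (auto simp: closed_segment_eq_real_ivl split: if_splits)
        then have "norm (s *\<^sub>R b) \<le> norm w" using b by simp
        moreover have "norm (\<Sum>b\<in>B. (w \<bullet> b) *\<^sub>R b) \<le> (\<Sum>b\<in>B. norm w)"
          using insert.prems
          by (intro order_trans[OF norm_sum sum_mono]) (auto simp: Basis_le_norm subset_iff)
        ultimately have "dist (q s) x0 \<le> ?n * norm w"
          using norm_triangle_ineq[of "\<Sum>b\<in>B. (w \<bullet> b) *\<^sub>R b" "s *\<^sub>R b"]
          by (simp add: q_def p_def dist_norm algebra_simps)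
        moreover have "norm w < min d2 d3 / ?n" using w by (simp add: d_def)
        then have "?n * norm w < min d2 d3" by (simp add: pos_less_divide_eq mult.commute)
        ultimately show ?thesis by simp
      qed
      \<comment> \<open>Subtracting the linear term leaves a function of \<open>s\<close> whose
        derivative is the difference of two nearby values of \<open>h b\<close>.\<close>
      have der: "((\<lambda>s. f (q s) - s *\<^sub>R h b x0) has_derivative
          (\<lambda>t. t *\<^sub>R (h b (q s) - h b x0))) (at s within ?I)" if s: "s \<in> ?I" for s
      proof -
        have "q s \<in> U" using near[OF s] d3 by (auto simp: dist_commute)
        then have "((\<lambda>t. f (q s + t *\<^sub>R b)) has_vector_derivative h b (q s)) (at (s - s))"
          using part b by (simp add: has_dir_deriv_euclidean_iff)
        moreover have "((\<lambda>r. r - s) has_vector_derivative 1) (at s)"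
          by (auto intro!: derivative_eq_intros)
        ultimately have "((\<lambda>r. f (q s + (r - s) *\<^sub>R b)) has_vector_derivative 1 *\<^sub>R h b (q s)) (at s)"
          using vector_diff_chain_at[of "\<lambda>r. r - s" 1 s "\<lambda>t. f (q s + t *\<^sub>R b)"] by (simp add: o_def)
        moreover have "q s + (r - s) *\<^sub>R b = q r" for r by (simp add: q_def algebra_simps)
        ultimately have "((\<lambda>r. f (q r)) has_vector_derivative h b (q s)) (at s)" by simp
        then have "((\<lambda>r. f (q r)) has_derivative (\<lambda>t. t *\<^sub>R h b (q s))) (at s within ?I)"
          by (simp add: has_vector_derivative_def has_derivative_at_withinI)
        from has_derivative_diff[OF this bounded_linear_imp_has_derivative[OF bounded_linear_scaleR_left[of "h b x0"]]]
        show ?thesis by (simp add: scaleR_diff_right)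
      qed
      have "norm ((f (q (w \<bullet> b)) - (w \<bullet> b) *\<^sub>R h b x0) - (f (q 0) - 0 *\<^sub>R h b x0))
          \<le> e / 2 * norm (w \<bullet> b - 0)"
      proof (rule differentiable_bound[OF _ der])
        fix s assume "s \<in> ?I"
        then have "norm (h b (q s) - h b x0) \<le> e / 2"
          using d2(2)[of "q s"] near by (auto simp: dist_norm less_imp_le)
        then show "onorm (\<lambda>t. t *\<^sub>R (h b (q s) - h b x0)) \<le> e / 2"
          by (intro onorm_le)
            (simp add: mult.commute[of "e / 2"] mult_left_mono del: times_divide_eq_left times_divide_eq_right)
      qed auto
      also have "\<dots> \<le> e / 2 * norm w"
        using e2 Basis_le_norm[OF b, of w] by (intro mult_left_mono) auto
      finally have 2: "norm (f (q (w \<bullet> b)) - f p - (w \<bullet> b) *\<^sub>R h b x0) \<le> e / 2 * norm w"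
        by (simp add: q_def algebra_simps)
      have 1: "norm (f p - f x0 - (\<Sum>b\<in>B. (w \<bullet> b) *\<^sub>R h b x0)) \<le> e / 2 * norm w"
        unfolding p_def using d1(2)[of w] w by (simp add: d_def)
      have "x0 + (\<Sum>b\<in>insert b B. (w \<bullet> b) *\<^sub>R b) = q (w \<bullet> b)"
        using insert.hyps by (simp add: q_def p_def algebra_simps)
      moreover have "f (q (w \<bullet> b)) - f x0 - (\<Sum>b\<in>insert b B. (w \<bullet> b) *\<^sub>R h b x0) =
         (f p - f x0 - (\<Sum>b\<in>B. (w \<bullet> b) *\<^sub>R h b x0)) + (f (q (w \<bullet> b)) - f p - (w \<bullet> b) *\<^sub>R h b x0)"
        using insert.hyps by (simp add: algebra_simps)
      moreover have "norm ((f p - f x0 - (\<Sum>b\<in>B. (w \<bullet> b) *\<^sub>R h b x0)) +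
          (f (q (w \<bullet> b)) - f p - (w \<bullet> b) *\<^sub>R h b x0)) \<le> e * norm w"
        by (rule order_trans[OF norm_triangle_ineq]) (use 1 2 in simp)
      ultimately show ?thesis by (simp only:)
    qed
    ultimately show ?case by blast
  qed (auto intro: exI[of _ 1])
  have "bounded_linear (\<lambda>w. \<Sum>b\<in>Basis. (w \<bullet> b) *\<^sub>R h b x0)"
    by (intro bounded_linear_sum bounded_linear_compose[OF bounded_linear_scaleR_left]
        bounded_linear_inner_left)
  moreover have "\<exists>d>0. \<forall>y. norm (y - x0) < d \<longrightarrow>
      norm (f y - f x0 - (\<Sum>b\<in>Basis. ((y - x0) \<bullet> b) *\<^sub>R h b x0)) \<le> e * norm (y - x0)"
    if e: "e > 0" for e
  proof -
    obtain d where d: "d > 0" "\<And>w. norm w < d \<Longrightarrow>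
      norm (f (x0 + (\<Sum>b\<in>Basis. (w \<bullet> b) *\<^sub>R b)) - f x0 - (\<Sum>b\<in>Basis. (w \<bullet> b) *\<^sub>R h b x0)) \<le> e * norm w"
      using main[OF finite_Basis order_refl e] by blast
    show ?thesis using d(1) d(2)[of "y - x0" for y]
      by (intro exI[of _ d]) (simp add: euclidean_representation)
  qed
  ultimately show ?thesis by (simp add: has_derivative_within_alt)
qed

section \<open>Iterated derivatives up to the boundary\<close>

text \<open>Unlike \<open>iter_dir_deriv\<close>, this is meaningful at boundary points. For maps of
  class \<open>Ck\<close> it is the continuous extension that the definition of C^r asks
  for.\<close>

primrec iter_within ::
  "'a::real_normed_vector set \<Rightarrow> ('a \<Rightarrow> 'b::real_normed_vector) \<Rightarrow> nat \<Rightarrow> 'a \<Rightarrow> (nat \<Rightarrow> 'a) \<Rightarrow> 'b" where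
  "iter_within K f 0 x y = f x"
| "iter_within K f (Suc k) x y = frechet_derivative (\<lambda>z. iter_within K f k z y) (at x within K) (y k)"

lemma iter_within_Suc_shift:
  "iter_within K f (Suc k) x y =
    iter_within K (\<lambda>z. frechet_derivative f (at z within K) (y 0)) k x (\<lambda>i. y (Suc i))"
  by (induction k arbitrary: x) simp_all

text \<open>Both sides are choices from the same set of derivatives, hence equal even where that set
  is empty.\<close>

lemma frechet_derivative_within_cong:
  assumes "\<And>z. z \<in> K \<Longrightarrow> f z = g z" "x \<in> K"
  shows "frechet_derivative f (at x within K) = frechet_derivative g (at x within K)"
proof -
  have "(f has_derivative D) (at x within K) \<longleftrightarrow> (g has_derivative D) (at x within K)" for D
    using assms has_derivative_transform[of x K g f D] has_derivative_transform[of x K f g D] by auto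
  then show ?thesis by (simp add: frechet_derivative_def)
qed

lemma iter_within_cong:
  "(\<And>z. z \<in> K \<Longrightarrow> f z = g z) \<Longrightarrow> x \<in> K \<Longrightarrow> iter_within K f k x y = iter_within K g k x y"
proof (induction k arbitrary: x)
  case (Suc k)
  have "frechet_derivative (\<lambda>z. iter_within K f k z y) (at x within K) =
      frechet_derivative (\<lambda>z. iter_within K g k z y) (at x within K)"
    by (rule frechet_derivative_within_cong) (use Suc in auto)
  then show ?case by simp
qed simp

lemma Ck_has_frechet_derivative:
  assumes "Ck (Suc k) K f" "x \<in> K"
  shows "(f has_derivative frechet_derivative f (at x within K)) (at x within K)"
  using assms by (meson Ck_SucE differentiableI frechet_derivative_works)

section \<open>Convex bodies: iterated derivatives within \<open>K\<close>\<close>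

locale convex_body =
  fixes K :: "'a::euclidean_space set"
  assumes compact: "compact K" and convex: "convex K" and interior_nonempty: "interior K \<noteq> {}"
begin

lemma closure_interior: "closure (interior K) = K"
  using convex_closure_interior[OF convex interior_nonempty] closure_closed[OF compact_imp_closed[OF compact]]
  by simp

lemma eq_on_if_eq_on_interior:
  fixes f g :: "'a \<Rightarrow> 'b::real_normed_vector"
  assumes "continuous_on K f" "continuous_on K g" "\<And>x. x \<in> interior K \<Longrightarrow> f x = g x" "x \<in> K"
  shows "f x = g x"
proof -
  have "continuous_on (closure (interior K)) (\<lambda>x. f x - g x)"
    using assms by (simp add: closure_interior continuous_on_diff)
  then have "f x - g x = 0"
    by (rule continuous_constant_on_closure) (use assms closure_interior in auto)
  then show ?thesis by simp
qed

lemma frechet_derivative_within_eqI: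
  assumes "x \<in> K" "(f has_derivative f') (at x within K)"
  shows "frechet_derivative f (at x within K) = f'"
  using has_derivative_unique_within_convex[OF convex interior_nonempty assms(1) _ assms(2)]
    assms(2) differentiableI frechet_derivative_works by blast

lemma Ck_frechet_derivative:
  assumes "Ck (Suc k) K f"
  shows "Ck k K (\<lambda>x. frechet_derivative f (at x within K) v)"
proof -
  obtain f' where f': "\<And>x. x \<in> K \<Longrightarrow> (f has_derivative f' x) (at x within K)"
    "\<And>v. Ck k K (\<lambda>x. f' x v)"
    using assms by (rule Ck_SucE) blast
  show ?thesis
    by (rule Ck_cong[OF _ f'(2)[of v]]) (simp add: frechet_derivative_within_eqI[OF _ f'(1)])
qed

lemma Ck_iter_within: "Ck (k + m) K f \<Longrightarrow> Ck m K (\<lambda>x. iter_within K f k x y)"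
proof (induction k arbitrary: m)
  case (Suc k)
  have "Ck (Suc m) K (\<lambda>x. iter_within K f k x y)" using Suc by (intro Suc.IH) simp
  then show ?case by (simp add: Ck_frechet_derivative)
qed simp

lemma iter_within_has_derivative:
  assumes "Ck (Suc k) K f" "x \<in> K"
  shows "((\<lambda>z. iter_within K f k z y) has_derivative
    frechet_derivative (\<lambda>z. iter_within K f k z y) (at x within K)) (at x within K)"
  using assms by (intro Ck_has_frechet_derivative[of 0] Ck_iter_within) simp_all

lemma iter_within_add:
  "Ck k K f \<Longrightarrow> Ck k K g \<Longrightarrow> x \<in> K \<Longrightarrow>
    iter_within K (\<lambda>x. f x + g x) k x y = iter_within K f k x y + iter_within K g k x y"
proof (induction k arbitrary: x)
  case (Suc k)
  have "frechet_derivative (\<lambda>z. iter_within K (\<lambda>x. f x + g x) k z y) (at x within K) =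
    frechet_derivative (\<lambda>z. iter_within K f k z y + iter_within K g k z y) (at x within K)"
    by (rule frechet_derivative_within_cong) (use Suc Ck_SucD in blast)+
  also have "\<dots> = (\<lambda>v. frechet_derivative (\<lambda>z. iter_within K f k z y) (at x within K) v +
      frechet_derivative (\<lambda>z. iter_within K g k z y) (at x within K) v)"
    using Suc.prems
    by (intro frechet_derivative_within_eqI has_derivative_add iter_within_has_derivative)
  finally show ?case by simp
qed simp

lemma iter_within_scaleR:
  "Ck k K f \<Longrightarrow> x \<in> K \<Longrightarrow>
    iter_within K (\<lambda>x. c *\<^sub>R f x) k x y = c *\<^sub>R iter_within K f k x y"
proof (induction k arbitrary: x)
  case (Suc k)
  have "frechet_derivative (\<lambda>z. iter_within K (\<lambda>x. c *\<^sub>R f x) k z y) (at x within K) =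
    frechet_derivative (\<lambda>z. c *\<^sub>R iter_within K f k z y) (at x within K)"
    by (rule frechet_derivative_within_cong) (use Suc Ck_SucD in blast)+
  also have "\<dots> = (\<lambda>v. c *\<^sub>R frechet_derivative (\<lambda>z. iter_within K f k z y) (at x within K) v)"
    using Suc.prems
    by (intro frechet_derivative_within_eqI has_derivative_scaleR_right iter_within_has_derivative)
  finally show ?case by simp
qed simp

lemma iter_within_zero:
  assumes "x \<in> K" shows "iter_within K (\<lambda>_. 0) k x y = 0"
proof -
  \<comment> \<open>Writing zero as a zero multiple reduces the claim to homogeneity.\<close>
  have "iter_within K (\<lambda>_. 0 *\<^sub>R 0) k x y = 0 *\<^sub>R iter_within K (\<lambda>_. 0) k x y"
    by (rule iter_within_scaleR[OF Ck_const assms])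
  then show ?thesis by simp
qed

lemma iter_within_sum:
  assumes "finite I" and "x \<in> K"
  shows "(\<And>i. i \<in> I \<Longrightarrow> Ck k K (f i)) \<Longrightarrow>
    iter_within K (\<lambda>x. \<Sum>i\<in>I. c i *\<^sub>R f i x) k x y = (\<Sum>i\<in>I. c i *\<^sub>R iter_within K (f i) k x y)"
  using assms(1)
proof (induction I)
  case empty
  then show ?case using iter_within_zero[OF assms(2)] by simp
next
  case (insert i I)
  have "iter_within K (\<lambda>x. c i *\<^sub>R f i x + (\<Sum>i\<in>I. c i *\<^sub>R f i x)) k x y =
     iter_within K (\<lambda>x. c i *\<^sub>R f i x) k x y + iter_within K (\<lambda>x. \<Sum>i\<in>I. c i *\<^sub>R f i x) k x y"
    using insert.prems by (intro iter_within_add Ck_sum Ck_scaleR Ck_const assms(2)) auto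
  then show ?case using insert assms(2) by (simp add: iter_within_scaleR)
qed

text \<open>Expanding the first direction in the standard basis reduces joint continuity in the point and
  the directions to continuity in the point.\<close>

lemma continuous_map_iter_within:
  fixes f :: "'a \<Rightarrow> 'b::euclidean_space"
  assumes p: "continuous_map T (top_of_set K) p"
  shows "Ck k K f \<Longrightarrow> (\<And>i. i < k \<Longrightarrow> continuous_map T euclidean (\<lambda>t. q t i)) \<Longrightarrow>
    continuous_map T euclidean (\<lambda>t. iter_within K f k (p t) (q t))"
proof (induction k arbitrary: f q)
  case 0
  then have "continuous_map (top_of_set K) euclidean f" by simp
  from continuous_map_compose[OF p this] show ?case by (simp add: o_def)
next
  case (Suc k)
  let ?D = "\<lambda>v z. frechet_derivative f (at z within K) v"
  have pK: "p t \<in> K" if "t \<in> topspace T" for t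
    using p that by (auto simp: continuous_map_in_subtopology)
  have D: "Ck k K (?D v)" for v using Suc.prems(1) by (rule Ck_frechet_derivative)
  have expand: "iter_within K f (Suc k) (p t) (q t) =
      (\<Sum>b\<in>Basis. (q t 0 \<bullet> b) *\<^sub>R iter_within K (?D b) k (p t) (\<lambda>i. q t (Suc i)))"
    if t: "t \<in> topspace T" for t
  proof -
    have "?D v z = (\<Sum>b\<in>Basis. (v \<bullet> b) *\<^sub>R ?D b z)" if z: "z \<in> K" for z v
    proof -
      have lin: "linear (frechet_derivative f (at z within K))"
        using Ck_has_frechet_derivative[OF Suc.prems(1) z] by (rule has_derivative_linear)
      have "?D v z = ?D (\<Sum>b\<in>Basis. (v \<bullet> b) *\<^sub>R b) z" by (simp add: euclidean_representation)
      then show ?thesis by (simp add: linear_sum[OF lin] linear_cmul[OF lin])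
    qed
    then have "iter_within K f (Suc k) (p t) (q t) =
        iter_within K (\<lambda>z. \<Sum>b\<in>Basis. (q t 0 \<bullet> b) *\<^sub>R ?D b z) k (p t) (\<lambda>i. q t (Suc i))"
      unfolding iter_within_Suc_shift by (rule iter_within_cong[OF _ pK[OF t]])
    also have "\<dots> = (\<Sum>b\<in>Basis. (q t 0 \<bullet> b) *\<^sub>R iter_within K (?D b) k (p t) (\<lambda>i. q t (Suc i)))"
      by (rule iter_within_sum[OF finite_Basis pK[OF t] D])
    finally show ?thesis .
  qed
  have IH: "continuous_map T euclidean (\<lambda>t. iter_within K (?D b) k (p t) (\<lambda>i. q t (Suc i)))" for b
    using Suc.prems(2) by (intro Suc.IH D) auto
  have "continuous_map T euclidean
      (\<lambda>t. \<Sum>b\<in>Basis. (q t 0 \<bullet> b) *\<^sub>R iter_within K (?D b) k (p t) (\<lambda>i. q t (Suc i)))"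
    using IH Suc.prems(2)[of 0] unfolding continuous_map_atin limitin_canonical_iff
    by (intro ballI tendsto_sum tendsto_scaleR tendsto_inner tendsto_const) auto
  then show ?case by (rule continuous_map_eq) (simp add: expand del: iter_within.simps)
qed

section \<open>Comparison with directional derivatives and their extensions\<close>

lemma has_dir_deriv_iter_within:
  assumes "Ck (Suc k) K f" "x \<in> interior K"
  shows "has_dir_deriv euclidean (\<lambda>z. iter_within K f k z y) x v
    (frechet_derivative (\<lambda>z. iter_within K f k z y) (at x within K) v)"
proof -
  have "x \<in> K" using assms(2) interior_subset by auto
  from iter_within_has_derivative[OF assms(1) this] at_within_interior[OF assms(2)]
  have "((\<lambda>z. iter_within K f k z y) has_derivative
    frechet_derivative (\<lambda>z. iter_within K f k z y) (at x within K)) (at x)" by simp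
  then show ?thesis by (rule has_dir_deriv_of_has_derivative)
qed

lemma interior_openin: "openin euclidean (interior K)" by simp

lemma iter_dir_deriv_eq_iter_within:
  fixes f :: "'a \<Rightarrow> 'b::euclidean_space"
  shows "Ck k K f \<Longrightarrow> x \<in> interior K \<Longrightarrow> iter_dir_deriv euclidean f k x y = iter_within K f k x y"
proof (induction k arbitrary: x)
  case (Suc k)
  note eq = Suc.IH[OF Ck_SucD[OF Suc.prems(1)]]
  have "has_dir_deriv euclidean (\<lambda>z. iter_dir_deriv euclidean f k z y) x (y k)
      (iter_within K f (Suc k) x y)"
    by (rule iffD2[OF has_dir_deriv_cong[OF locally_convex_space_euclidean interior_openin Suc.prems(2) _ eq]])
      (simp_all add: has_dir_deriv_iter_within[OF Suc.prems])
  then show ?case by (simp add: dir_deriv_eqI)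
qed simp

lemma has_dir_deriv_iter_dir_deriv:
  fixes f :: "'a \<Rightarrow> 'b::euclidean_space"
  assumes "Ck (Suc k) K f" "x \<in> interior K"
  shows "\<exists>l. has_dir_deriv euclidean (\<lambda>z. iter_dir_deriv euclidean f k z y) x v l"
proof -
  note eq = iter_dir_deriv_eq_iter_within[OF Ck_SucD[OF assms(1)]]
  have "has_dir_deriv euclidean (\<lambda>z. iter_dir_deriv euclidean f k z y) x v
     (frechet_derivative (\<lambda>z. iter_within K f k z y) (at x within K) v)"
    by (rule iffD2[OF has_dir_deriv_cong[OF locally_convex_space_euclidean interior_openin assms(2) _ eq]])
      (simp_all add: has_dir_deriv_iter_within[OF assms])
  then show ?thesis ..
qed

abbreviation ext_iter :: "nat \<Rightarrow> ('a \<Rightarrow> 'b::euclidean_space) \<Rightarrow> 'a \<times> (nat \<Rightarrow> 'a) \<Rightarrow> 'b" where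
  "ext_iter k f \<equiv> restrict (\<lambda>(x, y). iter_within K f k x y) (topspace (dom_top K k))"

lemma continuous_map_ext_iter:
  fixes f :: "'a \<Rightarrow> 'b::euclidean_space"
  assumes "Ck k K f"
  shows "continuous_map (dom_top K k) euclidean (ext_iter k f)"
proof -
  have "continuous_map (dom_top K k) euclidean (\<lambda>p. iter_within K f k (fst p) (snd p))"
  proof (rule continuous_map_iter_within[OF continuous_map_fst assms])
    fix i assume "i < k"
    then have "i \<in> {..<k}" by simp
    from continuous_map_compose[OF continuous_map_snd continuous_map_product_projection[OF this]]
    show "continuous_map (dom_top K k) euclidean (\<lambda>p. snd p i)" by (simp add: o_def)
  qed
  then show ?thesis by (rule continuous_map_eq) (auto simp: case_prod_unfold)
qed

lemma is_ext_deriv_ext_iter: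
  fixes f :: "'a \<Rightarrow> 'b::euclidean_space"
  assumes "Ck k K f"
  shows "is_ext_deriv K k f (ext_iter k f)"
  using continuous_map_ext_iter[OF assms] interior_subset[of K]
  by (auto simp: is_ext_deriv_def iter_dir_deriv_eq_iter_within[OF assms])

lemma is_ext_deriv_slice:
  fixes g :: "'a \<times> (nat \<Rightarrow> 'a) \<Rightarrow> 'b::euclidean_space"
  assumes g: "is_ext_deriv K k f g" and y: "y \<in> topspace (power_topology euclidean k)"
  shows "continuous_on K (\<lambda>x. g (x, y))"
proof -
  have "continuous_map (top_of_set K) (dom_top K k) (\<lambda>x. (x, y))"
    using y by (intro continuous_map_pairedI) auto
  moreover have "continuous_map (dom_top K k) euclidean g" using g by (simp add: is_ext_deriv_def)
  ultimately have "continuous_map (top_of_set K) euclidean (g \<circ> (\<lambda>x. (x, y)))"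
    by (rule continuous_map_compose)
  then show ?thesis by (simp add: o_def)
qed

text \<open>For each fixed tuple of directions, two extensions agree on the dense set
  \<open>interior K\<close>. This gives the definite description in \<open>ext_deriv\<close> its
  meaning.\<close>

lemma is_ext_deriv_unique:
  fixes g g' :: "'a \<times> (nat \<Rightarrow> 'a) \<Rightarrow> 'b::euclidean_space"
  assumes g: "is_ext_deriv K k f g" and g': "is_ext_deriv K k f g'"
  shows "g = g'"
proof (rule extensionalityI)
  show "g \<in> extensional (topspace (dom_top K k))" "g' \<in> extensional (topspace (dom_top K k))"
    using g g' by (simp_all add: is_ext_deriv_def)
  fix p assume "p \<in> topspace (dom_top K k)"
  then obtain x y where p: "p = (x, y)" "x \<in> K" "y \<in> topspace (power_topology euclidean k)" by auto
  have "g (x, y) = g' (x, y)"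
    using g g' p(3)
    by (intro eq_on_if_eq_on_interior[OF is_ext_deriv_slice[OF g p(3)] is_ext_deriv_slice[OF g' p(3)] _ p(2)])
      (simp add: is_ext_deriv_def)
  then show "g p = g' p" using p by simp
qed

lemma ext_deriv_eq:
  fixes f :: "'a \<Rightarrow> 'b::euclidean_space"
  assumes "Ck k K f"
  shows "ext_deriv K k f = ext_iter k f"
  unfolding ext_deriv_def
  using is_ext_deriv_ext_iter[OF assms] is_ext_deriv_unique by blast

text \<open>Continuous partial derivatives make \<open>f\<close> Frechet differentiable on the
  interior, and their continuous extensions carry this to the boundary by
  \<open>has_derivative_extend_closure\<close>. The induction then continues with the first
  derivative in a fixed direction, which is why the extension is only asked for with fixed
  directions.\<close>

lemma Ck_if_extensions:
  fixes f :: "'a \<Rightarrow> 'b::euclidean_space"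
  shows "continuous_on K f \<Longrightarrow>
    (\<And>j x y. j < k \<Longrightarrow> x \<in> interior K \<Longrightarrow>
       \<exists>l. has_dir_deriv euclidean (\<lambda>z. iter_dir_deriv euclidean f j z y) x (y j) l) \<Longrightarrow>
    (\<And>j y. j \<le> k \<Longrightarrow> \<exists>h. continuous_on K h \<and> (\<forall>x\<in>interior K. h x = iter_dir_deriv euclidean f j x y)) \<Longrightarrow>
    Ck k K f"
proof (induction k arbitrary: f)
  case (Suc k)
  have "\<exists>h. continuous_on K h \<and> (\<forall>x\<in>interior K. h x = dir_deriv euclidean f x v)" for v
    using Suc.prems(3)[of 1 "\<lambda>_. v"] by simp
  then obtain h where h: "\<And>v. continuous_on K (h v)"
    "\<And>v x. x \<in> interior K \<Longrightarrow> h v x = dir_deriv euclidean f x v"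
    by metis
  have part: "has_dir_deriv euclidean f x v (h v x)" if x: "x \<in> interior K" for x v
  proof -
    obtain l where l: "has_dir_deriv euclidean f x v l"
      using Suc.prems(2)[OF zero_less_Suc x, of "\<lambda>_. v"] by auto
    then show ?thesis using h(2)[OF x] dir_deriv_eqI[OF _ l] by simp
  qed
  \<comment> \<open>Only the extensions in basis directions are used, so that \<open>F x\<close> is
    linear by construction, also at boundary points, where nothing is known yet about how
    \<open>h v\<close> depends on \<open>v\<close>.\<close>
  define F where "F = (\<lambda>x w. \<Sum>b\<in>Basis. (w \<bullet> b) *\<^sub>R h b x)"
  have F_cont: "continuous_on K (\<lambda>x. F x w)" for w
    unfolding F_def by (intro continuous_intros h)
  have F_lin: "bounded_linear (F x)" for x
    unfolding F_def by (intro bounded_linear_sum bounded_linear_compose[OF bounded_linear_scaleR_left]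
        bounded_linear_inner_left)
  have F_int: "(f has_derivative F x) (at x)" if "x \<in> interior K" for x
    unfolding F_def
    by (rule has_derivative_partials_continuous[OF open_interior that part])
      (use h(1) continuous_on_subset interior_subset in blast)+
  have F_der: "(f has_derivative F x) (at x within K)" if "x \<in> K" for x
    by (rule has_derivative_extend_closure[OF convex interior_nonempty Suc.prems(1) F_int F_lin F_cont that])
  have F_dir: "F z v = dir_deriv euclidean f z v" if "z \<in> interior K" for z v
    using dir_deriv_eqI[OF _ has_dir_deriv_of_has_derivative[OF F_int[OF that]]] by simp
  have "Ck k K (\<lambda>x. F x v)" for v
  proof (rule Suc.IH[OF F_cont])
    \<comment> \<open>\<open>case_nat v y\<close> places \<open>v\<close> in front of
      \<open>y\<close> as direction \<open>0\<close>.\<close>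
    have iter: "iter_dir_deriv euclidean (\<lambda>x. F x v) j x y =
        iter_dir_deriv euclidean f (Suc j) x (case_nat v y)" if "x \<in> interior K" for j x y
    proof -
      have "iter_dir_deriv euclidean (\<lambda>x. F x v) j x y =
          iter_dir_deriv euclidean (\<lambda>z. dir_deriv euclidean f z v) j x y"
        by (rule iter_dir_deriv_cong[OF locally_convex_space_euclidean interior_openin F_dir that]) simp_all
      then show ?thesis unfolding iter_dir_deriv_Suc_shift by simp
    qed
    show "\<exists>l. has_dir_deriv euclidean (\<lambda>z. iter_dir_deriv euclidean (\<lambda>x. F x v) j z y) x (y j) l"
      if jx: "j < k" "x \<in> interior K" for j x y
    proof -
      obtain l where "has_dir_deriv euclidean
          (\<lambda>z. iter_dir_deriv euclidean f (Suc j) z (case_nat v y)) x (y j) l"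
        using Suc.prems(2)[of "Suc j" x "case_nat v y"] jx by auto
      then have "has_dir_deriv euclidean (\<lambda>z. iter_dir_deriv euclidean (\<lambda>x. F x v) j z y) x (y j) l"
        by (subst has_dir_deriv_cong[OF locally_convex_space_euclidean interior_openin jx(2) _ iter]) auto
      then show ?thesis ..
    qed
    show "\<exists>h. continuous_on K h \<and> (\<forall>x\<in>interior K. h x = iter_dir_deriv euclidean (\<lambda>x. F x v) j x y)"
      if "j \<le> k" for j y
      using Suc.prems(3)[of "Suc j" "case_nat v y"] that iter by auto
  qed
  with F_der show ?case by (rule Ck_SucI)
qed simp

text \<open>This replaces directional derivatives and extensions by derivatives within
  \<open>K\<close>, for which chain rule and inversion are available. For infinite \<open>r\<close>
  the right-hand side collects all finite orders.\<close>

lemma Cr_on_iff: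
  fixes f :: "'a \<Rightarrow> 'b::euclidean_space"
  shows "Cr_on K r f \<longleftrightarrow> (\<forall>k. enat k \<le> r \<longrightarrow> Ck k K f)"
proof safe
  fix k assume f: "Cr_on K r f" and k: "enat k \<le> r"
  have jk: "enat j \<le> r" if "j \<le> k" for j using that k order_trans[of "enat j" "enat k" r] by simp
  have b: "bastiani_C r euclidean euclidean (interior K) f" using f by (simp add: Cr_on_def)
  show "Ck k K f"
  proof (rule Ck_if_extensions)
    show fc: "continuous_on K f" using f by (simp add: Cr_on_def)
    show "\<exists>l. has_dir_deriv euclidean (\<lambda>z. iter_dir_deriv euclidean f j z y) x (y j) l"
      if "j < k" "x \<in> interior K" for j x y
      using that by (intro bastiani_C_dir_deriv_exists[OF b]) (auto intro: jk)
    show "\<exists>h. continuous_on K h \<and> (\<forall>x\<in>interior K. h x = iter_dir_deriv euclidean f j x y)"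
      if "j \<le> k" for j y
    \<comment> \<open>\<open>Cr_on\<close> provides extensions only from order 1 on; at order 0 the
      function itself is the extension.\<close>
    proof (cases "j = 0")
      case True
      then show ?thesis using fc by auto
    next
      case False
      then have "\<exists>g. is_ext_deriv K j f g"
        using f jk[OF that] by (simp add: Cr_on_def)
      then obtain g where g: "is_ext_deriv K j f g" ..
      let ?y = "restrict y {..<j}"
      have y: "?y \<in> topspace (power_topology euclidean j)" by simp
      have "iter_dir_deriv euclidean f j x ?y = iter_dir_deriv euclidean f j x y" for x
        by (rule iter_dir_deriv_directions_cong) simp
      moreover have "g (x, ?y) = iter_dir_deriv euclidean f j x ?y" if "x \<in> interior K" for x
        using g y that unfolding is_ext_deriv_def by blast
      ultimately show ?thesis using is_ext_deriv_slice[OF g y] by auto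
    qed
  qed
next
  assume f: "\<forall>k. enat k \<le> r \<longrightarrow> Ck k K f"
  have "continuous_on K f" using f[rule_format, of 0] by (simp add: zero_enat_def[symmetric])
  moreover have "\<exists>g. is_ext_deriv K k f g" if "enat k \<le> r" for k
    using is_ext_deriv_ext_iter f that by blast
  moreover have "continuous_map (prod_topology (top_of_set (interior K)) (power_topology euclidean k)) euclidean
          (\<lambda>(x, y). iter_dir_deriv euclidean f k x y)" if "enat k \<le> r" for k
  proof (rule continuous_map_eq)
    let ?T = "prod_topology (top_of_set (interior K)) (power_topology (euclidean :: 'a topology) k)"
    show "continuous_map ?T euclidean (\<lambda>p. iter_within K f k (fst p) (snd p))"
    proof (rule continuous_map_iter_within)
      show "continuous_map ?T (top_of_set K) fst"
        using continuous_map_fst[of "top_of_set (interior K)" "power_topology (euclidean :: 'a topology) k"]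
          interior_subset[of K]
        by (auto simp: continuous_map_in_subtopology)
      show "Ck k K f" using f that by blast
      fix i assume "i < k"
      then have "i \<in> {..<k}" by simp
      from continuous_map_compose[OF continuous_map_snd continuous_map_product_projection[OF this]]
      show "continuous_map ?T euclidean (\<lambda>p. snd p i)" by (simp add: o_def)
    qed
    show "iter_within K f k (fst p) (snd p) = (case p of (x, y) \<Rightarrow> iter_dir_deriv euclidean f k x y)"
      if "p \<in> topspace ?T" for p
      using that f \<open>enat k \<le> r\<close> by (auto simp: iter_dir_deriv_eq_iter_within)
  qed
  moreover have "\<exists>l. has_dir_deriv euclidean (\<lambda>z. iter_dir_deriv euclidean f k z y) x (y k) l"
    if "enat (Suc k) \<le> r" "x \<in> interior K" for k x y
    using has_dir_deriv_iter_dir_deriv f that by blast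
  ultimately show "Cr_on K r f"
    by (simp add: Cr_on_def bastiani_C_def)
qed

end

section \<open>The compact-open topology on differentiable functions\<close>

text \<open>The compact set \<open>C\<close> is cut into finitely many compact pieces on which
  \<open>G\<close> is nearly constant; asking \<open>h\<close> to stay near the same constants on
  them is a finite intersection of subbasic conditions.\<close>

lemma compact_open_topology_nbhd:
  fixes G :: "'a \<Rightarrow> 'b::euclidean_space"
  assumes G: "G \<in> extensional (topspace Y)" "continuous_map Y euclidean G"
    and C: "compactin Y C" and e: "e > 0"
  obtains T where "openin (compact_open_topology Y euclidean) T" "G \<in> T"
    "\<And>h p. h \<in> T \<Longrightarrow> p \<in> C \<Longrightarrow> dist (h p) (G p) \<le> e"
proof -
  have "compact (G ` C)" using image_compactin[OF C G(2)] by simp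
  moreover have "G ` C \<subseteq> (\<Union>a\<in>G ` C. ball a (e / 4))" using e by auto
  ultimately obtain A where A: "A \<subseteq> G ` C" "finite A" "G ` C \<subseteq> (\<Union>a\<in>A. ball a (e / 4))"
    using compactE_image[of "G ` C" "G ` C" "\<lambda>a. ball a (e / 4)"] by auto
  \<comment> \<open>\<open>G\<close> stays within \<open>e / 4\<close> of \<open>a\<close> on the
    piece, \<open>h\<close> will be asked to stay within \<open>e / 2\<close>. The gap puts
    \<open>G\<close> itself into the open set, and the two distances add up to less than
    \<open>e\<close>.\<close>
  define B where "B = (\<lambda>a. {p \<in> topspace Y. G p \<in> cball a (e / 4)} \<inter> C)"
  define S where "S = (\<lambda>D (V::'b set). {g \<in> extensional (topspace Y). continuous_map Y euclidean g \<and> g ` D \<subseteq> V})"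
  have open_S: "openin (compact_open_topology Y euclidean) (S D V)" if "compactin Y D" "open V" for D V
    using that unfolding compact_open_topology_def S_def
    by (intro topology_generated_by_Basis) auto
  \<comment> \<open>The member \<open>S {} UNIV\<close> keeps the intersection inside the function
    space when \<open>C\<close>, and with it \<open>A\<close>, is empty.\<close>
  define T where "T = \<Inter> (insert (S {} UNIV) ((\<lambda>a. S (B a) (ball a (e / 2))) ` A))"
  have B: "compactin Y (B a)" for a
    unfolding B_def
    using closedin_continuous_map_preimage[OF G(2), of "cball a (e / 4)"] C
    by (intro closed_Int_compactin) auto
  show thesis
  proof (rule that)
    show "openin (compact_open_topology Y euclidean) T"
      unfolding T_def using A(2) open_S B by (intro openin_Inter) auto
    show "G \<in> T" using G e by (auto simp: T_def S_def B_def)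
    fix h p assume h: "h \<in> T" and p: "p \<in> C"
    obtain a where a: "a \<in> A" "G p \<in> ball a (e / 4)" using A(3) p by auto
    have "p \<in> B a" using a p C compactin_subset_topspace by (fastforce simp: B_def)
    moreover have "h ` B a \<subseteq> ball a (e / 2)" using h a(1) by (simp add: T_def S_def)
    ultimately have "h p \<in> ball a (e / 2)" by blast
    then show "dist (h p) (G p) \<le> e"
      using a(2) e dist_triangle2[of "h p" "G p" a] by (simp add: dist_commute)
  qed
qed

text \<open>For a subbasic set, the compact image of \<open>C\<close> under \<open>G\<close> has a
  uniform margin inside the open target. Intersections take the union of the compact sets and the
  smaller margin.\<close>

lemma compact_open_topology_basis:
  fixes G :: "'a \<Rightarrow> 'b::euclidean_space"
  assumes "openin (compact_open_topology Y euclidean) V" "G \<in> V"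
  obtains C e where "compactin Y C" "e > 0"
    "\<forall>h \<in> extensional (topspace Y). continuous_map Y euclidean h \<longrightarrow>
       (\<forall>p\<in>C. dist (h p) (G p) < e) \<longrightarrow> h \<in> V"
proof -
  have "generate_topology_on {{g \<in> extensional (topspace Y). continuous_map Y euclidean g \<and> g ` C \<subseteq> V} |C V.
        compactin Y C \<and> openin (euclidean :: 'b topology) V} V"
    using openin_topology_generated_by[OF assms(1)[unfolded compact_open_topology_def]] .
  then have "\<exists>C e. compactin Y C \<and> e > 0 \<and>
    (\<forall>h \<in> extensional (topspace Y). continuous_map Y euclidean h \<longrightarrow>
       (\<forall>p\<in>C. dist (h p) (G p) < e) \<longrightarrow> h \<in> V)"
    using assms(2)
  proof (induction rule: generate_topology_on.induct)
    case (Int a b)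
    obtain C e where 1: "compactin Y C" "e > 0" "\<And>h. h \<in> extensional (topspace Y) \<Longrightarrow>
        continuous_map Y euclidean h \<Longrightarrow> (\<forall>p\<in>C. dist (h p) (G p) < e) \<Longrightarrow> h \<in> a"
      using Int by auto
    obtain D d where 2: "compactin Y D" "d > 0" "\<And>h. h \<in> extensional (topspace Y) \<Longrightarrow>
        continuous_map Y euclidean h \<Longrightarrow> (\<forall>p\<in>D. dist (h p) (G p) < d) \<Longrightarrow> h \<in> b"
      using Int by auto
    show ?case
      by (intro exI[of _ "C \<union> D"] exI[of _ "min e d"]) (use 1 2 in \<open>auto intro: compactin_Un\<close>)
  next
    case (UN \<U>)
    then show ?case by (meson UnionE UnionI)
  next
    case (Basis s)
    then obtain C V where s: "s = {g \<in> extensional (topspace Y). continuous_map Y euclidean g \<and> g ` C \<subseteq> V}"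
      and C: "compactin Y C" "open V" by auto
    have "continuous_map Y euclidean G" "G ` C \<subseteq> V" using Basis s by auto
    then have "compact (G ` C)" using image_compactin[OF C(1)] by fastforce
    then obtain e where e: "e > 0" "(\<Union>x\<in>G ` C. ball x e) \<subseteq> V"
      using compact_subset_open_imp_ball_epsilon_subset C(2) \<open>G ` C \<subseteq> V\<close> by metis
    have "h ` C \<subseteq> V" if "\<forall>p\<in>C. dist (h p) (G p) < e" for h
    proof
      fix z assume "z \<in> h ` C"
      then obtain p where "p \<in> C" "z = h p" by auto
      then have "z \<in> ball (G p) e" using that by (simp add: dist_commute)
      then show "z \<in> V" using e(2) \<open>p \<in> C\<close> by blast
    qed
    then show ?case
      by (intro exI[of _ C] exI[of _ e]) (use C e in \<open>auto simp: s\<close>)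
  qed auto
  then show thesis by (elim exE conjE) (rule that)
qed

section \<open>Sup-norm balls and the topology of C^r(K,E)\<close>

context convex_body
begin

abbreviation directions :: "nat \<Rightarrow> real \<Rightarrow> (nat \<Rightarrow> 'a) set" where
  "directions j R \<equiv> PiE {..<j} (\<lambda>_. cball 0 R)"

lemma Cr_space_iff:
  "f \<in> Cr_space K r \<longleftrightarrow> (\<forall>k. enat k \<le> r \<longrightarrow> Ck k K f) \<and> (\<forall>x. x \<notin> K \<longrightarrow> f x = 0)"
  by (simp add: Cr_space_def Cr_on_iff)

lemma Cr_space_Ck: "f \<in> Cr_space K r \<Longrightarrow> enat k \<le> r \<Longrightarrow> Ck k K f"
  by (simp add: Cr_space_iff)

lemma subspace_Cr_space: "subspace (Cr_space K r :: ('a \<Rightarrow> 'b::euclidean_space) set)"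
  by (simp add: subspace_def Cr_space_iff plus_fun_def scaleR_fun_def zero_fun_def Ck_const Ck_add Ck_scaleR)

text \<open>These are the balls of the seminorms that take the supremum over derivatives of order up
  to \<open>k\<close> and directions of norm at most \<open>R\<close>. A uniform
  \<open>d < e\<close> expresses that the supremum is below \<open>e\<close>; the gap
  \<open>e - d\<close> makes the ball open.\<close>

definition Cr_ball :: "enat \<Rightarrow> ('a \<Rightarrow> 'b::euclidean_space) \<Rightarrow> nat \<Rightarrow> real \<Rightarrow> real \<Rightarrow> ('a \<Rightarrow> 'b) set" where
  "Cr_ball r f k R e = {g \<in> Cr_space K r. \<exists>d<e. \<forall>j\<le>k. \<forall>x\<in>K. \<forall>y\<in>directions j R.
     norm (iter_within K g j x y - iter_within K f j x y) \<le> d}"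

lemma Cr_ballI:
  assumes "g \<in> Cr_space K r" "d < e"
    "\<And>j x y. j \<le> k \<Longrightarrow> x \<in> K \<Longrightarrow> y \<in> directions j R \<Longrightarrow>
      norm (iter_within K g j x y - iter_within K f j x y) \<le> d"
  shows "g \<in> Cr_ball r f k R e"
  using assms by (auto simp: Cr_ball_def)

lemma Cr_ballE:
  assumes "g \<in> Cr_ball r f k R e"
  obtains d where "g \<in> Cr_space K r" "d < e"
    "\<And>j x y. j \<le> k \<Longrightarrow> x \<in> K \<Longrightarrow> y \<in> directions j R \<Longrightarrow>
      norm (iter_within K g j x y - iter_within K f j x y) \<le> d"
  using assms by (auto simp: Cr_ball_def)

lemma Cr_ball_subset: "Cr_ball r f k R e \<subseteq> Cr_space K r"
  by (auto simp: Cr_ball_def)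

lemma Cr_ball_centre: "f \<in> Cr_space K r \<Longrightarrow> e > 0 \<Longrightarrow> f \<in> Cr_ball r f k R e"
  by (rule Cr_ballI) auto

lemma Cr_ball_mono:
  assumes "k' \<le> k" "R' \<le> R" "e \<le> e'" shows "Cr_ball r f k R e \<subseteq> Cr_ball r f k' R' e'"
proof
  fix g assume "g \<in> Cr_ball r f k R e"
  then obtain d where d: "g \<in> Cr_space K r" "d < e"
    "\<And>j x y. j \<le> k \<Longrightarrow> x \<in> K \<Longrightarrow> y \<in> directions j R \<Longrightarrow>
      norm (iter_within K g j x y - iter_within K f j x y) \<le> d"
    by (rule Cr_ballE) blast
  have sub: "directions j R' \<subseteq> directions j R" for j
    using assms(2) by (intro PiE_mono) (simp add: subset_iff)
  show "g \<in> Cr_ball r f k' R' e'"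
    using assms sub by (intro Cr_ballI[OF d(1), of d] d(3)) (use d(2) in auto)
qed

lemma Cr_ball_shrink:
  assumes "g \<in> Cr_ball r f k R e"
  obtains e' where "e' > 0" "Cr_ball r g k R e' \<subseteq> Cr_ball r f k R e"
proof -
  obtain d where d: "g \<in> Cr_space K r" "d < e"
    "\<And>j x y. j \<le> k \<Longrightarrow> x \<in> K \<Longrightarrow> y \<in> directions j R \<Longrightarrow>
      norm (iter_within K g j x y - iter_within K f j x y) \<le> d"
    using assms by (rule Cr_ballE) blast
  show thesis
  proof (rule that[of "e - d"])
    show "e - d > 0" using d by simp
    show "Cr_ball r g k R (e - d) \<subseteq> Cr_ball r f k R e"
    proof
      fix h assume "h \<in> Cr_ball r g k R (e - d)"
      then obtain d' where d': "h \<in> Cr_space K r" "d' < e - d"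
        "\<And>j x y. j \<le> k \<Longrightarrow> x \<in> K \<Longrightarrow> y \<in> directions j R \<Longrightarrow>
          norm (iter_within K h j x y - iter_within K g j x y) \<le> d'"
        by (rule Cr_ballE) blast
      show "h \<in> Cr_ball r f k R e"
      proof (rule Cr_ballI[OF d'(1), of "d + d'"])
        fix j x y assume *: "j \<le> k" "x \<in> K" "y \<in> directions j R"
        show "norm (iter_within K h j x y - iter_within K f j x y) \<le> d + d'"
          using norm_triangle_ineq[of "iter_within K h j x y - iter_within K g j x y"
              "iter_within K g j x y - iter_within K f j x y"] d(3)[OF *] d'(3)[OF *] by simp
      qed (use d'(2) in simp)
    qed
  qed
qed

text \<open>The balls are the sets on which \<open>Cr_ball\<close> tests derivatives; the spheres
  serve the openness of \<open>nondegenerate\<close>.\<close>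

lemma compactin_dom_top:
  "compactin (dom_top K j) (K \<times> directions j R)"
  "compactin (dom_top K j) (K \<times> PiE {..<j} (\<lambda>_. sphere 0 R))"
  using compact by (simp_all add: compactin_Times compactin_PiE compactin_subtopology)

text \<open>The sum of the norms of the directions is continuous, hence bounded on \<open>C\<close>.
  Arbitrary compact sets may thus be replaced by the family \<open>directions j R\<close>.\<close>

lemma compactin_dom_top_bound:
  assumes C: "compactin (dom_top K j) C"
  obtains R where "C \<subseteq> K \<times> directions j R"
proof -
  have "continuous_map (dom_top K j) euclideanreal (\<lambda>p. \<Sum>i<j. norm (snd p i))"
  proof (intro continuous_map_sum continuous_map_norm)
    fix i assume "i \<in> {..<j}"
    from continuous_map_compose[OF continuous_map_snd continuous_map_product_projection[OF this]]
    show "continuous_map (dom_top K j) euclidean (\<lambda>p. snd p i)" by (simp add: o_def)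
  qed simp
  from image_compactin[OF C this] have "bounded ((\<lambda>p. \<Sum>i<j. norm (snd p i)) ` C)"
    by (simp add: compact_imp_bounded)
  then obtain R where R: "\<And>p. p \<in> C \<Longrightarrow> \<bar>\<Sum>i<j. norm (snd p i)\<bar> \<le> R"
    by (auto simp: bounded_iff)
  have "norm (y i) \<le> R" if "(x, y) \<in> C" "i < j" for x y i
  proof -
    have "norm (y i) \<le> (\<Sum>i<j. norm (y i))" using that by (intro member_le_sum) auto
    then show ?thesis using R[OF that(1)] by simp
  qed
  note bound = this
  have "C \<subseteq> K \<times> directions j R"
  proof
    fix p assume "p \<in> C"
    moreover obtain x y where "p = (x, y)" by (cases p)
    ultimately have "(x, y) \<in> C" "(x, y) \<in> topspace (dom_top K j)"
      using compactin_subset_topspace[OF C] by auto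
    then show "p \<in> K \<times> directions j R"
      using bound[of x y] \<open>p = (x, y)\<close> by (simp add: PiE_iff)
  qed
  then show thesis by (rule that)
qed

lemma ext_deriv_props:
  assumes "f \<in> Cr_space K r" "enat k \<le> r"
  shows "ext_deriv K k f \<in> extensional (topspace (dom_top K k))"
    "continuous_map (dom_top K k) euclidean (ext_deriv K k f)"
    "x \<in> K \<Longrightarrow> y \<in> extensional {..<k} \<Longrightarrow> ext_deriv K k f (x, y) = iter_within K f k x y"
  using continuous_map_ext_iter[OF Cr_space_Ck[OF assms]]
  by (simp_all add: ext_deriv_eq[OF Cr_space_Ck[OF assms]] PiE_iff)

lemma topspace_Cr_topology [simp]: "topspace (Cr_topology K r) = Cr_space K r"
  by (auto simp: Cr_topology_def initial_topology_def)

lemma openin_Cr_topology_vimage: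
  assumes "enat k \<le> r" "openin (compact_open_topology (dom_top K k) euclidean) V"
  shows "openin (Cr_topology K r) (Cr_space K r \<inter> ext_deriv K k -` V)"
  unfolding Cr_topology_def initial_topology_def
  using assms by (intro topology_generated_by_Basis) auto

lemma Cr_ball_nbhd:
  assumes f: "f \<in> Cr_space K r" and k: "enat k \<le> r" and e: "e > 0"
  obtains T where "openin (Cr_topology K r) T" "f \<in> T" "T \<subseteq> Cr_ball r f k R e"
proof -
  have "\<exists>T. openin (Cr_topology K r) T \<and> f \<in> T \<and> (\<forall>g\<in>T. \<forall>x\<in>K. \<forall>y\<in>directions j R.
     norm (iter_within K g j x y - iter_within K f j x y) \<le> e / 2)" if "j \<le> k" for j
  proof -
    have j: "enat j \<le> r" using that k order_trans[of "enat j" "enat k" r] by simp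
    \<comment> \<open>Half of \<open>e\<close> leaves room for the strict bound in
      \<open>Cr_ball\<close>.\<close>
    have e2: "e / 2 > 0" using e by simp
    obtain T where T: "openin (compact_open_topology (dom_top K j) euclidean) T" "ext_deriv K j f \<in> T"
      "\<And>h p. h \<in> T \<Longrightarrow> p \<in> K \<times> directions j R \<Longrightarrow> dist (h p) (ext_deriv K j f p) \<le> e / 2"
      using compact_open_topology_nbhd[OF ext_deriv_props(1,2)[OF f j] compactin_dom_top(1) e2] by blast
    have "norm (iter_within K g j x y - iter_within K f j x y) \<le> e / 2"
      if "g \<in> Cr_space K r" "ext_deriv K j g \<in> T" "x \<in> K" "y \<in> directions j R" for g x y
      using T(3)[OF that(2), of "(x, y)"] that ext_deriv_props(3)[OF that(1) j, of x y]
        ext_deriv_props(3)[OF f j, of x y]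
      by (auto simp: dist_norm PiE_iff)
    then show ?thesis
      using openin_Cr_topology_vimage[OF j T(1)] T(2) f by blast
  qed
  then obtain T where T: "\<And>j. j \<le> k \<Longrightarrow> openin (Cr_topology K r) (T j)" "\<And>j. j \<le> k \<Longrightarrow> f \<in> T j"
    "\<And>j g x y. j \<le> k \<Longrightarrow> g \<in> T j \<Longrightarrow> x \<in> K \<Longrightarrow> y \<in> directions j R \<Longrightarrow>
     norm (iter_within K g j x y - iter_within K f j x y) \<le> e / 2"
    by metis
  show thesis
  proof (rule that[of "\<Inter>j\<in>{..k}. T j"])
    show "openin (Cr_topology K r) (\<Inter>j\<in>{..k}. T j)" using T(1) by (intro openin_Inter) auto
    show "f \<in> (\<Inter>j\<in>{..k}. T j)" using T(2) by auto
    show "(\<Inter>j\<in>{..k}. T j) \<subseteq> Cr_ball r f k R e"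
    proof
      fix g assume g: "g \<in> (\<Inter>j\<in>{..k}. T j)"
      then have "g \<in> T 0" by auto
      then have "g \<in> Cr_space K r" using openin_subset[OF T(1)[of 0]] by auto
      then show "g \<in> Cr_ball r f k R e"
        by (rule Cr_ballI[of _ _ "e / 2"]) (use g T(3) e in auto)
    qed
  qed
qed

text \<open>A generating open set restricts one derivative on one compact set, which is contained in
  some \<open>K \<times> directions k R\<close>. Finite intersections are absorbed by the larger
  order and radius and the smaller \<open>e\<close>.\<close>

lemma Cr_topology_basis:
  assumes "openin (Cr_topology K r) U" "f \<in> U"
  obtains k R e where "enat k \<le> r" "e > 0" "Cr_ball r f k R e \<subseteq> U"
proof -
  have f: "f \<in> Cr_space K r" using openin_subset[OF assms(1)] assms(2) by auto
  have "\<exists>k R e. enat k \<le> r \<and> e > 0 \<and> Cr_ball r f k R e \<subseteq> U"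
    using openin_topology_generated_by[OF assms(1)[unfolded Cr_topology_def initial_topology_def]] assms(2)
  proof (induction rule: generate_topology_on.induct)
    case (Int a b)
    obtain k R e where 1: "enat k \<le> r" "e > 0" "Cr_ball r f k R e \<subseteq> a" using Int by auto
    obtain k' R' e' where 2: "enat k' \<le> r" "e' > 0" "Cr_ball r f k' R' e' \<subseteq> b" using Int by auto
    have "Cr_ball r f (max k k') (max R R') (min e e') \<subseteq> a \<inter> b"
      using 1(3) 2(3) Cr_ball_mono[of k "max k k'" R "max R R'" "min e e'" e r f]
        Cr_ball_mono[of k' "max k k'" R' "max R R'" "min e e'" e' r f] by auto
    moreover have "enat (max k k') \<le> r" using 1 2 by (simp add: max_def)
    ultimately show ?case using 1 2 by (intro exI[of _ "max k k'"] exI conjI) auto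
  next
    case (UN \<U>)
    then show ?case by (meson Union_upper UnionE subset_trans)
  next
    case (Basis s)
    then consider "s = Cr_space K r" | k V where "s = Cr_space K r \<inter> ext_deriv K k -` V" "enat k \<le> r"
        "openin (compact_open_topology (dom_top K k) euclidean) V" by blast
    then show ?case
    proof cases
      case 1
      then have "Cr_ball r f 0 0 1 \<subseteq> s" using Cr_ball_subset by simp
      moreover have "enat 0 \<le> r" "(0::real) < 1" by (simp_all add: zero_enat_def[symmetric])
      ultimately show ?thesis by blast
    next
      case 2
      then have "ext_deriv K k f \<in> V" using Basis by auto
      then obtain C e where C: "compactin (dom_top K k) C" "e > 0"
        "\<forall>h \<in> extensional (topspace (dom_top K k)). continuous_map (dom_top K k) euclidean h \<longrightarrow>
           (\<forall>p\<in>C. dist (h p) (ext_deriv K k f p) < e) \<longrightarrow> h \<in> V"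
        by (rule compact_open_topology_basis[OF 2(3)])
      obtain R where R: "C \<subseteq> K \<times> directions k R"
        using compactin_dom_top_bound[OF C(1)] .
      have "Cr_ball r f k R e \<subseteq> s"
      proof
        fix g assume "g \<in> Cr_ball r f k R e"
        then obtain d where d: "g \<in> Cr_space K r" "d < e"
          "\<And>j x y. j \<le> k \<Longrightarrow> x \<in> K \<Longrightarrow> y \<in> directions j R \<Longrightarrow>
            norm (iter_within K g j x y - iter_within K f j x y) \<le> d"
          by (rule Cr_ballE) blast
        have "dist (ext_deriv K k g p) (ext_deriv K k f p) < e" if pC: "p \<in> C" for p
        proof -
          obtain x y where p: "p = (x, y)" "x \<in> K" "y \<in> directions k R"
            using R pC by auto
          then have "ext_deriv K k g p = iter_within K g k x y" "ext_deriv K k f p = iter_within K f k x y"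
            using ext_deriv_props(3)[OF d(1) 2(2), of x y] ext_deriv_props(3)[OF f 2(2), of x y]
            by (auto simp: PiE_iff)
          then show ?thesis using d(3)[OF order_refl p(2,3)] d(2) by (simp add: dist_norm)
        qed
        then have "ext_deriv K k g \<in> V" using C(3) ext_deriv_props(1,2)[OF d(1) 2(2)] by blast
        then show "g \<in> s" using 2(1) d(1) by auto
      qed
      then show ?thesis using 2(2) C(2) by blast
    qed
  qed auto
  then show thesis by (elim exE conjE) (rule that)
qed

lemma openin_Cr_ball:
  assumes "enat k \<le> r"
  shows "openin (Cr_topology K r) (Cr_ball r f k R e)"
proof (subst openin_subopen, safe)
  fix g assume g: "g \<in> Cr_ball r f k R e"
  then obtain e' where e': "e' > 0" "Cr_ball r g k R e' \<subseteq> Cr_ball r f k R e" by (rule Cr_ball_shrink)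
  have "g \<in> Cr_space K r" using g Cr_ball_subset by blast
  then obtain T where "openin (Cr_topology K r) T" "g \<in> T" "T \<subseteq> Cr_ball r g k R e'"
    by (rule Cr_ball_nbhd[OF _ assms e'(1)])
  then show "\<exists>T. openin (Cr_topology K r) T \<and> g \<in> T \<and> T \<subseteq> Cr_ball r f k R e"
    using e'(2) by (intro exI[of _ T]) auto
qed

lemma continuous_map_Cr_topologyI:
  fixes h :: "'c \<Rightarrow> 'a \<Rightarrow> 'b::euclidean_space"
  assumes "\<And>p. p \<in> topspace T \<Longrightarrow> h p \<in> Cr_space K r"
    and "\<And>p k R e. p \<in> topspace T \<Longrightarrow> enat k \<le> r \<Longrightarrow> e > 0 \<Longrightarrow>
      \<exists>W. openin T W \<and> p \<in> W \<and> h ` W \<subseteq> Cr_ball r (h p) k R e"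
  shows "continuous_map T (Cr_topology K r) h"
  unfolding continuous_map_def
proof (intro conjI allI impI)
  show "h \<in> topspace T \<rightarrow> topspace (Cr_topology K r)" using assms(1) by auto
  fix U :: "('a \<Rightarrow> 'b) set" assume U: "openin (Cr_topology K r) U"
  show "openin T {x \<in> topspace T. h x \<in> U}"
  proof (subst openin_subopen, safe)
    fix p assume p: "p \<in> topspace T" "h p \<in> U"
    obtain k R e where *: "enat k \<le> r" "e > 0" "Cr_ball r (h p) k R e \<subseteq> U"
      by (rule Cr_topology_basis[OF U p(2)])
    obtain W where W: "openin T W" "p \<in> W" "h ` W \<subseteq> Cr_ball r (h p) k R e"
      using assms(2)[OF p(1) *(1,2), of R] by (elim exE conjE) (rule that)
    have "W \<subseteq> {x \<in> topspace T. h x \<in> U}"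
    proof
      fix x assume x: "x \<in> W"
      then have "h x \<in> Cr_ball r (h p) k R e" by (rule subsetD[OF W(3) imageI])
      then show "x \<in> {x \<in> topspace T. h x \<in> U}"
        using subsetD[OF *(3)] subsetD[OF openin_subset[OF W(1)] x] by simp
    qed
    with W(1,2) show "\<exists>W. openin T W \<and> p \<in> W \<and> W \<subseteq> {x \<in> topspace T. h x \<in> U}"
      by (intro exI[of _ W] conjI)
  qed
qed

section \<open>Continuity of the vector space operations and local convexity\<close>

lemma Cr_ball_add:
  assumes f: "f \<in> Cr_space K r" and g: "g \<in> Cr_space K r" and k: "enat k \<le> r"
    and f': "f' \<in> Cr_ball r f k R (e / 2)" and g': "g' \<in> Cr_ball r g k R (e / 2)"
  shows "f' + g' \<in> Cr_ball r (f + g) k R e"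
proof -
  obtain d where d: "f' \<in> Cr_space K r" "d < e / 2"
    "\<And>j x y. j \<le> k \<Longrightarrow> x \<in> K \<Longrightarrow> y \<in> directions j R \<Longrightarrow>
      norm (iter_within K f' j x y - iter_within K f j x y) \<le> d"
    using f' by (rule Cr_ballE) blast
  obtain c where c: "g' \<in> Cr_space K r" "c < e / 2"
    "\<And>j x y. j \<le> k \<Longrightarrow> x \<in> K \<Longrightarrow> y \<in> directions j R \<Longrightarrow>
      norm (iter_within K g' j x y - iter_within K g j x y) \<le> c"
    using g' by (rule Cr_ballE) blast
  show ?thesis
  proof (rule Cr_ballI[of _ _ "d + c"])
    show "f' + g' \<in> Cr_space K r" using subspace_add[OF subspace_Cr_space d(1) c(1)] .
    show "d + c < e" using d(2) c(2) by simp
    fix j x y assume *: "j \<le> k" "x \<in> K" "y \<in> directions j R"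
    have "enat j \<le> r" using *(1) k order_trans[of "enat j" "enat k" r] by simp
    then have "iter_within K (f + g) j x y = iter_within K f j x y + iter_within K g j x y"
      "iter_within K (f' + g') j x y = iter_within K f' j x y + iter_within K g' j x y"
      using f g d(1) c(1) *(2) by (simp_all add: plus_fun_def iter_within_add Cr_space_Ck)
    then show "norm (iter_within K (f' + g') j x y - iter_within K (f + g) j x y) \<le> d + c"
      using norm_triangle_ineq[of "iter_within K f' j x y - iter_within K f j x y"
          "iter_within K g' j x y - iter_within K g j x y"] d(3)[OF *] c(3)[OF *]
      by (simp add: algebra_simps)
  qed
qed

lemma iter_within_bounded:
  assumes "f \<in> Cr_space K r" "enat k \<le> r"
  obtains B where "B \<ge> 0" "\<And>j x y. j \<le> k \<Longrightarrow> x \<in> K \<Longrightarrow> y \<in> directions j R \<Longrightarrow>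
    norm (iter_within K f j x y) \<le> B"
proof -
  have "\<exists>B. \<forall>x\<in>K. \<forall>y\<in>directions j R. norm (iter_within K f j x y) \<le> B"
    if "j \<le> k" for j
  proof -
    have j: "enat j \<le> r" using that assms(2) order_trans[of "enat j" "enat k" r] by simp
    have "compact (ext_deriv K j f ` (K \<times> directions j R))"
      using image_compactin[OF compactin_dom_top(1) ext_deriv_props(2)[OF assms(1) j]] by simp
    then obtain B where B: "\<And>p. p \<in> K \<times> directions j R \<Longrightarrow> norm (ext_deriv K j f p) \<le> B"
      using compact_imp_bounded by (fastforce simp: bounded_iff)
    have "norm (iter_within K f j x y) \<le> B" if "x \<in> K" "y \<in> directions j R" for x y
      using B[of "(x, y)"] that ext_deriv_props(3)[OF assms(1) j, of x y] by (auto simp: PiE_iff)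
    then show ?thesis by blast
  qed
  then obtain B where B: "\<And>j x y. j \<le> k \<Longrightarrow> x \<in> K \<Longrightarrow> y \<in> directions j R \<Longrightarrow>
    norm (iter_within K f j x y) \<le> B j" by metis
  show thesis
  proof (rule that[of "\<Sum>j\<le>k. \<bar>B j\<bar>"])
    fix j x y assume *: "j \<le> k" "x \<in> K" "y \<in> directions j R"
    have "\<bar>B j\<bar> \<le> (\<Sum>j\<le>k. \<bar>B j\<bar>)" using *(1) by (intro member_le_sum) auto
    then show "norm (iter_within K f j x y) \<le> (\<Sum>j\<le>k. \<bar>B j\<bar>)" using B[OF *] by simp
  qed (simp add: sum_nonneg)
qed

lemma Cr_ball_scaleR:
  assumes f: "f \<in> Cr_space K r" and k: "enat k \<le> r" and e: "e > 0"
  obtains c where "c > 0"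
    "\<And>t g. \<bar>t - s\<bar> < c \<Longrightarrow> g \<in> Cr_ball r f k R c \<Longrightarrow> t *\<^sub>R g \<in> Cr_ball r (s *\<^sub>R f) k R e"
proof -
  obtain B where B: "B \<ge> 0" "\<And>j x y. j \<le> k \<Longrightarrow> x \<in> K \<Longrightarrow> y \<in> directions j R \<Longrightarrow>
    norm (iter_within K f j x y) \<le> B"
    by (rule iter_within_bounded[OF f k]) blast
  \<comment> \<open>In \<open>t g - s f = t (g - f) + (t - s) f\<close> the first term is at most
    \<open>(\<bar>s\<bar> + 1) * c\<close>, as \<open>c \<le> 1\<close>, and the second at most
    \<open>c * B\<close>.\<close>
  define M where "M = \<bar>s\<bar> + 1 + B"
  have M: "M > 0" using B(1) by (simp add: M_def)
  define c where "c = min 1 (e / (2 * M))"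
  have c: "c > 0" "c \<le> 1" "M * c \<le> e / 2"
    using e M by (auto simp: c_def min_def field_simps)
  show thesis
  proof (rule that[OF c(1)])
    fix t g assume t: "\<bar>t - s\<bar> < c" and g: "g \<in> Cr_ball r f k R c"
    obtain d where d: "g \<in> Cr_space K r" "d < c"
      "\<And>j x y. j \<le> k \<Longrightarrow> x \<in> K \<Longrightarrow> y \<in> directions j R \<Longrightarrow>
        norm (iter_within K g j x y - iter_within K f j x y) \<le> d"
      using g by (rule Cr_ballE) blast
    show "t *\<^sub>R g \<in> Cr_ball r (s *\<^sub>R f) k R e"
    proof (rule Cr_ballI[of _ _ "e / 2"])
      show "t *\<^sub>R g \<in> Cr_space K r" using subspace_scale[OF subspace_Cr_space d(1)] .
      fix j x y assume *: "j \<le> k" "x \<in> K" "y \<in> directions j R"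
      have "enat j \<le> r" using *(1) k order_trans[of "enat j" "enat k" r] by simp
      then have "iter_within K (s *\<^sub>R f) j x y = s *\<^sub>R iter_within K f j x y"
        "iter_within K (t *\<^sub>R g) j x y = t *\<^sub>R iter_within K g j x y"
        using f d(1) *(2) by (simp_all add: scaleR_fun_def iter_within_scaleR Cr_space_Ck)
      then have "iter_within K (t *\<^sub>R g) j x y - iter_within K (s *\<^sub>R f) j x y =
          t *\<^sub>R (iter_within K g j x y - iter_within K f j x y) + (t - s) *\<^sub>R iter_within K f j x y"
        by (simp add: algebra_simps)
      then have "norm (iter_within K (t *\<^sub>R g) j x y - iter_within K (s *\<^sub>R f) j x y) \<le>
          \<bar>t\<bar> * norm (iter_within K g j x y - iter_within K f j x y) + \<bar>t - s\<bar> * norm (iter_within K f j x y)"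
        using norm_triangle_ineq by (metis norm_scaleR)
      also have "\<dots> \<le> (\<bar>s\<bar> + 1) * c + c * B"
        using t c d(3)[OF *] d(2) B(2)[OF *] by (intro add_mono mult_mono) auto
      also have "\<dots> = M * c" by (simp add: M_def algebra_simps)
      also have "\<dots> \<le> e / 2" by (rule c(3))
      finally show "norm (iter_within K (t *\<^sub>R g) j x y - iter_within K (s *\<^sub>R f) j x y) \<le> e / 2" .
    qed (use e in simp)
  qed
qed

text \<open>Evaluation at a point where the functions differ already separates them. Order 0
  involves no directions, so the balls with \<open>k = 0\<close> and \<open>R = 0\<close> compare
  values only.\<close>

lemma Hausdorff_Cr_topology: "Hausdorff_space (Cr_topology K r :: ('a \<Rightarrow> 'b::euclidean_space) topology)"
  unfolding Hausdorff_space_def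
proof (intro allI impI, elim conjE)
  fix f g :: "'a \<Rightarrow> 'b" assume *: "f \<in> topspace (Cr_topology K r)" "g \<in> topspace (Cr_topology K r)" "f \<noteq> g"
  then have fg: "f \<in> Cr_space K r" "g \<in> Cr_space K r" by auto
  then obtain x where x: "x \<in> K" "f x \<noteq> g x" using *(3) by (auto simp: fun_eq_iff Cr_space_iff) metis
  let ?e = "norm (f x - g x) / 2"
  have e: "?e > 0" using x by simp
  have 0: "enat 0 \<le> r" by (simp add: zero_enat_def[symmetric])
  have near: "norm (h x - u x) < ?e" if "h \<in> Cr_ball r u 0 0 ?e" for h u :: "'a \<Rightarrow> 'b"
    using that x(1) by (auto simp: Cr_ball_def)
  have "disjnt (Cr_ball r f 0 0 ?e) (Cr_ball r g 0 0 ?e)"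
    unfolding disjnt_iff
  proof (intro allI notI, elim conjE)
    fix h assume "h \<in> Cr_ball r f 0 0 ?e" "h \<in> Cr_ball r g 0 0 ?e"
    then have "norm (h x - f x) < ?e" "norm (h x - g x) < ?e" using near by auto
    then show False
      using norm_triangle_ineq4[of "h x - g x" "h x - f x"] by simp
  qed
  then show "\<exists>U V. openin (Cr_topology K r) U \<and> openin (Cr_topology K r) V \<and> f \<in> U \<and> g \<in> V \<and> disjnt U V"
    by (intro exI[of _ "Cr_ball r f 0 0 ?e"] exI[of _ "Cr_ball r g 0 0 ?e"] conjI)
      (intro openin_Cr_ball[OF 0] Cr_ball_centre fg e | assumption)+
qed

lemma convex_Cr_ball_0:
  assumes "enat k \<le> r" shows "convex (Cr_ball r (0 :: 'a \<Rightarrow> 'b::euclidean_space) k R e)"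
proof (rule convexI)
  fix f g :: "'a \<Rightarrow> 'b" and u v assume *: "f \<in> Cr_ball r 0 k R e" "g \<in> Cr_ball r 0 k R e" and uv: "0 \<le> u" "0 \<le> v" "u + v = (1::real)"
  have zero: "iter_within K 0 j x y = 0" if "x \<in> K" for j x y
    using iter_within_zero[OF that] by (simp add: zero_fun_def)
  obtain d where d: "f \<in> Cr_space K r" "d < e"
    "\<And>j x y. j \<le> k \<Longrightarrow> x \<in> K \<Longrightarrow> y \<in> directions j R \<Longrightarrow> norm (iter_within K f j x y) \<le> d"
    using *(1) by (rule Cr_ballE) (simp add: zero)
  obtain c where c: "g \<in> Cr_space K r" "c < e"
    "\<And>j x y. j \<le> k \<Longrightarrow> x \<in> K \<Longrightarrow> y \<in> directions j R \<Longrightarrow> norm (iter_within K g j x y) \<le> c"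
    using *(2) by (rule Cr_ballE) (simp add: zero)
  show "u *\<^sub>R f + v *\<^sub>R g \<in> Cr_ball r 0 k R e"
  proof (rule Cr_ballI[of _ _ "max d c"])
    show "u *\<^sub>R f + v *\<^sub>R g \<in> Cr_space K r"
      by (intro subspace_add subspace_scale subspace_Cr_space d c)
    show "max d c < e" using d c by simp
    fix j x y assume h: "j \<le> k" "x \<in> K" "y \<in> directions j R"
    have j: "enat j \<le> r" using h(1) assms order_trans[of "enat j" "enat k" r] by simp
    have "iter_within K (u *\<^sub>R f + v *\<^sub>R g) j x y = u *\<^sub>R iter_within K f j x y + v *\<^sub>R iter_within K g j x y"
      using Cr_space_Ck[OF d(1) j] Cr_space_Ck[OF c(1) j] h(2)
      by (simp add: plus_fun_def scaleR_fun_def iter_within_add iter_within_scaleR Ck_scaleR Ck_const)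
    then have "norm (iter_within K (u *\<^sub>R f + v *\<^sub>R g) j x y) \<le>
        u * norm (iter_within K f j x y) + v * norm (iter_within K g j x y)"
      using norm_triangle_ineq[of "u *\<^sub>R iter_within K f j x y" "v *\<^sub>R iter_within K g j x y"] uv by simp
    also have "\<dots> \<le> u * max d c + v * max d c"
      using d(3)[OF h] c(3)[OF h] uv by (intro add_mono mult_left_mono) auto
    also have "\<dots> = max d c" using uv by (simp add: distrib_right[symmetric])
    finally show "norm (iter_within K (u *\<^sub>R f + v *\<^sub>R g) j x y - iter_within K 0 j x y) \<le> max d c"
      by (simp add: zero[OF h(2)])
  qed
qed

lemma locally_convex_space_Cr:
  "locally_convex_space (Cr_topology K r :: ('a \<Rightarrow> 'b::euclidean_space) topology)"
proof -
  let ?X = "Cr_topology K r :: ('a \<Rightarrow> 'b) topology"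
  have "continuous_map (prod_topology ?X ?X) ?X (\<lambda>(f, g). f + g)"
  proof (rule continuous_map_Cr_topologyI)
    show "(case p of (f, g) \<Rightarrow> f + g) \<in> Cr_space K r" if "p \<in> topspace (prod_topology ?X ?X)" for p
      using that by (auto intro!: subspace_add[OF subspace_Cr_space])
    fix p k R and e :: real assume p: "p \<in> topspace (prod_topology ?X ?X)" and k: "enat k \<le> r" and e: "e > 0"
    obtain f g where fg: "p = (f, g)" "f \<in> Cr_space K r" "g \<in> Cr_space K r" using p by auto
    show "\<exists>W. openin (prod_topology ?X ?X) W \<and> p \<in> W \<and>
        (\<lambda>(f, g). f + g) ` W \<subseteq> Cr_ball r (case p of (f, g) \<Rightarrow> f + g) k R e"
      using fg e
      by (intro exI[of _ "Cr_ball r f k R (e / 2) \<times> Cr_ball r g k R (e / 2)"])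
        (auto simp: openin_prod_Times_iff openin_Cr_ball[OF k] Cr_ball_centre intro!: Cr_ball_add k)
  qed
  moreover have "continuous_map (prod_topology euclideanreal ?X) ?X (\<lambda>(t, f). t *\<^sub>R f)"
  proof (rule continuous_map_Cr_topologyI)
    show "(case p of (t, f) \<Rightarrow> t *\<^sub>R f) \<in> Cr_space K r" if "p \<in> topspace (prod_topology euclideanreal ?X)" for p
      using that by (auto intro!: subspace_scale[OF subspace_Cr_space])
    fix p k R and e :: real
    assume p: "p \<in> topspace (prod_topology euclideanreal ?X)" and k: "enat k \<le> r" and e: "e > 0"
    obtain s f where sf: "p = (s, f)" "f \<in> Cr_space K r" using p by auto
    obtain c where c: "c > 0"
      "\<And>t g. \<bar>t - s\<bar> < c \<Longrightarrow> g \<in> Cr_ball r f k R c \<Longrightarrow> t *\<^sub>R g \<in> Cr_ball r (s *\<^sub>R f) k R e"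
      by (rule Cr_ball_scaleR[OF sf(2) k e]) blast
    show "\<exists>W. openin (prod_topology euclideanreal ?X) W \<and> p \<in> W \<and>
        (\<lambda>(t, f). t *\<^sub>R f) ` W \<subseteq> Cr_ball r (case p of (t, f) \<Rightarrow> t *\<^sub>R f) k R e"
      using sf c
      by (intro exI[of _ "ball s c \<times> Cr_ball r f k R c"])
        (auto simp: openin_prod_Times_iff openin_Cr_ball[OF k] Cr_ball_centre dist_real_def abs_minus_commute)
  qed
  moreover have "\<exists>V. openin ?X V \<and> convex V \<and> 0 \<in> V \<and> V \<subseteq> U" if U: "openin ?X U" "0 \<in> U" for U
  proof -
    obtain k R e where "enat k \<le> r" "e > 0" "Cr_ball r 0 k R e \<subseteq> U"
      by (rule Cr_topology_basis[OF U])
    then show ?thesis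
      by (intro exI[of _ "Cr_ball r 0 k R e"] conjI)
        (intro openin_Cr_ball convex_Cr_ball_0 Cr_ball_centre subspace_0[OF subspace_Cr_space] | assumption)+
  qed
  ultimately show ?thesis
    unfolding locally_convex_space_def topspace_Cr_topology
    using Hausdorff_Cr_topology subspace_Cr_space by blast
qed

section \<open>The closed model space and the open set of nondegenerate maps\<close>

lemma closedin_Cr_frontier: "closedin (Cr_topology K r) (Cr_frontier K r)"
  unfolding closedin_def
proof (intro conjI)
  show "Cr_frontier K r \<subseteq> topspace (Cr_topology K r)" by (auto simp: Cr_frontier_def)
  show "openin (Cr_topology K r) (topspace (Cr_topology K r) - Cr_frontier K r)"
  proof (subst openin_subopen, intro ballI)
    fix f assume f: "f \<in> topspace (Cr_topology K r) - Cr_frontier K r"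
    then obtain x where x: "x \<in> frontier K" "f x \<noteq> 0" by (auto simp: Cr_frontier_def)
    have xK: "x \<in> K" using x(1) frontier_subset_closed[OF compact_imp_closed[OF compact]] by auto
    have "g \<notin> Cr_frontier K r" if "g \<in> Cr_ball r f 0 0 (norm (f x))" for g
    proof -
      have "norm (g x - f x) < norm (f x)" using that xK by (auto simp: Cr_ball_def)
      then have "g x \<noteq> 0" by auto
      then show ?thesis using x(1) by (auto simp: Cr_frontier_def)
    qed
    moreover have "openin (Cr_topology K r) (Cr_ball r f 0 0 (norm (f x)))"
      by (rule openin_Cr_ball) (simp add: zero_enat_def[symmetric])
    moreover have "f \<in> Cr_ball r f 0 0 (norm (f x))"
      using f x by (intro Cr_ball_centre) auto
    ultimately show "\<exists>T. openin (Cr_topology K r) T \<and> f \<in> T \<and> T \<subseteq> topspace (Cr_topology K r) - Cr_frontier K r"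
      using Cr_ball_subset[of r f 0 0 "norm (f x)"]
      by (intro exI[of _ "Cr_ball r f 0 0 (norm (f x))"]) auto
  qed
qed

lemma subspace_Cr_frontier: "subspace (Cr_frontier K r :: ('a \<Rightarrow> 'b::euclidean_space) set)"
  using subspace_Cr_space[of r, where 'b = 'b]
  by (auto simp: subspace_def Cr_frontier_def plus_fun_def scaleR_fun_def zero_fun_def)

definition nondegenerate :: "enat \<Rightarrow> ('a \<Rightarrow> 'b::euclidean_space) set" where
  "nondegenerate r = {f \<in> Cr_space K r. \<forall>x\<in>K. \<forall>v. v \<noteq> 0 \<longrightarrow> frechet_derivative f (at x within K) v \<noteq> 0}"

text \<open>By linearity of the derivative it suffices to test unit vectors, and the resulting condition
  is a subbasic open one.\<close>

lemma openin_nondegenerate: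
  assumes r: "1 \<le> r"
  shows "openin (Cr_topology K r) (nondegenerate r :: ('a \<Rightarrow> 'b::euclidean_space) set)"
proof -
  have 1: "enat 1 \<le> r" using r by (simp add: one_enat_def)
  \<comment> \<open>At order 1 a tuple of directions has the single entry \<open>0\<close>, here a
    unit vector.\<close>
  let ?C = "K \<times> PiE {..<1} (\<lambda>_. sphere (0::'a) 1)"
  let ?V = "{g \<in> extensional (topspace (dom_top K 1)). continuous_map (dom_top K 1) euclidean g \<and>
     g ` ?C \<subseteq> - {0::'b}}"
  have "openin (compact_open_topology (dom_top K 1) euclidean) ?V"
    unfolding compact_open_topology_def
    using compactin_dom_top(2)[of 1 1]
    by (intro topology_generated_by_Basis CollectI exI[of _ ?C] exI[of _ "- {0::'b}"] conjI refl) auto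
  from openin_Cr_topology_vimage[OF 1 this]
  have "openin (Cr_topology K r) (Cr_space K r \<inter> ext_deriv K 1 -` ?V)" .
  moreover have "f \<in> nondegenerate r \<longleftrightarrow> ext_deriv K 1 f ` ?C \<subseteq> - {0}"
    if f: "f \<in> Cr_space K r" for f :: "'a \<Rightarrow> 'b"
  proof -
    have val: "ext_deriv K 1 f (x, y) = frechet_derivative f (at x within K) (y 0)"
      if "x \<in> K" "y \<in> extensional {..<1}" for x y
      using ext_deriv_props(3)[OF f 1 that] by simp
    have lin: "linear (frechet_derivative f (at x within K))" if "x \<in> K" for x
      using Ck_has_frechet_derivative[of 0 K f x] Cr_space_Ck[OF f 1] that has_derivative_linear by auto
    have "ext_deriv K 1 f ` ?C \<subseteq> - {0} \<longleftrightarrow>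
        (\<forall>x\<in>K. \<forall>v. norm v = 1 \<longrightarrow> frechet_derivative f (at x within K) v \<noteq> 0)"
    proof safe
      fix x v assume *: "ext_deriv K 1 f ` ?C \<subseteq> - {0}" "x \<in> K" "norm v = 1"
        "frechet_derivative f (at x within K) v = 0"
      let ?y = "\<lambda>i\<in>{..<1::nat}. v"
      have "(x, ?y) \<in> ?C" using * by auto
      then have "ext_deriv K 1 f (x, ?y) \<noteq> 0" using *(1) by blast
      then show False using val[OF *(2), of ?y] *(4) by simp
    next
      fix x y assume *: "\<forall>x\<in>K. \<forall>v. norm v = 1 \<longrightarrow> frechet_derivative f (at x within K) v \<noteq> 0"
        "x \<in> K" "y \<in> PiE {..<1} (\<lambda>_. sphere (0::'a) 1)" "ext_deriv K 1 f (x, y) = 0"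
      then have "norm (y 0) = 1" "y \<in> extensional {..<1}" by (auto simp: PiE_iff)
      then show False using * val[OF *(2), of y] by auto
    qed
    also have "\<dots> \<longleftrightarrow> (\<forall>x\<in>K. \<forall>v. v \<noteq> 0 \<longrightarrow> frechet_derivative f (at x within K) v \<noteq> 0)"
    proof (intro ball_cong refl iffI allI impI)
      fix x v :: 'a assume *: "x \<in> K" "\<forall>v. norm v = 1 \<longrightarrow> frechet_derivative f (at x within K) v \<noteq> 0" "v \<noteq> 0"
      then have "frechet_derivative f (at x within K) (v /\<^sub>R norm v) \<noteq> 0" by simp
      then show "frechet_derivative f (at x within K) v \<noteq> 0"
        using linear_cmul[OF lin[OF *(1)], of "inverse (norm v)" v] by auto
    next
      fix x v :: 'a assume *: "\<forall>v. v \<noteq> 0 \<longrightarrow> frechet_derivative f (at x within K) v \<noteq> 0" "norm v = 1"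
      then have "v \<noteq> 0" by auto
      then show "frechet_derivative f (at x within K) v \<noteq> 0" using *(1) by blast
    qed
    finally show ?thesis using f by (simp add: nondegenerate_def)
  qed
  then have "nondegenerate r = Cr_space K r \<inter> ext_deriv K 1 -` ?V"
    using ext_deriv_props(1,2)[OF _ 1] by (auto simp: nondegenerate_def)
  ultimately show ?thesis by simp
qed

end

section \<open>Submanifolds cut out by a translated subspace\<close>

lemma bastiani_smooth_add_const:
  assumes X: "locally_convex_space X" and U: "openin X U" and c: "c \<in> topspace X"
  shows "bastiani_smooth X X U (\<lambda>x. x + c)"
  using bastiani_C_add_const[OF X c bastiani_smooth_id[OF X U]] by (simp only: id_apply)

lemma smooth_manifold_lcs_atlas:
  assumes X: "locally_convex_space X"
  shows "smooth_manifold X X (lcs_atlas X)"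
proof -
  have 0: "0 \<in> topspace X" using lcs_subspace[OF X] by (rule subspace_0)
  have "bastiani_smooth X X (topspace X) (id \<circ> inv_into (topspace X) id)"
    by (rule bastiani_C_cong[OF X _ bastiani_smooth_add_const[OF X openin_topspace 0]])
      (simp add: inv_into_f_eq)
  moreover have "homeomorphic_map X X id"
    using lcs_translate_homeomorphic_map[OF X 0] by (simp add: id_def)
  ultimately show ?thesis
    using lcs_Hausdorff[OF X] X
    by (simp add: smooth_manifold_def lcs_atlas_def is_chart_def smooth_compatible_def smooth_transition_def)
qed

text \<open>Translation by \<open>- c\<close> flattens \<open>N\<close> onto an open part of
  \<open>Y\<close>, and its domain \<open>W\<close> contains all of \<open>N\<close>. One ambient
  chart therefore serves every point and induces a chart of \<open>N\<close> defined
  everywhere.\<close>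

lemma translated_subspace_submanifold:
  assumes X: "locally_convex_space X" and Y: "subspace Y" "closedin X Y"
    and W: "openin X W" and c: "c \<in> topspace X" and N: "N = W \<inter> {x. x - c \<in> Y}"
  shows "smooth_submanifold X X (lcs_atlas X) Y N \<and> submanifold_has_global_chart X X (lcs_atlas X) Y N"
proof -
  define \<kappa> where "\<kappa> = (\<lambda>x. x + (- c))"
  have c': "- c \<in> topspace X" using lcs_subspace[OF X] c subspace_neg by blast
  have YX: "Y \<subseteq> topspace X" using Y(2) by (rule closedin_subset)
  have WX: "W \<subseteq> topspace X" using W by (rule openin_subset)
  have NW: "N \<subseteq> W" using N by blast
  have hom: "homeomorphic_map X X \<kappa>"
    unfolding \<kappa>_def by (rule lcs_translate_homeomorphic_map[OF X c'])
  have image_in: "\<kappa> ` S \<subseteq> topspace X" if "S \<subseteq> topspace X" for S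
    using homeomorphic_imp_surjective_map[OF hom] that by blast
  have inj: "inj_on \<kappa> S" for S by (simp add: \<kappa>_def inj_on_def)
  have inv: "inv_into S \<kappa> z = z + c" if "z \<in> \<kappa> ` S" for S z
    using that inv_into_f_f[OF inj] by (auto simp: \<kappa>_def)
  have openW: "openin X (\<kappa> ` W)"
    using homeomorphic_map_openness_eq[OF hom, of W] W by blast
  have \<kappa>N: "\<kappa> ` N = \<kappa> ` W \<inter> Y"
    by (auto simp: N \<kappa>_def image_iff)
  have chart: "is_chart X X (W, \<kappa>)"
    unfolding is_chart_def prod.case
  proof (intro conjI W openW homeomorphic_map_subtopologies[OF hom])
    show "\<kappa> ` (topspace X \<inter> W) = topspace X \<inter> \<kappa> ` W"
      using WX image_in[OF WX] by (simp add: Int_absorb1)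
  qed
  have "smooth_transition X (W, \<kappa>) (topspace X, id)"
    unfolding smooth_transition_def prod.case
  proof (rule bastiani_C_cong[OF X _ bastiani_smooth_add_const[OF X _ c]])
    show "openin X (\<kappa> ` (W \<inter> topspace X))" using openW WX by (simp add: Int_absorb2)
    show "z + c = (id \<circ> inv_into W \<kappa>) z" if "z \<in> \<kappa> ` (W \<inter> topspace X)" for z
      using inv[of z W] that by auto
  qed
  moreover have "smooth_transition X (topspace X, id) (W, \<kappa>)"
    unfolding smooth_transition_def prod.case
  proof (rule bastiani_C_cong[OF X _ bastiani_smooth_add_const[OF X _ c']])
    show "openin X (id ` (topspace X \<inter> W))" using W WX by (simp add: Int_absorb1)
    show "z + - c = (\<kappa> \<circ> inv_into (topspace X) id) z" if "z \<in> id ` (topspace X \<inter> W)" for z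
      using that by (auto simp: \<kappa>_def inv_into_f_eq)
  qed
  ultimately have atlas: "(W, \<kappa>) \<in> maximal_atlas X X (lcs_atlas X)"
    using chart by (simp add: maximal_atlas_def lcs_atlas_def smooth_compatible_def)
  have adapted: "adapted_chart Y N (W, \<kappa>)"
    using \<kappa>N NW by (simp add: adapted_chart_def Int_absorb1)
  have sub: "smooth_submanifold X X (lcs_atlas X) Y N"
    unfolding smooth_submanifold_def
  proof (intro conjI ballI)
    show "N \<subseteq> topspace X" using NW WX by blast
    show "\<exists>a\<in>maximal_atlas X X (lcs_atlas X). p \<in> fst a \<and> adapted_chart Y N a" if "p \<in> N" for p
      using atlas adapted that NW by (intro bexI[of _ "(W, \<kappa>)"]) auto
  qed (use Y smooth_manifold_lcs_atlas[OF X] in auto)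
  let ?Y = "subtopology X Y"
  note lcsY = locally_convex_space_subtopology[OF X Y(1) YX]
  have "is_chart ?Y (subtopology X N) (N, \<kappa>)"
    unfolding is_chart_def prod.case
  proof (intro conjI)
    show "openin (subtopology X N) N"
      using NW WX openin_topspace[of "subtopology X N"] by (simp add: Int_absorb1 subset_trans)
    show "openin ?Y (\<kappa> ` N)" unfolding \<kappa>N using openW by (auto simp: openin_subtopology)
    have "homeomorphic_map (subtopology X N) (subtopology X (\<kappa> ` N)) \<kappa>"
    proof (rule homeomorphic_map_subtopologies[OF hom])
      have "N \<subseteq> topspace X" using NW WX by blast
      then show "\<kappa> ` (topspace X \<inter> N) = topspace X \<inter> \<kappa> ` N"
        using image_in by (simp add: Int_absorb1)
    qed
    moreover have "Y \<inter> \<kappa> ` N = \<kappa> ` N" unfolding \<kappa>N by blast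
    ultimately show "homeomorphic_map (subtopology (subtopology X N) N) (subtopology ?Y (\<kappa> ` N)) \<kappa>"
      by (simp add: subtopology_subtopology)
  qed
  \<comment> \<open>The atlas of the submanifold contains the traces of all adapted ambient charts,
    so compatibility is checked against an arbitrary one.\<close>
  moreover have "smooth_compatible ?Y (N, \<kappa>) a" if a: "a \<in> submanifold_atlas X X (lcs_atlas X) Y N" for a
  proof -
    obtain W' \<theta> where a: "a = (W' \<inter> N, \<theta>)" "(W', \<theta>) \<in> maximal_atlas X X (lcs_atlas X)"
      and "adapted_chart Y N (W', \<theta>)"
      using a unfolding submanifold_atlas_def by blast
    then have ad: "\<theta> ` (W' \<inter> N) = \<theta> ` W' \<inter> Y" by (simp add: adapted_chart_def)
    have W': "openin X W'" and hom': "homeomorphic_map (subtopology X W') (subtopology X (\<theta> ` W')) \<theta>"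
      and s1: "bastiani_smooth X X (\<theta> ` (W' \<inter> topspace X)) (id \<circ> inv_into W' \<theta>)"
      and s2: "bastiani_smooth X X (id ` (topspace X \<inter> W')) (\<theta> \<circ> inv_into (topspace X) id)"
      using a(2) by (simp_all add: maximal_atlas_def lcs_atlas_def smooth_compatible_def
          smooth_transition_def is_chart_def)
    have W'X: "W' \<subseteq> topspace X" using W' by (rule openin_subset)
    have inj': "inj_on \<theta> W'"
      using homeomorphic_imp_injective_map[OF hom'] W'X by (simp add: Int_absorb1)
    \<comment> \<open>Compatibility with the identity chart says that \<open>\<theta>\<close> and
      its inverse are themselves smooth.\<close>
    have s1': "bastiani_smooth X X (\<theta> ` W') (inv_into W' \<theta>)"
      using s1 W'X by (simp add: Int_absorb2)
    have "bastiani_smooth X X W' (\<theta> \<circ> inv_into (topspace X) id)"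
      using s2 W'X by (simp add: Int_absorb1)
    then have s2': "bastiani_smooth X X W' \<theta>"
      by (rule bastiani_C_cong[OF X, rotated]) (use W'X in \<open>auto simp: inv_into_f_eq\<close>)
    have "smooth_transition ?Y (N, \<kappa>) (W' \<inter> N, \<theta>)"
      unfolding smooth_transition_def prod.case
    proof (rule bastiani_C_cong[OF lcsY])
      \<comment> \<open>The ambient chart change lives on a translate of the open set
        \<open>W' \<inter> W\<close>; its trace on \<open>Y\<close> is the domain of the chart
        change of \<open>N\<close>.\<close>
      have eq: "(\<lambda>x. x - c) ` (W' \<inter> W) \<inter> Y = \<kappa> ` (N \<inter> (W' \<inter> N))"
        by (auto simp: N \<kappa>_def image_iff)
      have "bastiani_smooth X X ((\<lambda>x. x - c) ` (W' \<inter> W)) (\<lambda>z. \<theta> (z + c))"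
        by (intro bastiani_C_translate[OF X c] bastiani_C_subset[OF s2'] openin_Int W' W) blast
      moreover have "(\<lambda>z. \<theta> (z + c)) ` ((\<lambda>x. x - c) ` (W' \<inter> W) \<inter> Y) \<subseteq> Y"
      proof clarsimp
        fix x assume "x \<in> W'" "x \<in> W" "x - c \<in> Y"
        then have "\<theta> x \<in> \<theta> ` (W' \<inter> N)" by (auto simp: N)
        then show "\<theta> x \<in> Y" unfolding ad by blast
      qed
      ultimately have "bastiani_smooth ?Y ?Y ((\<lambda>x. x - c) ` (W' \<inter> W) \<inter> Y) (\<lambda>z. \<theta> (z + c))"
        by (rule bastiani_C_restrict[OF X X Y(1) YX Y])
      then show "bastiani_smooth ?Y ?Y (\<kappa> ` (N \<inter> (W' \<inter> N))) (\<lambda>z. \<theta> (z + c))"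
        unfolding eq .
      show "\<theta> (z + c) = (\<theta> \<circ> inv_into N \<kappa>) z" if "z \<in> \<kappa> ` (N \<inter> (W' \<inter> N))" for z
        using inv[of z N] that by auto
    qed
    moreover have "smooth_transition ?Y (W' \<inter> N, \<theta>) (N, \<kappa>)"
      unfolding smooth_transition_def prod.case
    proof (rule bastiani_C_cong[OF lcsY])
      have "bastiani_smooth X X (\<theta> ` W') (\<lambda>z. inv_into W' \<theta> z + - c)"
        by (rule bastiani_C_add_const[OF X c' s1'])
      \<comment> \<open>Adaptedness makes points of \<open>Y\<close> in the image of
        \<open>\<theta>\<close> come from \<open>N\<close>, and points of \<open>N\<close> differ
        from \<open>c\<close> by elements of \<open>Y\<close>.\<close>
      moreover have "(\<lambda>z. inv_into W' \<theta> z + - c) ` (\<theta> ` W' \<inter> Y) \<subseteq> Y"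
        unfolding ad[symmetric] using inv_into_f_f[OF inj'] by (auto simp: N)
      ultimately have "bastiani_smooth ?Y ?Y (\<theta> ` W' \<inter> Y) (\<lambda>z. inv_into W' \<theta> z + - c)"
        by (rule bastiani_C_restrict[OF X X Y(1) YX Y])
      then show "bastiani_smooth ?Y ?Y (\<theta> ` (W' \<inter> N \<inter> N)) (\<lambda>z. inv_into W' \<theta> z + - c)"
        by (simp only: ad Int_assoc Int_absorb)
      show "inv_into W' \<theta> z + - c = (\<kappa> \<circ> inv_into (W' \<inter> N) \<theta>) z" if z: "z \<in> \<theta> ` (W' \<inter> N \<inter> N)" for z
      proof -
        obtain x where x: "x \<in> W' \<inter> N" "z = \<theta> x" using z by blast
        moreover have "inv_into (W' \<inter> N) \<theta> (\<theta> x) = x"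
          using inv_into_f_f[OF inj_on_subset[OF inj'] x(1)] by blast
        moreover have "inv_into W' \<theta> (\<theta> x) = x" using inv_into_f_f[OF inj'] x(1) by blast
        ultimately show ?thesis by (simp add: \<kappa>_def)
      qed
    qed
    ultimately show ?thesis by (simp add: a(1) smooth_compatible_def)
  qed
  ultimately have "(N, \<kappa>) \<in> maximal_atlas ?Y (subtopology X N) (submanifold_atlas X X (lcs_atlas X) Y N)"
    by (simp add: maximal_atlas_def)
  with sub show ?thesis by (auto simp: submanifold_has_global_chart_def)
qed

section \<open>Inverses\<close>

text \<open>By invariance of domain \<open>\<phi>\<close> is open on the interior. Openness forbids
  image points outside \<open>K\<close>, makes the image of the interior clopen in it, and makes the
  set of values taken twice open; the fixed boundary enters in each of these arguments.\<close>

lemma (in convex_body) bij_betw_if_locally_injective: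
  fixes \<phi> :: "'a \<Rightarrow> 'a"
  assumes cont: "continuous_on K \<phi>"
    and loc: "\<And>x. x \<in> K \<Longrightarrow> \<exists>d>0. inj_on \<phi> (K \<inter> ball x d)"
    and bd: "\<And>x. x \<in> frontier K \<Longrightarrow> \<phi> x = x"
  shows "bij_betw \<phi> K K"
proof -
  have closed: "closed K" using compact by (rule compact_imp_closed)
  have fr: "frontier K = K - interior K" using closed by (simp add: frontier_def)
  have intK: "interior K \<subseteq> K" by (rule interior_subset)
  have open_image: "open (\<phi> ` U)" if U: "open U" "U \<subseteq> interior K" for U
  proof (subst open_subopen, clarify)
    fix x assume x: "x \<in> U"
    then obtain d where d: "d > 0" "inj_on \<phi> (K \<inter> ball x d)" using loc U(2) intK by blast
    have sub: "U \<inter> ball x d \<subseteq> K \<inter> ball x d" using U(2) intK by blast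
    have "open (\<phi> ` (U \<inter> ball x d))"
    proof (rule invariance_of_domain)
      show "continuous_on (U \<inter> ball x d) \<phi>" using continuous_on_subset[OF cont] sub by blast
      show "inj_on \<phi> (U \<inter> ball x d)" using inj_on_subset[OF d(2) sub] .
    qed (use U in auto)
    then show "\<exists>T. open T \<and> \<phi> x \<in> T \<and> T \<subseteq> \<phi> ` U"
      using x d(1) by (intro exI[of _ "\<phi> ` (U \<inter> ball x d)"]) auto
  qed
  have image_compact: "compact (\<phi> ` K)" using compact_continuous_image[OF cont compact] .
  txt \<open>A point of the image outside \<open>K\<close> that is extremal for a separating functional would be an
    interior point of the image.\<close>
  have image_sub: "\<phi> ` K \<subseteq> K"
  proof (rule ccontr)
    assume "\<not> \<phi> ` K \<subseteq> K"
    then obtain p where p: "p \<in> \<phi> ` K" "p \<notin> K" by blast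
    obtain a b where ab: "a \<bullet> p < b" "\<And>x. x \<in> K \<Longrightarrow> a \<bullet> x > b"
      using separating_hyperplane_closed_point[OF convex closed p(2)] by blast
    have "continuous_on (\<phi> ` K) (\<lambda>z. a \<bullet> z)" by (intro continuous_intros)
    then obtain q where q: "q \<in> \<phi> ` K" "\<And>z. z \<in> \<phi> ` K \<Longrightarrow> a \<bullet> q \<le> a \<bullet> z"
      using continuous_attains_inf[OF image_compact] p(1) by blast
    have "a \<bullet> q < b" using q(2)[OF p(1)] ab(1) by simp
    have "q \<notin> K" using ab(2)[of q] \<open>a \<bullet> q < b\<close> by auto
    obtain x where x: "x \<in> K" "q = \<phi> x" using q(1) by blast
    have "x \<in> interior K"
    proof (rule ccontr)
      assume "x \<notin> interior K"
      then have "q = x" using x bd[of x] fr by simp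
      then show False using x(1) \<open>q \<notin> K\<close> by simp
    qed
    then have "q \<in> \<phi> ` interior K" using x(2) by blast
    then obtain e where e: "e > 0" "ball q e \<subseteq> \<phi> ` interior K"
      using open_image[OF open_interior] open_contains_ball by blast
    obtain c where "c \<in> K" using interior_nonempty intK by blast
    then have "a \<noteq> 0" using ab p by force
    \<comment> \<open>A step of length \<open>e / 2\<close> against \<open>a\<close> stays in the
      ball but takes the functional below its minimum on the image.\<close>
    define z where "z = q - (e / (2 * norm a)) *\<^sub>R a"
    have "z \<in> ball q e" using e(1) \<open>a \<noteq> 0\<close> by (simp add: z_def dist_norm)
    then have "z \<in> \<phi> ` K" using e(2) intK by blast
    then have "a \<bullet> q \<le> a \<bullet> z" by (rule q(2))
    moreover have "a \<bullet> z < a \<bullet> q" using e(1) \<open>a \<noteq> 0\<close> by (simp add: z_def inner_diff_right)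
    ultimately show False by simp
  qed
  have image_int: "\<phi> ` interior K \<subseteq> interior K"
    using image_sub intK by (intro interior_maximal open_image) auto
  have "\<phi> ` interior K = interior K"
  proof -
    have "openin (top_of_set (interior K)) (\<phi> ` interior K)"
      using open_image[OF open_interior] image_int by (simp add: open_openin_trans)
    moreover have "closedin (top_of_set (interior K)) (\<phi> ` interior K)"
    proof -
      have "\<phi> x \<notin> interior K" if "x \<in> K" "x \<notin> interior K" for x
        using bd[of x] that fr by simp
      then have "\<phi> ` interior K = interior K \<inter> \<phi> ` K"
        using image_int intK by blast
      then show ?thesis using compact_imp_closed[OF image_compact] by (simp add: closedin_closed_Int)
    qed
    ultimately show ?thesis
      using convex_connected[OF convex_interior[OF convex]] interior_nonempty
      unfolding connected_clopen by blast
  qed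
  moreover have "frontier K \<subseteq> \<phi> ` K" using bd fr by force
  ultimately have surj: "\<phi> ` K = K" using image_sub fr intK by blast
  txt \<open>The set of points with several preimages is compact by local injectivity, and open since
    boundary points have only one preimage.\<close>
  define R where "R = {p \<in> K \<times> K. fst p \<noteq> snd p \<and> \<phi> (fst p) = \<phi> (snd p)}"
  define S where "S = (\<lambda>p. \<phi> (fst p)) ` R"
  obtain d where d: "\<And>x. x \<in> K \<Longrightarrow> d x > 0" "\<And>x. x \<in> K \<Longrightarrow> inj_on \<phi> (K \<inter> ball x (d x))"
    using loc by metis
  have "compact R"
  proof -
    have cont1: "continuous_on (K \<times> K) (\<lambda>p. \<phi> (fst p))" "continuous_on (K \<times> K) (\<lambda>p. \<phi> (snd p))"
      by (auto intro!: continuous_on_compose2[OF cont] continuous_intros)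
    have "closed {p \<in> K \<times> K. \<phi> (fst p) = \<phi> (snd p)}"
      by (rule continuous_closed_preimage_constant[OF continuous_on_diff[OF cont1] closed_Times[OF closed closed], of 0, simplified])
    then have "compact ((K \<times> K) \<inter> {p \<in> K \<times> K. \<phi> (fst p) = \<phi> (snd p)})"
      by (rule compact_Int_closed[OF compact_Times[OF compact compact]])
    moreover have "(K \<times> K) \<inter> {p \<in> K \<times> K. \<phi> (fst p) = \<phi> (snd p)} = {p \<in> K \<times> K. \<phi> (fst p) = \<phi> (snd p)}"
      by blast
    ultimately have "compact {p \<in> K \<times> K. \<phi> (fst p) = \<phi> (snd p)}" by (simp only:)
    \<comment> \<open>The open squares cover the diagonal and, by local injectivity, miss
      \<open>R\<close>; removing them from a compact set leaves exactly \<open>R\<close>.\<close>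
    moreover have "R = {p \<in> K \<times> K. \<phi> (fst p) = \<phi> (snd p)} - (\<Union>x\<in>K. ball x (d x) \<times> ball x (d x))"
    proof (intro equalityI subsetI)
      fix p assume p: "p \<in> R"
      have "p \<notin> ball x (d x) \<times> ball x (d x)" if "x \<in> K" for x
        using p inj_onD[OF d(2)[OF that], of "fst p" "snd p"] by (auto simp: R_def)
      then show "p \<in> {p \<in> K \<times> K. \<phi> (fst p) = \<phi> (snd p)} - (\<Union>x\<in>K. ball x (d x) \<times> ball x (d x))"
        using p by (auto simp: R_def)
    next
      fix p assume p: "p \<in> {p \<in> K \<times> K. \<phi> (fst p) = \<phi> (snd p)} - (\<Union>x\<in>K. ball x (d x) \<times> ball x (d x))"
      have "fst p \<noteq> snd p" using p d(1)[of "fst p"] by (cases p) auto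
      then show "p \<in> R" using p by (auto simp: R_def)
    qed
    ultimately show ?thesis by (auto intro!: compact_diff open_UN open_Times)
  qed
  then have "compact S"
    unfolding S_def
    by (rule compact_continuous_image[rotated])
      (auto intro!: continuous_on_compose2[OF cont] continuous_intros simp: R_def)
  moreover have "open S"
  proof (subst open_subopen, clarify)
    fix y assume "y \<in> S"
    then obtain u w where uw: "u \<in> K" "w \<in> K" "u \<noteq> w" "\<phi> u = y" "\<phi> w = y"
      by (auto simp: S_def R_def)
    \<comment> \<open>A boundary point is its own value. A partner in the interior has its value in
      the interior, and a partner on the boundary is fixed too, so neither can share that
      value.\<close>
    have int: "s \<in> interior K" if st: "s \<in> K" "t \<in> K" "s \<noteq> t" "\<phi> s = \<phi> t" for s t
    proof (rule ccontr)
      assume s: "s \<notin> interior K"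
      then have \<phi>s: "\<phi> s = s" using bd[of s] fr st(1) by simp
      show False
      proof (cases "t \<in> interior K")
        case True
        then have "\<phi> t \<in> interior K" using image_int by blast
        then show False using s \<phi>s st(4) by simp
      next
        case False
        then have "\<phi> t = t" using bd[of t] fr st(2) by simp
        then show False using \<phi>s st(3,4) by simp
      qed
    qed
    have uwint: "u \<in> interior K" "w \<in> interior K"
      using int[OF uw(1,2,3)] int[OF uw(2,1) uw(3)[symmetric]] uw(4,5) by simp_all
    obtain U V where UV: "open U" "open V" "u \<in> U" "w \<in> V" "U \<inter> V = {}"
      using hausdorff[OF uw(3)] by blast
    have "\<phi> ` (U \<inter> interior K) \<inter> \<phi> ` (V \<inter> interior K) \<subseteq> S"
    proof
      fix z assume "z \<in> \<phi> ` (U \<inter> interior K) \<inter> \<phi> ` (V \<inter> interior K)"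
      then obtain s t where "s \<in> U" "s \<in> interior K" "t \<in> V" "t \<in> interior K" "z = \<phi> s" "z = \<phi> t" by blast
      then show "z \<in> S" using UV(5) intK by (auto simp: S_def R_def intro!: image_eqI[of _ _ "(s, t)"])
    qed
    moreover have "open (\<phi> ` (U \<inter> interior K) \<inter> \<phi> ` (V \<inter> interior K))"
      by (intro open_Int open_image open_interior Int_lower2 UV(1,2))
    moreover have "y \<in> \<phi> ` (U \<inter> interior K) \<inter> \<phi> ` (V \<inter> interior K)"
      using uw(4,5) UV(3,4) uwint
      by (intro IntI image_eqI[of y \<phi> u] image_eqI[of y \<phi> w]) simp_all
    ultimately show "\<exists>T. open T \<and> y \<in> T \<and> T \<subseteq> S" by (intro exI conjI)
  qed
  \<comment> \<open>Connectedness of the whole space leaves two cases, and boundedness excludes the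
    second.\<close>
  ultimately have "S = {} \<or> S = UNIV"
    using clopen compact_imp_closed by blast
  then have "S = {}" using \<open>compact S\<close> compact_imp_bounded not_bounded_UNIV by metis
  then have "inj_on \<phi> K" by (force simp: S_def R_def inj_on_def)
  with surj show ?thesis by (simp add: bij_betw_def)
qed

text \<open>An injective linear map stretches every vector by at least some \<open>B > 0\<close>. A
  strict derivative estimate with error \<open>B / 2\<close> cannot compensate this.\<close>

lemma (in convex_body) locally_injective_if_derivative_injective:
  fixes f :: "'a \<Rightarrow> 'b::euclidean_space"
  assumes f: "Ck 1 K f" and x: "x \<in> K"
    and inj: "\<And>v. frechet_derivative f (at x within K) v = 0 \<Longrightarrow> v = 0"
  shows "\<exists>d>0. inj_on f (K \<inter> ball x d)"
proof -
  let ?D = "\<lambda>x. frechet_derivative f (at x within K)"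
  have D: "(f has_derivative ?D z) (at z within K)" if "z \<in> K" for z
    using Ck_has_frechet_derivative[of 0 K f z] f that by simp
  have cont: "continuous_on K (\<lambda>z. ?D z v)" for v
    using Ck_frechet_derivative[of 0 f v] f by simp
  have lin: "linear (?D x)" using D[OF x] by (rule has_derivative_linear)
  have "inj (?D x)" using inj by (simp add: linear_injective_0[OF lin])
  then obtain B where B: "B > 0" "\<And>v. B * norm v \<le> norm (?D x v)"
    using linear_inj_bounded_below_pos[OF lin] by blast
  obtain d where d: "d > 0" "\<And>u w. u \<in> K \<inter> ball x d \<Longrightarrow> w \<in> K \<inter> ball x d \<Longrightarrow>
        norm (f u - f w - ?D x (u - w)) \<le> B / 2 * norm (u - w)"
    using C1_strict_derivative[OF convex D cont x, of "B / 2"] B(1) by (metis half_gt_zero)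
  have "u = w" if "u \<in> K \<inter> ball x d" "w \<in> K \<inter> ball x d" "f u = f w" for u w
  proof -
    have "B * norm (u - w) \<le> B / 2 * norm (u - w)"
      using d(2)[OF that(1,2)] B(2)[of "u - w"] that(3) by simp
    then have "norm (u - w) \<le> 0" using B(1) by simp
    then show ?thesis by simp
  qed
  then show ?thesis using d(1) by (intro exI[of _ d]) (auto intro: inj_onI)
qed

text \<open>The derivative is taken within the image of \<open>S\<close>, so the inverse rule
  applies at boundary points. A left inverse of \<open>A\<close> turns the error of \<open>f\<close>
  into the error of \<open>g\<close>, once \<open>norm (u - x)\<close> is controlled by
  \<open>norm (f u - f x)\<close>.\<close>

lemma has_derivative_inverse_within_image:
  fixes f :: "'a::real_normed_vector \<Rightarrow> 'b::real_normed_vector"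
  assumes f: "(f has_derivative A) (at x within S)" and x: "x \<in> S"
    and B: "bounded_linear B" "\<And>v. B (A v) = v"
    and g: "continuous_on (f ` S) g" "\<And>u. u \<in> S \<Longrightarrow> g (f u) = u"
  shows "(g has_derivative B) (at (f x) within f ` S)"
  unfolding has_derivative_within_alt
proof (intro conjI allI impI B(1))
  fix e :: real assume e: "e > 0"
  obtain N where N: "N > 0" "\<And>z. norm (B z) \<le> norm z * N"
    using bounded_linear.pos_bounded[OF B(1)] by blast
  \<comment> \<open>The first bound lets the error be absorbed, giving
    \<open>norm (u - x) \<le> 2 * N * norm (f u - f x)\<close>. The second makes the resulting
    factor \<open>2 * N * N * e'\<close> at most \<open>e\<close>.\<close>
  define e' where "e' = min (1 / (2 * N)) (e / (2 * N * N))"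
  have e': "e' > 0" "N * e' \<le> 1 / 2" "2 * N * N * e' \<le> e"
    using e N(1) by (auto simp: e'_def min_def field_simps)
  obtain d where d: "d > 0" "\<And>u. u \<in> S \<Longrightarrow> norm (u - x) < d \<Longrightarrow>
      norm (f u - f x - A (u - x)) \<le> e' * norm (u - x)"
    using f e'(1) unfolding has_derivative_within_alt by metis
  obtain d' where d': "d' > 0" "\<And>y. y \<in> f ` S \<Longrightarrow> dist y (f x) < d' \<Longrightarrow> dist (g y) (g (f x)) < d"
    using g(1) x d(1) unfolding continuous_on_iff by (metis imageI)
  show "\<exists>d>0. \<forall>y\<in>f ` S. norm (y - f x) < d \<longrightarrow>
      norm (g y - g (f x) - B (y - f x)) \<le> e * norm (y - f x)"
  proof (intro exI[of _ d'] conjI ballI impI d'(1))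
    fix y assume y: "y \<in> f ` S" "norm (y - f x) < d'"
    then obtain u where u: "u \<in> S" "y = f u" by blast
    let ?q = "f u - f x - A (u - x)"
    have "norm (u - x) < d" using d'(2)[OF y(1)] y(2) u x g(2) by (simp add: dist_norm)
    then have q: "norm ?q \<le> e' * norm (u - x)" by (rule d(2)[OF u(1)])
    have Bq: "B ?q = B (f u - f x) - (u - x)"
      using linear_diff[OF bounded_linear.linear[OF B(1)], of "f u - f x" "A (u - x)"] B(2) by simp
    have "norm (B ?q) \<le> N * norm ?q" using N(2)[of ?q] by (simp only: mult.commute)
    also have "\<dots> \<le> N * (e' * norm (u - x))" using q N(1) by (intro mult_left_mono) auto
    finally have Bqn: "norm (B ?q) \<le> N * e' * norm (u - x)" by (simp only: mult.assoc)
    have "norm (u - x) \<le> norm (B (f u - f x)) + norm (B ?q)"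
      using norm_triangle_ineq4[of "B (f u - f x)" "B ?q"] Bq by simp
    also have "\<dots> \<le> norm (f u - f x) * N + 1 / 2 * norm (u - x)"
      using N(2)[of "f u - f x"] Bqn mult_right_mono[OF e'(2), of "norm (u - x)"] by simp
    finally have "norm (u - x) \<le> 2 * N * norm (f u - f x)" by (simp add: mult_ac)
    then have "N * e' * norm (u - x) \<le> N * e' * (2 * N * norm (f u - f x))"
      using N(1) e'(1) by (intro mult_left_mono) auto
    also have "\<dots> = 2 * N * N * e' * norm (f u - f x)" by (simp add: mult_ac)
    also have "\<dots> \<le> e * norm (f u - f x)" using e'(3) by (intro mult_right_mono) auto
    finally have "norm (B ?q) \<le> e * norm (f u - f x)" using Bqn by simp
    then show "norm (g y - g (f x) - B (y - f x)) \<le> e * norm (y - f x)"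
      using u x g(2) by (simp add: Bq norm_minus_commute)
  qed
qed

text \<open>Cramer's rule exhibits the inverse as a rational function of the coefficients.\<close>

lemma Ck_inv_linear:
  fixes M :: "'a::real_normed_vector \<Rightarrow> real^'n \<Rightarrow> real^'n"
  assumes lin: "\<And>x. x \<in> K \<Longrightarrow> linear (M x)" and inj: "\<And>x. x \<in> K \<Longrightarrow> inj (M x)"
    and M: "\<And>v. Ck k K (\<lambda>x. M x v)"
  shows "Ck k K (\<lambda>x. inv (M x) v)"
proof -
  define A where "A = (\<lambda>x. matrix (M x))"
  have comp: "Ck k K (\<lambda>x. f x $ i)" if "Ck k K f" for f :: "'a \<Rightarrow> real^'n" and i
    using Ck_bounded_linear_compose[OF bounded_linear_vec_nth that] .
  have A: "Ck k K (\<lambda>x. A x $ i $ j)" for i j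
    using comp[OF M, of "axis j 1" i] by (simp add: A_def matrix_def)
  have Ck_det: "Ck k K (\<lambda>x. det (C x))" if "\<And>i j. Ck k K (\<lambda>x. C x $ i $ j)" for C :: "'a \<Rightarrow> real^'n^'n"
    unfolding det_def by (intro Ck_sum Ck_mult Ck_const Ck_prod that)
  have det0: "det (A x) \<noteq> 0" if "x \<in> K" for x
    using det_nz_iff_inj[OF lin[OF that]] inj[OF that] by (simp add: A_def)
  \<comment> \<open>\<open>C i x\<close> is \<open>A x\<close> with column \<open>i\<close> replaced
    by \<open>v\<close>, the numerator matrix of Cramer's rule.\<close>
  define C where "C = (\<lambda>i x. (\<chi> p q. if q = i then v $ p else A x $ p $ q))"
  have C: "Ck k K (\<lambda>x. C i x $ p $ q)" for i p q
    by (cases "q = i") (simp_all add: C_def Ck_const A)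
  have "inv (M x) v = (\<Sum>i\<in>UNIV. (det (C i x) * inverse (det (A x))) *\<^sub>R axis i 1)" if x: "x \<in> K" for x
  proof -
    have "surj (M x)" using linear_injective_imp_surjective[OF lin[OF x] inj[OF x]] by simp
    then have "M x (inv (M x) v) = v" by (rule surj_f_inv_f)
    then have "A x *v inv (M x) v = v" by (simp add: A_def lin[OF x])
    then have "inv (M x) v = (\<chi> i. det (C i x) / det (A x))"
      by (simp add: cramer[OF det0[OF x]] C_def)
    then show ?thesis
      by (simp add: vec_eq_iff axis_def if_distrib[of "\<lambda>z. _ * z"] divide_inverse cong: if_cong)
  qed
  moreover have "Ck k K (\<lambda>x. \<Sum>i\<in>UNIV. (det (C i x) * inverse (det (A x))) *\<^sub>R axis i (1::real))"
    by (intro Ck_sum Ck_scaleR Ck_mult Ck_inverse Ck_det C A Ck_const det0)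
  ultimately show ?thesis by (rule Ck_cong)
qed

lemma (in convex_body) Ck_has_frechet_linear:
  "Ck (Suc k) K f \<Longrightarrow> x \<in> K \<Longrightarrow> linear (frechet_derivative f (at x within K))"
  using Ck_has_frechet_derivative has_derivative_linear by blast

text \<open>The derivative of the inverse at \<open>y\<close> is the inverse of the derivative of
  \<open>\<phi>\<close>, taken at the preimage of \<open>y\<close>. It is a composition of the
  inverse, of order \<open>j\<close> by induction, with a map of order \<open>j\<close> built from
  the derivative of \<open>\<phi>\<close>; so the inverse gains one order.\<close>

lemma Ck_inv_into:
  fixes K :: "(real^'n) set" and \<phi> :: "real^'n \<Rightarrow> real^'n"
  assumes K: "convex_body K" and bij: "bij_betw \<phi> K K" and \<phi>: "Ck k K \<phi>" "1 \<le> k"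
    and inj: "\<And>x v. x \<in> K \<Longrightarrow> frechet_derivative \<phi> (at x within K) v = 0 \<Longrightarrow> v = 0"
  shows "j \<le> k \<Longrightarrow> Ck j K (inv_into K \<phi>)"
proof (induction j)
  case 0
  have "continuous_on (\<phi> ` K) (inv_into K \<phi>)"
    using bij_betw_imp_inj_on[OF bij]
    by (intro continuous_on_inv[OF Ck_continuous_on[OF \<phi>(1)] convex_body.compact[OF K]]) simp
  then show ?case using bij by (simp add: bij_betw_def)
next
  case (Suc j)
  interpret convex_body K by fact
  let ?\<psi> = "inv_into K \<phi>" and ?D = "\<lambda>x. frechet_derivative \<phi> (at x within K)"
  have \<psi>: "?\<psi> y \<in> K" "\<phi> (?\<psi> y) = y" if "y \<in> K" for y
    using bij that bij_betw_apply[OF bij_betw_inv_into[OF bij]] by (auto simp: bij_betw_def f_inv_into_f)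
  have \<phi>j: "Ck (Suc j) K \<phi>" using Ck_mono[OF \<phi>(1) Suc.prems] .
  note lin = Ck_has_frechet_linear[OF \<phi>j]
  have injD: "inj (?D x)" if "x \<in> K" for x
    using inj[OF that] by (simp add: linear_injective_0[OF lin[OF that]])
  have IH: "Ck j K ?\<psi>" using Suc by simp
  have "(?\<psi> has_derivative inv (?D (?\<psi> y))) (at y within K)" if y: "y \<in> K" for y
  proof -
    have "(?\<psi> has_derivative inv (?D (?\<psi> y))) (at (\<phi> (?\<psi> y)) within \<phi> ` K)"
    proof (rule has_derivative_inverse_within_image)
      show "(\<phi> has_derivative ?D (?\<psi> y)) (at (?\<psi> y) within K)"
        using Ck_has_frechet_derivative[OF \<phi>j \<psi>(1)[OF y]] .
      show "bounded_linear (inv (?D (?\<psi> y)))"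
        using inj_linear_imp_inv_linear[OF lin[OF \<psi>(1)[OF y]] injD[OF \<psi>(1)[OF y]]]
        by (simp add: linear_linear)
      show "continuous_on (\<phi> ` K) ?\<psi>" using Ck_continuous_on[OF IH] bij by (simp add: bij_betw_def)
      show "inv (?D (?\<psi> y)) (?D (?\<psi> y) v) = v" for v
        using inv_f_f[OF injD[OF \<psi>(1)[OF y]]] .
      show "?\<psi> (\<phi> u) = u" if "u \<in> K" for u
        using that bij by (simp add: bij_betw_def inv_into_f_f)
    qed (rule \<psi>(1)[OF y])
    then show ?thesis using \<psi>(2)[OF y] bij by (simp add: bij_betw_def)
  qed
  moreover have "Ck j K (\<lambda>y. inv (?D (?\<psi> y)) v)" for v
  proof (rule Ck_compose[of ?\<psi> K K j "\<lambda>x. inv (?D x) v"])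
    show "?\<psi> ` K \<subseteq> K" using \<psi>(1) by blast
    show "Ck j K (\<lambda>x. inv (?D x) v)"
      by (rule Ck_inv_linear[OF lin injD Ck_frechet_derivative[OF \<phi>j]])
  qed (rule IH)
  ultimately show ?case by (rule Ck_SucI)
qed

section \<open>Diffeomorphisms fixing the boundary\<close>

context convex_body
begin

text \<open>The identity is cut off outside \<open>K\<close> because members of
  \<open>Cr_space\<close> vanish there.\<close>

definition id_within :: "'a \<Rightarrow> 'a" where
  "id_within = (\<lambda>x. if x \<in> K then x else 0)"

lemma id_within_in_Cr_space: "id_within \<in> Cr_space K r"
proof -
  have "Ck k K (\<lambda>x. x)" for k by (rule Ck_bounded_linear[OF bounded_linear_ident])
  then have "Ck k K id_within" for k by (rule Ck_cong[rotated]) (simp add: id_within_def)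
  then show ?thesis by (simp add: Cr_space_iff id_within_def)
qed

text \<open>The chain rule for the inverse after \<open>\<phi>\<close> gives the derivative of
  \<open>\<phi>\<close> a left inverse. At boundary points this relies on uniqueness of derivatives
  within \<open>K\<close>.\<close>

lemma nondegenerate_if_Diff_frontier:
  assumes r: "1 \<le> r" and \<phi>: "\<phi> \<in> Diff_frontier K r"
  shows "\<phi> \<in> nondegenerate r"
proof -
  let ?\<psi> = "inv_into K \<phi>" and ?D = "\<lambda>f x. frechet_derivative f (at x within K)"
  have 1: "enat (Suc 0) \<le> r" using r by (simp add: one_enat_def)
  have \<phi>1: "\<phi> \<in> Cr_space K r" "bij_betw \<phi> K K" and \<psi>: "Cr_on K r ?\<psi>"
    using \<phi> by (auto simp: Diff_frontier_def)
  have C1: "Ck (Suc 0) K \<phi>" "Ck (Suc 0) K ?\<psi>"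
    using Cr_space_Ck[OF \<phi>1(1) 1] \<psi> 1 by (auto simp: Cr_on_iff)
  have "v = 0" if x: "x \<in> K" and v: "?D \<phi> x v = 0" for x v
  proof -
    have "((\<lambda>z. ?\<psi> (\<phi> z)) has_derivative (\<lambda>v. ?D ?\<psi> (\<phi> x) (?D \<phi> x v))) (at x within K)"
      by (rule has_derivative_in_compose2[OF Ck_has_frechet_derivative[OF C1(2)] _ x
            Ck_has_frechet_derivative[OF C1(1) x]]) (simp_all add: bij_betw_imp_surj_on[OF \<phi>1(2)])
    moreover have "((\<lambda>z. ?\<psi> (\<phi> z)) has_derivative (\<lambda>v. v)) (at x within K)"
      by (rule has_derivative_transform[OF x _ has_derivative_ident])
        (simp add: inv_into_f_f[OF bij_betw_imp_inj_on[OF \<phi>1(2)]])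
    ultimately have "(\<lambda>v. ?D ?\<psi> (\<phi> x) (?D \<phi> x v)) = (\<lambda>v. v)"
      by (rule has_derivative_unique_within_convex[OF convex interior_nonempty x])
    then have "v = ?D ?\<psi> (\<phi> x) (?D \<phi> x v)" by (simp add: fun_eq_iff)
    also have "\<phi> x \<in> K" using x bij_betwE[OF \<phi>1(2)] by blast
    then have "?D ?\<psi> (\<phi> x) (?D \<phi> x v) = 0"
      unfolding v by (rule linear_0[OF Ck_has_frechet_linear[OF C1(2)]])
    finally show ?thesis .
  qed
  then show ?thesis using \<phi>1(1) by (auto simp: nondegenerate_def)
qed

end

text \<open>Within C^r(K,E), the second set only encodes that the boundary is fixed. Bijectivity and
  regularity of the inverse come from nondegeneracy; the latter uses Cramer's rule and hence the
  coordinates of \<open>real^'n\<close>.\<close>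

lemma Diff_frontier_eq:
  fixes K :: "(real^'n) set"
  assumes K: "convex_body K" and r: "1 \<le> r"
  shows "Diff_frontier K r =
    convex_body.nondegenerate K r \<inter> {\<phi>. \<phi> - convex_body.id_within K \<in> Cr_frontier K r}"
proof -
  interpret convex_body K by fact
  have fr: "frontier K \<subseteq> K" using frontier_subset_closed[OF compact_imp_closed[OF compact]] .
  have diff: "\<phi> - id_within \<in> Cr_frontier K r \<longleftrightarrow> (\<forall>x\<in>frontier K. \<phi> x = x)"
    if "\<phi> \<in> Cr_space K r" for \<phi>
    using subspace_diff[OF subspace_Cr_space that id_within_in_Cr_space] fr
    by (auto simp: Cr_frontier_def id_within_def fun_diff_def)
  have "\<phi> \<in> Diff_frontier K r" if \<phi>: "\<phi> \<in> nondegenerate r" and bdry: "\<forall>x\<in>frontier K. \<phi> x = x" for \<phi>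
  proof -
    have Cr: "\<phi> \<in> Cr_space K r" and inj: "\<And>x v. x \<in> K \<Longrightarrow> frechet_derivative \<phi> (at x within K) v = 0 \<Longrightarrow> v = 0"
      using \<phi> by (auto simp: nondegenerate_def)
    have C1: "Ck 1 K \<phi>" using Cr_space_Ck[OF Cr] r by (simp add: one_enat_def)
    have bij: "bij_betw \<phi> K K"
    proof (rule bij_betw_if_locally_injective)
      show "continuous_on K \<phi>" using C1 by (rule Ck_continuous_on)
      show "\<exists>d>0. inj_on \<phi> (K \<inter> ball x d)" if "x \<in> K" for x
        by (rule locally_injective_if_derivative_injective[OF C1 that inj[OF that]])
    qed (use bdry in blast)
    have "Ck k K (inv_into K \<phi>)" if k: "enat k \<le> r" for k
    proof (cases "k = 0")
      case True
      \<comment> \<open>\<open>Ck_inv_into\<close> starts from a map of order at least 1, so order 0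
        is obtained by applying it to \<open>\<phi>\<close> as a map of order 1.\<close>
      show ?thesis unfolding True by (rule Ck_inv_into[OF K bij C1 order_refl inj zero_le])
    next
      case False
      then have "1 \<le> k" by simp
      then show ?thesis by (rule Ck_inv_into[OF K bij Cr_space_Ck[OF Cr k] _ inj order_refl])
    qed
    then show ?thesis using Cr bij bdry by (simp add: Diff_frontier_def Cr_on_iff)
  qed
  moreover have "\<phi> \<in> Cr_space K r" "\<forall>x\<in>frontier K. \<phi> x = x" if "\<phi> \<in> Diff_frontier K r" for \<phi>
    using that by (auto simp: Diff_frontier_def)
  moreover have "\<phi> \<in> Cr_space K r" if "\<phi> \<in> nondegenerate r" for \<phi> :: "real^'n \<Rightarrow> real^'n"
    using that by (simp add: nondegenerate_def)
  ultimately show ?thesis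
    using nondegenerate_if_Diff_frontier[OF r] diff by blast
qed

theorem lemma3p1:
  fixes K :: "(real ^ 'n) set" and r :: enat
  assumes "compact K" and "convex K" and "interior K \<noteq> {}" and "1 \<le> r"
  defines "X \<equiv> (Cr_topology K r :: (real ^ 'n \<Rightarrow> real ^ 'n) topology)"
  shows "smooth_submanifold X X (lcs_atlas X) (Cr_frontier K r) (Diff_frontier K r) \<and>
    submanifold_has_global_chart X X (lcs_atlas X) (Cr_frontier K r) (Diff_frontier K r)"
proof -
  have K: "convex_body K" using assms(1-3) by unfold_locales
  interpret convex_body K by (rule K)
  show ?thesis
    unfolding X_def
  proof (rule translated_subspace_submanifold[where W = "nondegenerate r" and c = id_within])
    show "openin (Cr_topology K r) (nondegenerate r)" using assms(4) by (rule openin_nondegenerate)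
  qed (simp_all add: locally_convex_space_Cr subspace_Cr_frontier closedin_Cr_frontier
      id_within_in_Cr_space Diff_frontier_eq[OF K assms(4)])
qed

end
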